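(* Fix $p\in(0,1]$. For each $n\geq 2$, choose a Coxeter element $c^{(n)}$ of the Coxeter group $B_n$, and assume that the limit $\overline{r}=\lim_{n\to\infty}\frac{1}{n}r(c^{(n)})$ exists. Then, as $n\to\infty$, \[\mathcal E\left(\mathrm{Camb}_{c^{(n)}}\right)\leq \frac{1}{p}\left(3+2\sqrt{(1-p)(2-\overline r)(1+\overline{r})}\right)n+o(n).\]
   Context: $B_n$ is the hyperoctahedral group with simple reflections $s_0,\ldots,s_{n-1}$; its Coxeter graph is the path with edges $\{s_i,s_{i+1}\}$, $0\le i\le n-2$, with $m(s_0,s_1)=4$, $m(s_i,s_{i+1})=3$ for $i\ge1$, and nonadjacent simple reflections commuting. For a finite Coxeter group $W$ with simple reflections $S$, a Coxeter element is a product $c=s_{i_1}\cdots s_{i_r}$ of all simple reflections, each exactly once, in some order. Such $c$ determines an orientation of the Coxeter graph: edge $\{s,s'\}$ is oriented $s\to s'$ if $s$ appears to the left of $s'$ in a (any) such word for $c$. $r(c)$ is the number of edges $\{s_i,s_{i+1}\}$ oriented from $s_i$ to $s_{i+1}$. The right weak order on $W$: $u\le v$ if some reduced word for $v$ has a reduced word for $u$ as a prefix. For a fixed word $\mathsf c$ for $c$, the $\mathsf c$-sorting word of $w$ is the reduced word for $w$ that is lexicographically first (by positions) among reduced words for $w$ occurring as subwords of $\mathsf c^\infty$; writing it as $\mathsf w^{\langle1\rangle}\mathsf w^{\langle2\rangle}\cdots$ with $\mathsf w^{\langle i\rangle}$ taken from the $i$-th copy of $\mathsf c$, $w$ is $c$-sortable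 if the letter sets of the $\mathsf w^{\langle i\rangle}$ are weakly decreasing under inclusion. $\mathrm{Camb}_c$ is the lattice of $c$-sortable elements under the weak order. For a finite lattice $L$, the Ungarian Markov chain (probability $p$) moves from $x$ to $\bigwedge(\{x\}\cup T)$, where $T$ contains each element covered by $x$ independently with probability $p$; $\mathcal E(L)$ is the expected number of steps from the top element to the bottom element. *)

theory Defs
  imports
    "HOL-Library.Sublist"
    "HOL-Library.Landau_Symbols"
    "HOL-Combinatorics.Permutations"
    "HOL-Algebra.Lattice"
    "HOL-Probability.Probability"
begin

section \<open>The hyperoctahedral group and its words\<close>

text \<open>The group \<open>B\<^sub>n\<close> is realised as the group of signed permutations of \<open>{-n..n}\<close> (extended by the
  identity to all integers) under composition. Words are lists of indices: the index \<open>i < n\<close>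
  stands for the simple reflection \<open>s\<^sub>i\<close>, and the leftmost letter is the outermost factor.\<close>

definition hyperoctahedral :: "nat \<Rightarrow> (int \<Rightarrow> int) set" where
  "hyperoctahedral n = {w. w permutes {- int n..int n} \<and> (\<forall>x. w (- x) = - w x)}"

definition simple_refl :: "nat \<Rightarrow> int \<Rightarrow> int" where
  "simple_refl i =
     (if i = 0 then Transposition.transpose (-1) 1
      else Transposition.transpose (int i) (int i + 1) \<circ> Transposition.transpose (- int i) (- (int i + 1)))"

definition word_prod :: "nat list \<Rightarrow> int \<Rightarrow> int" where
  "word_prod ws = foldr (\<lambda>i w. simple_refl i \<circ> w) ws id"

definition word_for :: "nat \<Rightarrow> nat list \<Rightarrow> (int \<Rightarrow> int) \<Rightarrow> bool" where
  "word_for n ws w \<longleftrightarrow> set ws \<subseteq> {..<n} \<and> word_prod ws = w"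

definition reduced_word_for :: "nat \<Rightarrow> nat list \<Rightarrow> (int \<Rightarrow> int) \<Rightarrow> bool" where
  "reduced_word_for n ws w \<longleftrightarrow>
     word_for n ws w \<and> (\<forall>vs. word_for n vs w \<longrightarrow> length ws \<le> length vs)"

definition right_weak_le :: "nat \<Rightarrow> (int \<Rightarrow> int) \<Rightarrow> (int \<Rightarrow> int) \<Rightarrow> bool" where
  "right_weak_le n u v \<longleftrightarrow>
     (\<exists>us vs. reduced_word_for n us u \<and> reduced_word_for n vs v \<and> prefix us vs)"


section \<open>Coxeter elements\<close>

definition coxeter_word_for :: "nat \<Rightarrow> nat list \<Rightarrow> (int \<Rightarrow> int) \<Rightarrow> bool" where
  "coxeter_word_for n cw c \<longleftrightarrow> distinct cw \<and> set cw = {..<n} \<and> word_prod cw = c"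

definition coxeter_elements :: "nat \<Rightarrow> (int \<Rightarrow> int) set" where
  "coxeter_elements n = {c. \<exists>cw. coxeter_word_for n cw c}"

text \<open>The fixed word for a Coxeter element. Two such words differ by commutations of commuting
  letters only, so neither the orientation of the Coxeter graph nor sortability depends on
  this choice.\<close>

definition coxeter_word :: "nat \<Rightarrow> (int \<Rightarrow> int) \<Rightarrow> nat list" where
  "coxeter_word n c = (SOME cw. coxeter_word_for n cw c)"

definition appears_left_of :: "'b list \<Rightarrow> 'b \<Rightarrow> 'b \<Rightarrow> bool" where
  "appears_left_of xs a b \<longleftrightarrow> (\<exists>j k. j < k \<and> k < length xs \<and> xs ! j = a \<and> xs ! k = b)"

definition cox_r :: "nat \<Rightarrow> (int \<Rightarrow> int) \<Rightarrow> nat" where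
  "cox_r n c = card {i. i + 1 < n \<and> appears_left_of (coxeter_word n c) i (i + 1)}"


section \<open>Sorting words and the Cambrian lattice\<close>

text \<open>The infinite word \<open>ccc\<dots>\<close>; position \<open>k\<close> lies in the copy of \<open>c\<close> with number
  \<open>k div length cw\<close>, counting copies from \<open>0\<close>.\<close>

definition word_power_inf :: "nat list \<Rightarrow> nat \<Rightarrow> nat" where
  "word_power_inf cw k = cw ! (k mod length cw)"

text \<open>Subwords of the infinite word are recorded by their strictly increasing lists of positions,
  and it is these lists that are compared lexicographically.\<close>

definition reduced_positions :: "nat \<Rightarrow> nat list \<Rightarrow> (int \<Rightarrow> int) \<Rightarrow> nat list set" where
  "reduced_positions n cw w =
     {ps. sorted_wrt (<) ps \<and> reduced_word_for n (map (word_power_inf cw) ps) w}"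

definition sorting_positions :: "nat \<Rightarrow> nat list \<Rightarrow> (int \<Rightarrow> int) \<Rightarrow> nat list \<Rightarrow> bool" where
  "sorting_positions n cw w ps \<longleftrightarrow>
     ps \<in> reduced_positions n cw w \<and>
     (\<forall>qs \<in> reduced_positions n cw w. qs \<noteq> ps \<longrightarrow> (ps, qs) \<in> lexord less_than)"

definition block_letters :: "nat list \<Rightarrow> nat list \<Rightarrow> nat \<Rightarrow> nat set" where
  "block_letters cw ps i = word_power_inf cw ` {k \<in> set ps. k div length cw = i}"

definition sortable :: "nat \<Rightarrow> (int \<Rightarrow> int) \<Rightarrow> (int \<Rightarrow> int) \<Rightarrow> bool" where
  "sortable n c w \<longleftrightarrow>
     w \<in> hyperoctahedral n \<and>
     (\<exists>ps. sorting_positions n (coxeter_word n c) w ps \<and>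
        (\<forall>i. block_letters (coxeter_word n c) ps (Suc i) \<subseteq> block_letters (coxeter_word n c) ps i))"

definition Camb :: "nat \<Rightarrow> (int \<Rightarrow> int) \<Rightarrow> (int \<Rightarrow> int) gorder" where
  "Camb n c = \<lparr>carrier = {w. sortable n c w}, eq = (=), le = right_weak_le n\<rparr>"


section \<open>Markov chains\<close>

text \<open>The law on \<open>nat \<Rightarrow> 'a\<close> of the discrete-time Markov chain with initial distribution \<open>\<mu>\<close> and
  transition kernel \<open>K\<close>, obtained from the Ionescu-Tulcea theorem.\<close>

definition markov_step :: "'a pmf \<Rightarrow> ('a \<Rightarrow> 'a pmf) \<Rightarrow> nat \<Rightarrow> (nat \<Rightarrow> 'a) \<Rightarrow> 'a measure" where
  "markov_step \<mu> K i \<omega> = (case i of 0 \<Rightarrow> measure_pmf \<mu> | Suc j \<Rightarrow> measure_pmf (K (\<omega> j)))"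

lemma Ionescu_Tulcea_markov_step:
  fixes \<mu> :: "'a pmf"
  shows "Ionescu_Tulcea (markov_step \<mu> K) (\<lambda>_. count_space UNIV)"
proof (rule Ionescu_Tulcea.intro)
  fix i
  show "markov_step \<mu> K i \<in> PiM {0..<i} (\<lambda>_. count_space UNIV) \<rightarrow>\<^sub>M subprob_algebra (count_space UNIV)"
  proof (cases i)
    case 0
    then show ?thesis
      by (auto simp: markov_step_def[abs_def] measure_pmf_in_subprob_algebra)
  next
    case (Suc j)
    have *: "(\<lambda>\<omega>. \<omega> j) \<in> PiM {0..<i} (\<lambda>_. count_space UNIV) \<rightarrow>\<^sub>M count_space UNIV"
      using Suc by (intro measurable_component_singleton) auto
    have "(\<lambda>x. measure_pmf (K x)) \<in> count_space UNIV \<rightarrow>\<^sub>M subprob_algebra (count_space UNIV)"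
      by (auto simp: measure_pmf_in_subprob_algebra)
    from measurable_compose[OF * this]
    have "(\<lambda>\<omega>. measure_pmf (K (\<omega> j)))
        \<in> PiM {0..<i} (\<lambda>_. count_space UNIV) \<rightarrow>\<^sub>M subprob_algebra (count_space UNIV)" .
    then show ?thesis
      by (simp add: markov_step_def[abs_def] Suc)
  qed
next
  fix i and x :: "nat \<Rightarrow> 'a"
  show "prob_space (markov_step \<mu> K i x)"
    by (cases i) (auto simp: markov_step_def prob_space_measure_pmf)
qed

definition markov_paths :: "'a pmf \<Rightarrow> ('a \<Rightarrow> 'a pmf) \<Rightarrow> (nat \<Rightarrow> 'a) measure" where
  "markov_paths \<mu> K =
     projective_family.lim UNIV (Ionescu_Tulcea.CI (markov_step \<mu> K) (\<lambda>_. count_space UNIV))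
       (\<lambda>_. count_space UNIV)"

text \<open>The number of steps until a trajectory first visits \<open>y\<close>; it is \<open>\<infinity>\<close> if there is no visit.\<close>

definition hitting_time :: "'a \<Rightarrow> (nat \<Rightarrow> 'a) \<Rightarrow> ennreal" where
  "hitting_time y \<omega> = (INF t \<in> {t. \<omega> t = y}. of_nat t)"


section \<open>The Ungarian Markov chain\<close>

definition covered_by :: "'a gorder \<Rightarrow> 'a \<Rightarrow> 'a set" where
  "covered_by L x =
     {y \<in> carrier L. y \<sqsubset>\<^bsub>L\<^esub> x \<and> \<not> (\<exists>z \<in> carrier L. y \<sqsubset>\<^bsub>L\<^esub> z \<and> z \<sqsubset>\<^bsub>L\<^esub> x)}"

text \<open>Each element of the finite set \<open>A\<close> is included independently with probability \<open>p\<close>.\<close>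

definition random_subset :: "real \<Rightarrow> 'a set \<Rightarrow> 'a set pmf" where
  "random_subset p A = map_pmf (\<lambda>f. {x \<in> A. f x}) (Pi_pmf A False (\<lambda>_. bernoulli_pmf p))"

definition ungarian_kernel :: "'a gorder \<Rightarrow> real \<Rightarrow> 'a \<Rightarrow> 'a pmf" where
  "ungarian_kernel L p x =
     map_pmf (\<lambda>T. \<Sqinter>\<^bsub>L\<^esub>({x} \<union> T)) (random_subset p (covered_by L x))"

definition expected_ungarian_steps :: "real \<Rightarrow> 'a gorder \<Rightarrow> ennreal" where
  "expected_ungarian_steps p L =
     (\<integral>\<^sup>+ \<omega>. hitting_time \<bottom>\<^bsub>L\<^esub> \<omega>
        \<partial>markov_paths (return_pmf \<top>\<^bsub>L\<^esub>) (ungarian_kernel L p))"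

end

theory Submission
  imports Defs
begin

text \<open>Let \<open>I(w)\<close> be the set of left inversions of \<open>w\<close>, as pairs of values in the one-line picture of a
  signed permutation. Sortability is a condition on \<open>I(w)\<close> alone: for every \<open>a < m < b\<close> with
  \<open>(a, b) \<in> I(w)\<close> the colour of \<open>m\<close>, read off from the orientation of the Coxeter graph, prescribes
  which of \<open>(a, m)\<close> and \<open>(m, b)\<close> must also lie in \<open>I(w)\<close>. Sets with this property are closed under
  intersection, so meets in the Cambrian lattice are intersections of inversion sets. Placing the
  reflections in the plane so that each triple \<open>(a, m), (a, b), (m, b)\<close> is a chain of the product order,
  opposite to the order in which sorting words create them, embeds them into a rectangle with sides
  \<open>n + r + 1\<close> and \<open>2n - r - 1\<close>, and removing a minimal cell of \<open>I(w)\<close> leads to an element covered by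
  \<open>w\<close>. Hence the chain is at least as fast as the removal of minimal cells, each with probability \<open>p\<close>;
  by lack of memory the expected duration of the latter is the expected last-passage time with
  geometric weights, which serves as a Lyapunov function. In a rectangle this time is dominated by
  the one with independent geometric weights of parameters \<open>p1\<close>, \<open>p2\<close> on the two axes; if
  \<open>(1 - p1) (1 - p2) = 1 - p\<close>, the Burke property makes the latter's expectation computable, and
  optimising over \<open>p1\<close>, \<open>p2\<close> gives the constant.\<close>

section \<open>Hitting times of Markov chains\<close>

text \<open>Only an upper bound is wanted, so all comparisons are one-sided: covered elements not
  coming from minimal cells are ignored, and weights on the axes only lengthen passages. The drift
  of 1 per step comes from a coupling on a single field of weights: any path that reaches a cell can
  be rerouted at no loss through a minimal cell, and every minimal cell loses one unit of weight per
  round. The reflection encoded by \<open>(a, b)\<close> and \<open>(- b, - a)\<close> first appears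
  at two mirror positions of a square of side \<open>2n\<close>, given by the ranks of
  \<open>a\<close> and \<open>- b\<close>. Folding along the diagonal identifies them. The folded
  region fits into a rectangle of half-perimeter \<open>3n\<close> because \<open>a\<close> and
  \<open>- b\<close> are never both positive; this is the origin of the constant 3. The radical is a
  balance of two terms: with \<open>q = 1 - p\<close>, the stationary expectation for sides
  \<open>M\<close>, \<open>N\<close> is \<open>(M + N + M s + q N / s) / p\<close> with a free
  \<open>s > 0\<close>, whose minimum contains \<open>2 sqrt (q M N)\<close>. That sortability
  depends on inversions alone is shown by consuming the infinite word letter by letter. This rotates
  the Coxeter word, so the colours have to be transported along the rotation.\<close>

primrec markov_law :: "'a pmf \<Rightarrow> ('a \<Rightarrow> 'a pmf) \<Rightarrow> nat \<Rightarrow> 'a pmf" where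
  "markov_law \<mu> K 0 = \<mu>"
| "markov_law \<mu> K (Suc t) = bind_pmf (markov_law \<mu> K t) K"

text \<open>Marginals at a single time suffice below. The induction unrolls the kernels one
  coordinate at a time; it is general in \<open>f\<close>, so that the last transition can be
  absorbed into the integrand.\<close>

lemma
  fixes f :: "'a \<Rightarrow> ennreal"
  shows markov_paths_component_measurable:
      "(\<lambda>\<omega>. f (\<omega> t)) \<in> borel_measurable (markov_paths \<mu> K)" (is ?A)
    and nn_integral_markov_paths_component:
      "(\<integral>\<^sup>+ \<omega>. f (\<omega> t) \<partial>markov_paths \<mu> K) = (\<integral>\<^sup>+ x. f x \<partial>measure_pmf (markov_law \<mu> K t))" (is ?B)
proof -
  interpret IT: Ionescu_Tulcea "markov_step \<mu> K" "\<lambda>_. count_space UNIV"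
    by (rule Ionescu_Tulcea_markov_step)
  let ?M = "\<lambda>_::nat. count_space (UNIV :: 'a set)"
  have lim: "markov_paths \<mu> K = IT.PF.lim"
    by (simp add: markov_paths_def)
  have comp: "(\<lambda>\<omega>. f (\<omega> t)) \<in> borel_measurable (PiM J ?M)" if "t \<in> J" for t J and f :: "'a \<Rightarrow> ennreal"
    by (rule measurable_compose[OF measurable_component_singleton[OF that]]) simp
  show ?A
    unfolding lim using comp[of t UNIV f] by (simp add: measurable_cong_sets[OF IT.PF.sets_lim refl])
  have up: "IT.up_to {0..<Suc t} = Suc t" for t
    using IT.up_to_iff_Ico[of "{0..<Suc t}"]
    by (meson finite_atLeastLessThan le_antisym order_refl ivl_subset zero_less_Suc not_less IT.up_to)
  \<comment> \<open>The empty history: the only point of the product over no coordinates,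
    extensional functions being \<open>undefined\<close> outside the index set.\<close>
  let ?u = "\<lambda>x::nat. undefined :: 'a"
  have u: "?u \<in> space (PiM {0..<0} ?M)"
    by (simp add: space_PiM)
  have C: "(\<integral>\<^sup>+ \<omega>. f (\<omega> t) \<partial>IT.C 0 (Suc t) ?u) = (\<integral>\<^sup>+ x. f x \<partial>measure_pmf (markov_law \<mu> K t))" for f t
  proof (induction t arbitrary: f)
    case 0
    have "(\<integral>\<^sup>+ \<omega>. f (\<omega> 0) \<partial>IT.C 0 (Suc 0) ?u) =
        (\<integral>\<^sup>+ \<omega>'. (\<integral>\<^sup>+ \<omega>. f (\<omega> 0) \<partial>IT.eP 0 \<omega>') \<partial>IT.C 0 0 ?u)"
      unfolding IT.C.simps(2)
      by (subst nn_integral_bind[where B="PiM {0..<Suc 0} ?M"])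
        (use comp[of 0 "{0..<Suc 0}" f] IT.measurable_eP[of 0] in \<open>auto simp: \<close>)
    also have "\<dots> = (\<integral>\<^sup>+ \<omega>'. (\<integral>\<^sup>+ x. f x \<partial>measure_pmf \<mu>) \<partial>IT.C 0 0 ?u)"
    proof (rule nn_integral_cong)
      fix \<omega>' assume "\<omega>' \<in> space (IT.C 0 0 ?u)"
      then have "\<omega>' \<in> space (PiM {0..<0} ?M)" using IT.space_C[OF u, of 0] by simp
      then show "(\<integral>\<^sup>+ \<omega>. f (\<omega> 0) \<partial>IT.eP 0 \<omega>') = (\<integral>\<^sup>+ x. f x \<partial>measure_pmf \<mu>)"
        using comp[of 0 "{0..<Suc 0}" f] by (subst IT.nn_integral_eP) (auto simp: markov_step_def)
    qed
    also have "\<dots> = (\<integral>\<^sup>+ x. f x \<partial>measure_pmf \<mu>)"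
      using prob_space.emeasure_space_1[OF IT.prob_space_C[OF u, of 0]] by simp
    finally show ?case by simp
  next
    case (Suc t)
    have *: "(\<lambda>\<omega>. f (\<omega> (Suc t))) \<in> borel_measurable (PiM {0..<Suc (Suc t)} ?M)" for f :: "'a \<Rightarrow> ennreal"
      by (rule comp) simp
    have sC: "sets (IT.C 0 (Suc t) ?u) = sets (PiM {0..<Suc t} ?M)"
      using IT.sets_C[OF u, of "Suc t"] by simp
    have mC: "IT.eP (Suc t) \<in> measurable (IT.C 0 (Suc t) ?u) (subprob_algebra (PiM {0..<Suc (Suc t)} ?M))"
      by (subst measurable_cong_sets[OF sC refl]) (rule IT.measurable_eP)
    have "(\<integral>\<^sup>+ \<omega>. f (\<omega> (Suc t)) \<partial>IT.C 0 (Suc (Suc t)) ?u) =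
        (\<integral>\<^sup>+ \<omega>'. (\<integral>\<^sup>+ \<omega>. f (\<omega> (Suc t)) \<partial>IT.eP (0 + Suc t) \<omega>') \<partial>IT.C 0 (Suc t) ?u)"
      unfolding IT.C.simps(2)[of 0 "Suc t"]
      by (subst nn_integral_bind[OF *]) (simp_all add: mC del: IT.C.simps)
    also have "\<dots> = (\<integral>\<^sup>+ \<omega>'. (\<integral>\<^sup>+ x. f x \<partial>measure_pmf (K (\<omega>' t))) \<partial>IT.C 0 (Suc t) ?u)"
    proof (rule nn_integral_cong)
      fix \<omega>' assume "\<omega>' \<in> space (IT.C 0 (Suc t) ?u)"
      then have "\<omega>' \<in> space (PiM {0..<Suc t} ?M)" using IT.space_C[OF u, of "Suc t"] by simp
      then show "(\<integral>\<^sup>+ \<omega>. f (\<omega> (Suc t)) \<partial>IT.eP (0 + Suc t) \<omega>') = (\<integral>\<^sup>+ x. f x \<partial>measure_pmf (K (\<omega>' t)))"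
        using * by (simp add: IT.nn_integral_eP markov_step_def)
    qed
    also have "\<dots> = (\<integral>\<^sup>+ x. f x \<partial>measure_pmf (markov_law \<mu> K (Suc t)))"
      using Suc[of "\<lambda>x. \<integral>\<^sup>+ z. f z \<partial>K x"] by (simp del: IT.C.simps)
    finally show ?case .
  qed
  let ?J = "{0..<Suc t}"
  have "(\<integral>\<^sup>+ \<omega>. f (\<omega> t) \<partial>markov_paths \<mu> K) = (\<integral>\<^sup>+ \<omega>. f (restrict \<omega> ?J t) \<partial>IT.PF.lim)"
    by (simp add: lim)
  also have "\<dots> = (\<integral>\<^sup>+ \<omega>. f (\<omega> t) \<partial>distr IT.PF.lim (PiM ?J ?M) (\<lambda>x. restrict x ?J))"
    by (subst nn_integral_distr) (auto intro!: comp simp: measurable_cong_sets[OF IT.PF.sets_lim refl])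
  also have "\<dots> = (\<integral>\<^sup>+ \<omega>. f (\<omega> t) \<partial>IT.CI ?J)"
    by (subst IT.distr_lim) auto
  also have "\<dots> = (\<integral>\<^sup>+ \<omega>. f (restrict \<omega> ?J t) \<partial>IT.C 0 (Suc t) ?u)"
    unfolding IT.CI_def up
    using measurable_cong_sets[OF IT.sets_C[OF u, of "Suc t"] refl]
    by (subst nn_integral_distr) (auto intro!: comp simp del: IT.C.simps)
  finally show ?B
    using C[of t f] by (simp del: IT.C.simps)
qed

text \<open>The sum counts all times spent away from \<open>y\<close>, also those after a first
  visit, and diverges if there is no visit. In exchange for this slack it involves only one time at
  once.\<close>

lemma hitting_time_le_suminf:
  "hitting_time y \<omega> \<le> (\<Sum>t. indicator (- {y}) (\<omega> t))"
proof (cases "\<exists>t. \<omega> t = y")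
  case True
  define T where "T = (LEAST t. \<omega> t = y)"
  have T: "\<omega> T = y" unfolding T_def using True by (rule LeastI_ex)
  have less: "\<omega> t \<noteq> y" if "t < T" for t using that not_less_Least unfolding T_def by blast
  have "hitting_time y \<omega> \<le> of_nat T"
    unfolding hitting_time_def using T by (intro INF_lower) auto
  also have "\<dots> = (\<Sum>t<T. indicator (- {y}) (\<omega> t))"
    using less by (simp add: indicator_def)
  also have "\<dots> \<le> (\<Sum>t. indicator (- {y}) (\<omega> t))"
    by (intro sum_le_suminf) auto
  finally show ?thesis .
next
  case False
  have "(\<Sum>t. indicator (- {y}) (\<omega> t)) = (\<Sum>t::nat. 1 :: ennreal)"
    using False by (intro suminf_cong) auto
  also have "\<dots> = \<top>"
  proof -
    have "of_nat n \<le> (\<Sum>t::nat. 1 :: ennreal)" for n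
      using sum_le_suminf[of "\<lambda>_. 1::ennreal" "{..<n}"] by auto
    then show ?thesis
      by (metis ennreal_Ex_less_of_nat linorder_not_less top.not_eq_extremum)
  qed
  finally show ?thesis by simp
qed

text \<open>Foster-Lyapunov argument: each step begun away from \<open>y\<close> costs at least one
  unit of expected potential, so telescoping bounds the expected number of such steps by the initial
  potential.\<close>

lemma expected_hitting_time_le:
  fixes V :: "'a \<Rightarrow> ennreal"
  assumes init: "set_pmf \<mu> \<subseteq> C"
    and closed: "\<And>x. x \<in> C \<Longrightarrow> set_pmf (K x) \<subseteq> C"
    and drift: "\<And>x. x \<in> C \<Longrightarrow> indicator (- {y}) x + (\<integral>\<^sup>+ z. V z \<partial>measure_pmf (K x)) \<le> V x"
  shows "(\<integral>\<^sup>+ \<omega>. hitting_time y \<omega> \<partial>markov_paths \<mu> K) \<le> (\<integral>\<^sup>+ x. V x \<partial>measure_pmf \<mu>)"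
proof -
  let ?L = "markov_law \<mu> K"
  have supp: "set_pmf (?L t) \<subseteq> C" for t
    using init closed by (induction t) auto
  have step: "(\<integral>\<^sup>+ x. indicator (- {y}) x \<partial>?L t) + (\<integral>\<^sup>+ x. V x \<partial>?L (Suc t)) \<le> (\<integral>\<^sup>+ x. V x \<partial>?L t)" for t
  proof -
    have "(\<integral>\<^sup>+ x. indicator (- {y}) x \<partial>?L t) + (\<integral>\<^sup>+ x. V x \<partial>?L (Suc t))
        = (\<integral>\<^sup>+ x. indicator (- {y}) x + (\<integral>\<^sup>+ z. V z \<partial>K x) \<partial>?L t)"
      by (simp add: nn_integral_add del: nn_integral_indicator)
    also have "\<dots> \<le> (\<integral>\<^sup>+ x. V x \<partial>?L t)"
      using supp[of t] drift by (intro nn_integral_mono_AE AE_pmfI) auto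
    finally show ?thesis .
  qed
  \<comment> \<open>The remaining potential stays on the left, since subtraction does not cancel at
    infinity.\<close>
  have tele: "(\<Sum>t<k. \<integral>\<^sup>+ x. indicator (- {y}) x \<partial>?L t) + (\<integral>\<^sup>+ x. V x \<partial>?L k) \<le> (\<integral>\<^sup>+ x. V x \<partial>\<mu>)" for k
  proof (induction k)
    case (Suc k)
    have "(\<Sum>t<Suc k. \<integral>\<^sup>+ x. indicator (- {y}) x \<partial>?L t) + (\<integral>\<^sup>+ x. V x \<partial>?L (Suc k))
       = (\<Sum>t<k. \<integral>\<^sup>+ x. indicator (- {y}) x \<partial>?L t) + ((\<integral>\<^sup>+ x. indicator (- {y}) x \<partial>?L k) + (\<integral>\<^sup>+ x. V x \<partial>?L (Suc k)))"
      by (simp only: sum.lessThan_Suc add.assoc)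
    also have "\<dots> \<le> (\<Sum>t<k. \<integral>\<^sup>+ x. indicator (- {y}) x \<partial>?L t) + (\<integral>\<^sup>+ x. V x \<partial>?L k)"
      by (intro add_left_mono step)
    finally show ?case using Suc by (rule order_trans)
  qed simp
  have "(\<integral>\<^sup>+ \<omega>. hitting_time y \<omega> \<partial>markov_paths \<mu> K) \<le>
      (\<integral>\<^sup>+ \<omega>. (\<Sum>t. indicator (- {y}) (\<omega> t)) \<partial>markov_paths \<mu> K)"
    by (intro nn_integral_mono hitting_time_le_suminf)
  also have "\<dots> = (\<Sum>t. \<integral>\<^sup>+ \<omega>. indicator (- {y}) (\<omega> t) \<partial>markov_paths \<mu> K)"
    by (intro nn_integral_suminf markov_paths_component_measurable)
  also have "\<dots> = (\<Sum>t. \<integral>\<^sup>+ x. indicator (- {y}) x \<partial>?L t)"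
    by (subst nn_integral_markov_paths_component) simp
  also have "\<dots> = (SUP k. \<Sum>t<k. \<integral>\<^sup>+ x. indicator (- {y}) x \<partial>?L t)"
    by (rule suminf_eq_SUP)
  also have "\<dots> \<le> (\<integral>\<^sup>+ x. V x \<partial>\<mu>)"
  proof (rule SUP_least)
    show "(\<Sum>t<k. \<integral>\<^sup>+ x. indicator (- {y}) x \<partial>?L t) \<le> (\<integral>\<^sup>+ x. V x \<partial>\<mu>)" for k
      by (rule order_trans[OF _ tele[of k]]) simp
  qed
  finally show ?thesis .
qed

section \<open>Last-passage percolation and removal of minimal cells\<close>

text \<open>The axes carry no cells of the posets considered here; they are reserved for the boundary
  weights of the stationary model.\<close>

fun lpp :: "(nat \<times> nat \<Rightarrow> nat) \<Rightarrow> nat \<Rightarrow> nat \<Rightarrow> nat" where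
  "lpp w 0 0 = w (0, 0)"
| "lpp w (Suc i) 0 = lpp w i 0 + w (Suc i, 0)"
| "lpp w 0 (Suc j) = lpp w 0 j + w (0, Suc j)"
| "lpp w (Suc i) (Suc j) = max (lpp w i (Suc j)) (lpp w (Suc i) j) + w (Suc i, Suc j)"

lemma lpp_mono:
  assumes "\<And>a b. a \<le> i \<Longrightarrow> b \<le> j \<Longrightarrow> w (a, b) \<le> w' (a, b)"
  shows "lpp w i j \<le> lpp w' i j"
  using assms
proof (induction w i j rule: lpp.induct)
  case (2 w i)
  then show ?case by (auto intro!: add_mono)
next
  case (3 w j)
  then show ?case by (auto intro!: add_mono)
next
  case (4 w i j)
  then have "lpp w i (Suc j) \<le> lpp w' i (Suc j)" "lpp w (Suc i) j \<le> lpp w' (Suc i) j"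
    "w (Suc i, Suc j) \<le> w' (Suc i, Suc j)" by auto
  then show ?case by (simp; linarith)
qed simp

lemma lpp_eq_0:
  assumes "\<And>a b. a \<le> i \<Longrightarrow> b \<le> j \<Longrightarrow> w (a, b) = 0"
  shows "lpp w i j = 0"
  using assms by (induction w i j rule: lpp.induct) auto

lemma lpp_cong:
  assumes "\<And>a b. a \<le> i \<Longrightarrow> b \<le> j \<Longrightarrow> w (a, b) = w' (a, b)"
  shows "lpp w i j = lpp w' i j"
  using assms by (intro antisym lpp_mono) auto

definition min_cells :: "(nat \<times> nat) set \<Rightarrow> (nat \<times> nat) set" where
  "min_cells x = {c \<in> x. \<forall>d \<in> x. fst d \<le> fst c \<longrightarrow> snd d \<le> snd c \<longrightarrow> d = c}"

text \<open>\<open>W c\<close> stands for the failed trials before \<open>c\<close>, once minimal,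
  is removed, and \<open>Suc\<close> adds the successful one. Absent cells stay in the grid with
  weight 0, so the recursion of \<open>lpp\<close> keeps its shape.\<close>

definition cell_weight :: "(nat \<times> nat) set \<Rightarrow> (nat \<times> nat \<Rightarrow> nat) \<Rightarrow> nat \<times> nat \<Rightarrow> nat" where
  "cell_weight x W c = (if c \<in> x then Suc (W c) else 0)"

text \<open>Coupling of one round: a minimal cell in \<open>R\<close> loses its whole weight 1, any
  other minimal cell loses one failure. A path to a region containing a cell of \<open>x\<close> can
  be rerouted through a minimal cell at no loss, so the maximum drops by at least 1 there.\<close>

lemma lpp_remove_min_cells:
  assumes R: "R \<subseteq> min_cells x"
    and W: "\<And>c. c \<in> x \<Longrightarrow> W c = (if c \<in> min_cells x then if c \<in> R then 0 else Suc (W' c) else W' c)"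
  shows "lpp (cell_weight (x - R) W') i j + of_bool (\<exists>(a, b) \<in> x. a \<le> i \<and> b \<le> j)
    \<le> lpp (cell_weight x W) i j"
proof -
  let ?e = "\<lambda>i j. \<exists>(a, b) \<in> x. a \<le> i \<and> b \<le> j"
  let ?w = "cell_weight x W" and ?w' = "cell_weight (x - R) W'"
  have w: "?w c = ?w' c + of_bool (c \<in> min_cells x)" for c
    using R W[of c] by (auto simp: cell_weight_def min_cells_def)
  have zero: "lpp ?w' i j = 0" if "\<not> ?e i j" for i j
    using that by (intro lpp_eq_0) (auto simp: cell_weight_def)
  have min: "(i, j) \<in> min_cells x \<or> (i > 0 \<and> ?e (i - 1) j) \<or> (j > 0 \<and> ?e i (j - 1))" if e: "?e i j" for i j
  proof (rule ccontr)
    assume neg: "\<not> ?thesis"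
    have only: "d = (i, j)" if d: "d \<in> x" "fst d \<le> i" "snd d \<le> j" for d
    proof (rule ccontr)
      assume "d \<noteq> (i, j)"
      then have "fst d < i \<or> snd d < j" using d by (cases d) auto
      then show False
      proof
        assume "fst d < i"
        then have "i > 0 \<and> ?e (i - 1) j" using d by (intro conjI bexI[of _ d]) auto
        then show False using neg by blast
      next
        assume "snd d < j"
        then have "j > 0 \<and> ?e i (j - 1)" using d by (intro conjI bexI[of _ d]) auto
        then show False using neg by blast
      qed
    qed
    from e obtain d where d: "d \<in> x" "fst d \<le> i" "snd d \<le> j" by auto
    from only[OF this] d have "(i, j) \<in> x" by simp
    moreover have "\<forall>d \<in> x. fst d \<le> i \<longrightarrow> snd d \<le> j \<longrightarrow> d = (i, j)"
      by (intro ballI impI only)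
    ultimately have "(i, j) \<in> min_cells x" unfolding min_cells_def mem_Collect_eq fst_conv snd_conv by (rule conjI)
    with neg show False by blast
  qed
  show ?thesis
  proof -
    \<comment> \<open>\<open>e1\<close> and \<open>e2\<close> tell whether the quadrants of the two
      predecessors contain a cell. An empty one has passage time 0 after the removal, so it cannot
      be a branch that keeps the maximum from dropping.\<close>
    have two: "max l1' l2' + w' + of_bool e \<le> max l1 l2 + w"
      if "l1' + of_bool e1 \<le> l1" "l2' + of_bool e2 \<le> l2" "\<not> e1 \<longrightarrow> l1' = 0" "\<not> e2 \<longrightarrow> l2' = 0"
        "w = w' + of_bool m" "e \<longrightarrow> m \<or> e1 \<or> e2" for l1 l2 l1' l2' w w' :: nat and e1 e2 e m
      using that by (auto simp: max_def)
    have one: "l' + w' + of_bool e \<le> l + w"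
      if "l' + of_bool e1 \<le> l" "w = w' + of_bool m" "e \<longrightarrow> m \<or> e1" for l l' w w' :: nat and e1 e m
      using that by auto
    have nil: "w' + of_bool e \<le> w"
      if "w = w' + of_bool m" "e \<longrightarrow> m" for w w' :: nat and e m
      using that by auto
    show ?thesis
    proof (induction i arbitrary: j)
      case 0
      show ?case
      proof (induction j)
        case 0
        show ?case unfolding lpp.simps by (rule nil[OF w]) (use min[of 0 0] in simp)
      next
        case (Suc j)
        show ?case unfolding lpp.simps
          by (rule one[OF Suc w]) (use min[of 0 "Suc j"] in simp)
      qed
    next
      case IHi: (Suc i)
      show ?case
      proof (induction j)
        case 0
        show ?case unfolding lpp.simps
          by (rule one[OF IHi w]) (use min[of "Suc i" 0] in simp)
      next
        case (Suc j)
        show ?case unfolding lpp.simps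
          by (rule two[OF IHi Suc _ _ w]) (use min[of "Suc i" "Suc j"] zero[of i "Suc j"] zero[of "Suc i" j] in \<open>simp_all\<close>)
      qed
    qed
  qed
qed

text \<open>Lack of memory, used on the coordinates in \<open>D\<close> only: a first trial either
  ends the count at 0 or is followed by a fresh copy of it.\<close>

lemma Pi_geometric_pmf_unfold:
  assumes A: "finite A" "D \<subseteq> A" and p: "0 < p" "p \<le> 1"
  shows "Pi_pmf A 0 (\<lambda>_. geometric_pmf p) =
    bind_pmf (Pi_pmf D False (\<lambda>_. bernoulli_pmf p)) (\<lambda>B.
      map_pmf (\<lambda>W c. if c \<in> A then if c \<in> D then if B c then 0 else Suc (W c) else W c else 0)
        (Pi_pmf A 0 (\<lambda>_. geometric_pmf p)))"
proof -
  let ?G = "geometric_pmf p"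
  let ?g = "\<lambda>c b y. if c \<in> D then if b then 0 else Suc y else y"
  \<comment> \<open>Outside \<open>D\<close> the coin is a dummy; then all coordinates have the same
    two-stage form and \<open>Pi_pmf_bind\<close> applies.\<close>
  let ?b = "\<lambda>c. if c \<in> D then bernoulli_pmf p else return_pmf False"
  have unfold: "?G = bind_pmf (?b c) (\<lambda>b. bind_pmf ?G (\<lambda>y. return_pmf (?g c b y)))" for c
  proof (cases "c \<in> D")
    case True
    have "?G = bind_pmf (bernoulli_pmf p) (\<lambda>b. if b then return_pmf 0 else map_pmf Suc ?G)"
      using p by (intro geometric_bind_pmf_unfold) auto
    also have "\<dots> = bind_pmf (bernoulli_pmf p) (\<lambda>b. bind_pmf ?G (\<lambda>y. return_pmf (?g c b y)))"
      using True by (intro bind_pmf_cong refl) (auto simp: map_pmf_def)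
    finally show ?thesis using True by simp
  next
    case False
    then show ?thesis by (simp add: bind_return_pmf bind_return_pmf')
  qed
  have D: "{c \<in> A. c \<in> D} = D" using A by auto
  have "Pi_pmf A 0 (\<lambda>_. ?G) = Pi_pmf A 0 (\<lambda>c. bind_pmf (?b c) (\<lambda>b. bind_pmf ?G (\<lambda>y. return_pmf (?g c b y))))"
    by (intro Pi_pmf_cong unfold) auto
  also have "\<dots> = bind_pmf (Pi_pmf A False ?b) (\<lambda>B. bind_pmf (Pi_pmf A 0 (\<lambda>_. ?G)) (\<lambda>W.
       return_pmf (\<lambda>c. if c \<in> A then ?g c (B c) (W c) else 0)))"
    using A(1) by (simp add: Pi_pmf_bind[where d' = False] Pi_pmf_bind[where d' = "0::nat"])
  also have "Pi_pmf A False ?b = Pi_pmf D False (\<lambda>_. bernoulli_pmf p)"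
    using Pi_pmf_if_set[OF A(1), of False "\<lambda>c. c \<in> D"] D by simp
  finally show ?thesis by (simp add: map_pmf_def)
qed

definition expected_lpp :: "real \<Rightarrow> nat \<Rightarrow> nat \<Rightarrow> (nat \<times> nat) set \<Rightarrow> ennreal" where
  "expected_lpp p M N x =
    (\<integral>\<^sup>+ W. of_nat (lpp (cell_weight x W) M N) \<partial>Pi_pmf ({1..M} \<times> {1..N}) 0 (\<lambda>_. geometric_pmf p))"

lemma expected_lpp_mono: "x \<subseteq> y \<Longrightarrow> expected_lpp p M N x \<le> expected_lpp p M N y"
  unfolding expected_lpp_def
  by (intro nn_integral_mono of_nat_mono lpp_mono) (auto simp: cell_weight_def)

text \<open>The weights before the round arise from those after it by prepending the trials of the
  minimal cells. Both expectations thus live on one field, and the pointwise loss of 1 can be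
  integrated.\<close>

lemma expected_lpp_drift:
  assumes x: "x \<subseteq> {1..M} \<times> {1..N}" "x \<noteq> {}" and p: "0 < p" "p \<le> 1"
  shows "1 + (\<integral>\<^sup>+ R. expected_lpp p M N (x - R) \<partial>random_subset p (min_cells x)) \<le> expected_lpp p M N x"
proof -
  let ?A = "{1..M} \<times> {1..N}" and ?D = "min_cells x"
  let ?Q = "Pi_pmf ?A 0 (\<lambda>_. geometric_pmf p)" and ?B = "Pi_pmf ?D False (\<lambda>_. bernoulli_pmf p)"
  let ?R = "\<lambda>B. {c \<in> ?D. B c}"
  have D: "?D \<subseteq> ?A" using x by (auto simp: min_cells_def)
  have step: "1 + lpp (cell_weight (x - ?R B) W) M N \<le> lpp (cell_weight x
      (\<lambda>c. if c \<in> ?A then if c \<in> ?D then if B c then 0 else Suc (W c) else W c else 0)) M N" for B W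
  proof -
    obtain c where "c \<in> x" using x(2) by blast
    moreover have "fst c \<le> M \<and> snd c \<le> N" using x(1) \<open>c \<in> x\<close> by auto
    ultimately have "\<exists>(a, b) \<in> x. a \<le> M \<and> b \<le> N" by (intro bexI[of _ c]) auto
    moreover have "lpp (cell_weight (x - ?R B) W) M N + of_bool (\<exists>(a, b) \<in> x. a \<le> M \<and> b \<le> N) \<le> lpp (cell_weight x
      (\<lambda>c. if c \<in> ?A then if c \<in> ?D then if B c then 0 else Suc (W c) else W c else 0)) M N"
      by (rule lpp_remove_min_cells) (use x(1) in \<open>auto simp: subset_iff\<close>)
    ultimately show ?thesis by simp
  qed
  have "1 + (\<integral>\<^sup>+ R. expected_lpp p M N (x - R) \<partial>random_subset p ?D)
      = (\<integral>\<^sup>+ B. 1 + (\<integral>\<^sup>+ W. of_nat (lpp (cell_weight (x - ?R B) W) M N) \<partial>?Q) \<partial>?B)"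
    by (simp add: random_subset_def nn_integral_add expected_lpp_def)
  also have "\<dots> = (\<integral>\<^sup>+ B. (\<integral>\<^sup>+ W. of_nat (1 + lpp (cell_weight (x - ?R B) W) M N) \<partial>?Q) \<partial>?B)"
    by (simp add: nn_integral_add)
  also have "\<dots> \<le> (\<integral>\<^sup>+ B. (\<integral>\<^sup>+ W. of_nat (lpp (cell_weight x
      (\<lambda>c. if c \<in> ?A then if c \<in> ?D then if B c then 0 else Suc (W c) else W c else 0)) M N) \<partial>?Q) \<partial>?B)"
    by (intro nn_integral_mono of_nat_mono step)
  also have "\<dots> = expected_lpp p M N x"
    unfolding expected_lpp_def arg_cong[OF Pi_geometric_pmf_unfold[OF _ D p], where f = "\<lambda>q. \<integral>\<^sup>+ W. of_nat (lpp (cell_weight x W) M N) \<partial>measure_pmf q", OF finite_cartesian_product[OF finite_atLeastAtMost finite_atLeastAtMost]]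
    by simp
  finally show ?thesis .
qed

section \<open>The stationary bound for last-passage percolation\<close>

text \<open>Burke property of one corner: \<open>i\<close> and \<open>j\<close> are increments along
  two sides of a unit square, \<open>w\<close> is the weight of its upper corner, and the outputs
  are the increments along the opposite sides. Along a fibre, the relation between the parameters
  turns the probabilities into a geometric series of ratio \<open>1 - p\<close>.\<close>

lemma burke_geometric:
  assumes p: "0 < p1" "p1 \<le> 1" "0 < p2" "p2 \<le> 1" "0 < p" "p \<le> 1" and eq: "(1 - p1) * (1 - p2) = 1 - p"
  shows "map_pmf (\<lambda>((i, j), w). (w + (i - j), w + (j - i)))
      (pair_pmf (pair_pmf (geometric_pmf p1) (geometric_pmf p2)) (geometric_pmf p))
    = pair_pmf (geometric_pmf p1) (geometric_pmf p2)" (is "map_pmf ?f ?P = ?Q")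
proof (rule pmf_eqI)
  fix z :: "nat \<times> nat"
  obtain x y where z: "z = (x, y)" by (cases z)
  define m where "m = min x y"
  \<comment> \<open>One of the two truncated differences vanishes, which forces
    \<open>w = min x y\<close>; only \<open>k = min i j\<close> remains free.\<close>
  let ?a = "\<lambda>k. ((k + (x - y), k + (y - x)), m)"
  have pre: "?f -` {z} = (\<Union>k. {?a k})"
  proof (intro Set.set_eqI iffI)
    fix t assume t: "t \<in> ?f -` {z}"
    obtain i j w where ijw: "t = ((i, j), w)" by (metis surj_pair)
    with t z have "w + (i - j) = x" "w + (j - i) = y" by auto
    then have "t = ?a (min i j)" unfolding m_def ijw by auto
    then show "t \<in> (\<Union>k. {?a k})" by blast
  next
    fix t assume "t \<in> (\<Union>k. {?a k})"
    then obtain k where "t = ?a k" by blast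
    then show "t \<in> ?f -` {z}" unfolding z m_def by auto
  qed
  have "(\<lambda>k. measure_pmf.prob ?P {?a k}) sums measure_pmf.prob ?P (\<Union>k. {?a k})"
    by (intro measure_pmf.finite_measure_UNION) (auto simp: disjoint_family_on_def)
  then have "(\<lambda>k. pmf ?P (?a k)) sums pmf (map_pmf ?f ?P) z"
    by (simp add: pmf_map pre measure_pmf_single)
  moreover have "(\<lambda>k. pmf ?P (?a k)) sums pmf ?Q z"
  proof -
    have term_eq: "pmf ?P (?a k) = ((1 - p1) ^ x * p1 * ((1 - p2) ^ y * p2) * p) * (1 - p) ^ k" for k
    proof -
      have "pmf ?P (?a k) = p1 * p2 * p * ((1 - p1) ^ (k + (x - y)) * (1 - p2) ^ (k + (y - x)) * (1 - p) ^ m)"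
        using p by (simp add: pmf_pair)
      also have "(1 - p1) ^ (k + (x - y)) * (1 - p2) ^ (k + (y - x)) * (1 - p) ^ m =
          ((1 - p1) * (1 - p2)) ^ k * ((1 - p1) ^ (x - y) * (1 - p1) ^ m) * ((1 - p2) ^ (y - x) * (1 - p2) ^ m)"
        unfolding eq[symmetric] by (simp add: power_add power_mult_distrib)
      also have "(1 - p1) ^ (x - y) * (1 - p1) ^ m = (1 - p1) ^ x"
        unfolding power_add[symmetric] m_def by (rule arg_cong[where f = "\<lambda>n. (1 - p1) ^ n"]) simp
      also have "(1 - p2) ^ (y - x) * (1 - p2) ^ m = (1 - p2) ^ y"
        unfolding power_add[symmetric] m_def by (rule arg_cong[where f = "\<lambda>n. (1 - p2) ^ n"]) simp
      finally show ?thesis unfolding eq by (simp add: mult_ac)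
    qed
    have "(\<lambda>k. ((1 - p1) ^ x * p1 * ((1 - p2) ^ y * p2) * p) * (1 - p) ^ k) sums
        (((1 - p1) ^ x * p1 * ((1 - p2) ^ y * p2) * p) * (1 / (1 - (1 - p))))"
      using p by (intro sums_mult geometric_sums) auto
    then show ?thesis unfolding term_eq using p by (simp add: z pmf_pair)
  qed
  ultimately show "pmf (map_pmf ?f ?P) z = pmf ?Q z"
    by (rule sums_unique2)
qed

abbreviation geometric1_pmf :: "real \<Rightarrow> nat pmf" where
  "geometric1_pmf p \<equiv> map_pmf Suc (geometric_pmf p)"

lemma burke_geometric1:
  assumes p: "0 < p1" "p1 \<le> 1" "0 < p2" "p2 \<le> 1" "0 < p" "p \<le> 1" and eq: "(1 - p1) * (1 - p2) = 1 - p"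
  shows "map_pmf (\<lambda>((i, j), w). (w + (i - j), w + (j - i)))
      (pair_pmf (pair_pmf (geometric1_pmf p1) (geometric1_pmf p2)) (geometric1_pmf p))
    = pair_pmf (geometric1_pmf p1) (geometric1_pmf p2)" (is "map_pmf ?f _ = _")
proof -
  let ?G1 = "geometric_pmf p1" and ?G2 = "geometric_pmf p2" and ?G = "geometric_pmf p"
  have "map_pmf ?f (pair_pmf (pair_pmf (geometric1_pmf p1) (geometric1_pmf p2)) (geometric1_pmf p))
      = map_pmf (map_prod Suc Suc) (map_pmf ?f (pair_pmf (pair_pmf ?G1 ?G2) ?G))"
    by (simp add: pair_map_pmf1 pair_map_pmf2 map_pmf_comp case_prod_unfold)
  also have "\<dots> = pair_pmf (geometric1_pmf p1) (geometric1_pmf p2)"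
    unfolding burke_geometric[OF assms] by (simp add: map_prod_def map_pair)
  finally show ?thesis .
qed

lemma nn_integral_geometric1_pmf:
  assumes "0 < p" "p \<le> 1"
  shows "(\<integral>\<^sup>+ k. of_nat k \<partial>geometric1_pmf p) = ennreal (1 / p)"
proof -
  have p: "p \<in> {0<..1}" using assms by auto
  have "nn_integral (measure_pmf (geometric_pmf p)) of_nat = ennreal ((1 - p) / p)"
    unfolding ennreal_of_nat_eq_real_of_nat
    using expectation_geometric_pmf[OF p] integrable_real_geometric_pmf[OF p]
    by (subst nn_integral_eq_integral) auto
  then have "(\<integral>\<^sup>+ k. of_nat k \<partial>geometric1_pmf p) = 1 + ennreal ((1 - p) / p)"
    by (simp add: nn_integral_add)
  also have "\<dots> = ennreal (1 + (1 - p) / p)"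
    using assms by (subst ennreal_plus) auto
  also have "1 + (1 - p) / p = 1 / p" using assms by (simp add: field_simps)
  finally show ?thesis .
qed

text \<open>The axes carry the laws that the increments turn out to have everywhere:
  \<open>p1\<close> for horizontal steps, \<open>p2\<close> for vertical ones. In the interior
  weights start at 1, as those of present cells do in \<open>cell_weight\<close>.\<close>

definition stationary_law :: "real \<Rightarrow> real \<Rightarrow> real \<Rightarrow> nat \<times> nat \<Rightarrow> nat pmf" where
  "stationary_law p1 p2 p c =
    (if fst c = 0 then if snd c = 0 then return_pmf 0 else geometric1_pmf p2
     else if snd c = 0 then geometric1_pmf p1 else geometric1_pmf p)"

definition row_increments :: "nat \<Rightarrow> (nat \<times> nat \<Rightarrow> nat) \<Rightarrow> nat \<Rightarrow> nat \<Rightarrow> nat" where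
  "row_increments M w j m = (if m \<in> {1..M} then lpp w m j - lpp w (m - 1) j else 0)"

text \<open>Increments along the down-right path that follows row \<open>Suc j\<close> up to column \<open>i\<close>, steps down
  to row \<open>j\<close>, and continues there; index \<open>0\<close> is the vertical step.\<close>

definition path_increments :: "nat \<Rightarrow> (nat \<times> nat \<Rightarrow> nat) \<Rightarrow> nat \<Rightarrow> nat \<Rightarrow> nat \<Rightarrow> nat" where
  "path_increments M w i j m =
    (if m = 0 then lpp w i (Suc j) - lpp w i j
     else if m \<le> i then lpp w m (Suc j) - lpp w (m - 1) (Suc j)
     else if m \<le> M then lpp w m j - lpp w (m - 1) j else 0)"

lemma lpp_upd:
  assumes "i < a \<or> j < b"
  shows "lpp (w((a, b) := y)) i j = lpp w i j"
  using assms by (intro lpp_cong) auto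

lemma lpp_le_Suc1: "lpp w i j \<le> lpp w (Suc i) j"
  by (cases j) auto

lemma lpp_le_Suc2: "lpp w i j \<le> lpp w i (Suc j)"
  by (cases i) auto

context
  fixes p1 p2 p :: real and M :: nat
  assumes p: "0 < p1" "p1 \<le> 1" "0 < p2" "p2 \<le> 1" "0 < p" "p \<le> 1"
    and eq: "(1 - p1) * (1 - p2) = 1 - p"
begin

abbreviation (input) "law \<equiv> stationary_law p1 p2 p"
abbreviation (input) "pathlaw \<equiv> (\<lambda>m::nat. if m = 0 then geometric1_pmf p2 else geometric1_pmf p1)"

lemma row_increments_0:
  "map_pmf (\<lambda>w. row_increments M w 0) (Pi_pmf ({0..M} \<times> {0..0}) 0 law)
    = Pi_pmf {1..M} 0 (\<lambda>_. geometric1_pmf p1)"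
proof -
  let ?h = "\<lambda>m::nat. (m, 0::nat)"
  have "Pi_pmf {1..M} 0 (\<lambda>_. geometric1_pmf p1)
      = map_pmf (\<lambda>g. g \<circ> ?h) (Pi_pmf ({1..M} \<times> {0}) 0 (\<lambda>_. geometric1_pmf p1))"
    by (rule Pi_pmf_bij_betw) (auto simp: bij_betw_def inj_on_def)
  also have "Pi_pmf ({1..M} \<times> {0}) 0 (\<lambda>_. geometric1_pmf p1) = Pi_pmf ({1..M} \<times> {0}) 0 law"
    by (rule Pi_pmf_cong) (auto simp: stationary_law_def)
  also have "\<dots> = map_pmf (\<lambda>f x. if x \<in> {1..M} \<times> {0} then f x else 0) (Pi_pmf ({0..M} \<times> {0..0}) 0 law)"
    by (rule Pi_pmf_subset) auto
  finally have "Pi_pmf {1..M} 0 (\<lambda>_. geometric1_pmf p1) = map_pmf (\<lambda>f. (\<lambda>x. if x \<in> {1..M} \<times> {0} then f x else 0) \<circ> ?h)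
      (Pi_pmf ({0..M} \<times> {0..0}) 0 law)"
    by (simp add: map_pmf_comp comp_def)
  moreover have "row_increments M w 0 = (\<lambda>x. if x \<in> {1..M} \<times> {0} then w x else 0) \<circ> ?h" for w
  proof
    fix m show "row_increments M w 0 m = ((\<lambda>x. if x \<in> {1..M} \<times> {0} then w x else 0) \<circ> ?h) m"
      by (cases m) (auto simp: row_increments_def)
  qed
  ultimately show ?thesis by simp
qed

lemma path_increments_0:
  assumes "map_pmf (\<lambda>w. row_increments M w j) (Pi_pmf ({0..M} \<times> {0..j}) 0 law)
    = Pi_pmf {1..M} 0 (\<lambda>_. geometric1_pmf p1)"
  shows "map_pmf (\<lambda>w. path_increments M w 0 j) (Pi_pmf ({0..M} \<times> {0..j} \<union> {0..0} \<times> {Suc j}) 0 law)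
    = Pi_pmf {0..M} 0 pathlaw"
proof -
  let ?c = "(0::nat, Suc j)" and ?B = "{0..M} \<times> {0..j}"
  have upd: "path_increments M (f(?c := y)) 0 j = (row_increments M f j)(0 := y)" for f y
    by (rule ext) (auto simp: path_increments_def row_increments_def lpp_upd)
  have "{0..M} \<times> {0..j} \<union> {0..0} \<times> {Suc j} = insert ?c ?B" by auto
  then have "map_pmf (\<lambda>w. path_increments M w 0 j) (Pi_pmf ({0..M} \<times> {0..j} \<union> {0..0} \<times> {Suc j}) 0 law)
      = map_pmf (\<lambda>(y, f). (row_increments M f j)(0 := y)) (pair_pmf (law ?c) (Pi_pmf ?B 0 law))"
    by (simp add: Pi_pmf_insert map_pmf_comp case_prod_unfold upd)
  also have "\<dots> = map_pmf (\<lambda>(y, h). h(0 := y)) (pair_pmf (law ?c) (map_pmf (\<lambda>w. row_increments M w j) (Pi_pmf ?B 0 law)))"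
    by (simp add: pair_map_pmf2 map_pmf_comp case_prod_unfold)
  also have "\<dots> = map_pmf (\<lambda>(y, h). h(0 := y)) (pair_pmf (pathlaw 0) (Pi_pmf {1..M} 0 pathlaw))"
  proof -
    have "Pi_pmf {1..M} 0 (\<lambda>_. geometric1_pmf p1) = Pi_pmf {1..M} 0 pathlaw"
      by (rule Pi_pmf_cong) auto
    then show ?thesis unfolding assms by (simp add: stationary_law_def)
  qed
  also have "\<dots> = Pi_pmf (insert 0 {1..M}) 0 pathlaw"
    by (rule Pi_pmf_insert[symmetric]) auto
  also have "insert 0 {1..M} = {0..M}" by auto
  finally show ?thesis .
qed

text \<open>Turning one corner of the path: index \<open>0\<close> is the vertical step,
  \<open>Suc i\<close> the horizontal step after it, and \<open>y\<close> the weight of the new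
  cell. Conditioning on all other increments leaves \<open>burke_geometric1\<close>.\<close>

lemma path_flip:
  assumes i: "Suc i \<le> M"
  shows "map_pmf (\<lambda>(y, g). g(0 := y + (g 0 - g (Suc i)), Suc i := y + (g (Suc i) - g 0)))
      (pair_pmf (geometric1_pmf p) (Pi_pmf {0..M} 0 pathlaw)) = Pi_pmf {0..M} 0 pathlaw"
proof -
  let ?E = "{0..M} - {0, Suc i}"
  let ?F = "\<lambda>f b a. f(Suc i := b, 0 := a)"
  have E: "{0..M} = insert 0 (insert (Suc i) ?E)" using i by auto
  have split: "Pi_pmf {0..M} 0 pathlaw = bind_pmf (Pi_pmf ?E 0 pathlaw) (\<lambda>f.
      map_pmf (\<lambda>(b, a). ?F f b a) (pair_pmf (geometric1_pmf p1) (geometric1_pmf p2)))"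
  proof -
    have "Pi_pmf {0..M} 0 pathlaw = bind_pmf (geometric1_pmf p2) (\<lambda>a. bind_pmf (geometric1_pmf p1) (\<lambda>b.
        bind_pmf (Pi_pmf ?E 0 pathlaw) (\<lambda>f. return_pmf (?F f b a))))"
      by (subst E, subst Pi_pmf_insert, simp, simp, subst Pi_pmf_insert, simp, simp)
        (simp add: map_pmf_def pair_pmf_def bind_assoc_pmf bind_return_pmf del: bind_map_pmf)
    also have "\<dots> = bind_pmf (geometric1_pmf p1) (\<lambda>b. bind_pmf (geometric1_pmf p2) (\<lambda>a.
        bind_pmf (Pi_pmf ?E 0 pathlaw) (\<lambda>f. return_pmf (?F f b a))))"
      by (rule bind_commute_pmf)
    also have "\<dots> = bind_pmf (pair_pmf (geometric1_pmf p1) (geometric1_pmf p2)) (\<lambda>(b, a).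
        bind_pmf (Pi_pmf ?E 0 pathlaw) (\<lambda>f. return_pmf (?F f b a)))"
      by (simp add: pair_pmf_def bind_assoc_pmf bind_return_pmf)
    also have "\<dots> = bind_pmf (Pi_pmf ?E 0 pathlaw) (\<lambda>f.
      map_pmf (\<lambda>(b, a). ?F f b a) (pair_pmf (geometric1_pmf p1) (geometric1_pmf p2)))"
      unfolding map_pmf_def case_prod_unfold by (rule bind_commute_pmf)
    finally show ?thesis .
  qed
  have "map_pmf (\<lambda>(y, g). g(0 := y + (g 0 - g (Suc i)), Suc i := y + (g (Suc i) - g 0)))
      (pair_pmf (geometric1_pmf p) (Pi_pmf {0..M} 0 pathlaw))
    = bind_pmf (geometric1_pmf p) (\<lambda>y. bind_pmf (Pi_pmf {0..M} 0 pathlaw) (\<lambda>g.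
        return_pmf (g(0 := y + (g 0 - g (Suc i)), Suc i := y + (g (Suc i) - g 0)))))"
    by (simp add: map_pmf_def pair_pmf_def bind_assoc_pmf bind_return_pmf del: bind_map_pmf)
  also have "\<dots> = bind_pmf (Pi_pmf {0..M} 0 pathlaw) (\<lambda>g. bind_pmf (geometric1_pmf p) (\<lambda>y.
        return_pmf (g(0 := y + (g 0 - g (Suc i)), Suc i := y + (g (Suc i) - g 0)))))"
    by (rule bind_commute_pmf)
  also have "\<dots> = bind_pmf (Pi_pmf ?E 0 pathlaw) (\<lambda>f. map_pmf (\<lambda>(b, a). ?F f b a)
      (map_pmf (\<lambda>((i, j), w). (w + (i - j), w + (j - i)))
        (pair_pmf (pair_pmf (geometric1_pmf p1) (geometric1_pmf p2)) (geometric1_pmf p))))"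
    unfolding split
    by (simp add: map_pmf_def pair_pmf_def bind_assoc_pmf bind_return_pmf case_prod_unfold fun_upd_twist
      del: bind_map_pmf)
  also have "\<dots> = Pi_pmf {0..M} 0 pathlaw"
    unfolding burke_geometric1[OF p eq] split ..
  finally show ?thesis .
qed

lemma path_increments_Suc:
  assumes i: "Suc i \<le> M"
    and IH: "map_pmf (\<lambda>w. path_increments M w i j) (Pi_pmf ({0..M} \<times> {0..j} \<union> {0..i} \<times> {Suc j}) 0 law)
      = Pi_pmf {0..M} 0 pathlaw"
  shows "map_pmf (\<lambda>w. path_increments M w (Suc i) j)
      (Pi_pmf ({0..M} \<times> {0..j} \<union> {0..Suc i} \<times> {Suc j}) 0 law) = Pi_pmf {0..M} 0 pathlaw"
proof -
  let ?c = "(Suc i, Suc j)" and ?B = "{0..M} \<times> {0..j} \<union> {0..i} \<times> {Suc j}"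
  let ?\<phi> = "\<lambda>y g. g(0 := y + (g 0 - g (Suc i)), Suc i := y + (g (Suc i) - g 0))"
  \<comment> \<open>\<open>max u v - u\<close> is the truncated difference \<open>v - u\<close>;
    this turns the recursion of \<open>lpp\<close> into the corner map.\<close>
  have upd: "path_increments M (f(?c := y)) (Suc i) j = ?\<phi> y (path_increments M f i j)" for f y
  proof
    fix m
    have mono: "lpp f i j \<le> lpp f (Suc i) j" "lpp f i j \<le> lpp f i (Suc j)"
      by (rule lpp_le_Suc1, rule lpp_le_Suc2)
    consider "m = 0" | "m = Suc i" | "0 < m" "m \<le> i" | "Suc i < m" by linarith
    then show "path_increments M (f(?c := y)) (Suc i) j m = ?\<phi> y (path_increments M f i j) m"
    proof cases
      case 1
      then show ?thesis using mono i by (simp add: path_increments_def lpp_upd)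
    next
      case 2
      then show ?thesis using mono i by (simp add: path_increments_def lpp_upd)
    next
      case 3
      then show ?thesis using i by (simp add: path_increments_def lpp_upd)
    next
      case 4
      then show ?thesis by (simp add: path_increments_def lpp_upd)
    qed
  qed
  have "{0..M} \<times> {0..j} \<union> {0..Suc i} \<times> {Suc j} = insert ?c ?B" by auto
  then have "map_pmf (\<lambda>w. path_increments M w (Suc i) j)
        (Pi_pmf ({0..M} \<times> {0..j} \<union> {0..Suc i} \<times> {Suc j}) 0 law)
      = map_pmf (\<lambda>(y, f). ?\<phi> y (path_increments M f i j)) (pair_pmf (law ?c) (Pi_pmf ?B 0 law))"
    by (simp add: Pi_pmf_insert map_pmf_comp case_prod_unfold upd)
  also have "\<dots> = map_pmf (\<lambda>(y, g). ?\<phi> y g)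
      (pair_pmf (geometric1_pmf p) (map_pmf (\<lambda>w. path_increments M w i j) (Pi_pmf ?B 0 law)))"
    by (simp add: pair_map_pmf2 map_pmf_comp case_prod_unfold stationary_law_def)
  also have "\<dots> = Pi_pmf {0..M} 0 pathlaw"
    unfolding IH by (rule path_flip[OF i])
  finally show ?thesis .
qed

text \<open>Row \<open>j\<close> is deformed into row \<open>Suc j\<close> by moving the vertical
  step from column 0 to column \<open>M\<close>, one corner at a time, with the product law
  preserved throughout.\<close>

lemma row_increments_law:
  "map_pmf (\<lambda>w. row_increments M w j) (Pi_pmf ({0..M} \<times> {0..j}) 0 law)
    = Pi_pmf {1..M} 0 (\<lambda>_. geometric1_pmf p1)"
proof (induction j)
  case 0
  then show ?case by (rule row_increments_0)
next
  case (Suc j)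
  have "map_pmf (\<lambda>w. path_increments M w i j) (Pi_pmf ({0..M} \<times> {0..j} \<union> {0..i} \<times> {Suc j}) 0 law)
      = Pi_pmf {0..M} 0 pathlaw" if "i \<le> M" for i
    using that
  proof (induction i)
    case 0
    then show ?case using path_increments_0[OF Suc] by simp
  next
    case (Suc i)
    then show ?case by (intro path_increments_Suc) auto
  qed
  from this[of M] have *: "map_pmf (\<lambda>w. path_increments M w M j) (Pi_pmf ({0..M} \<times> {0..j} \<union> {0..M} \<times> {Suc j}) 0 law)
      = Pi_pmf {0..M} 0 pathlaw" by simp
  have B: "{0..M} \<times> {0..j} \<union> {0..M} \<times> {Suc j} = {0..M} \<times> {0..Suc j}" by auto
  have "row_increments M w (Suc j) = (\<lambda>m. if m \<in> {1..M} then path_increments M w M j m else 0)" for w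
    by (rule ext) (auto simp: row_increments_def path_increments_def)
  then have "map_pmf (\<lambda>w. row_increments M w (Suc j)) (Pi_pmf ({0..M} \<times> {0..Suc j}) 0 law)
      = map_pmf (\<lambda>g m. if m \<in> {1..M} then g m else 0) (Pi_pmf {0..M} 0 pathlaw)"
    unfolding *[symmetric] B by (simp add: map_pmf_comp)
  also have "\<dots> = Pi_pmf {1..M} 0 pathlaw"
    by (rule Pi_pmf_subset[symmetric]) auto
  also have "\<dots> = Pi_pmf {1..M} 0 (\<lambda>_. geometric1_pmf p1)"
    by (rule Pi_pmf_cong) auto
  finally show ?case .
qed

text \<open>The passage time telescopes up the vertical axis and then along row \<open>N\<close>:
  the first \<open>N\<close> terms are boundary weights of mean \<open>1 / p2\<close>, the other
  \<open>M\<close> are stationary increments of mean \<open>1 / p1\<close>.\<close>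

lemma nn_integral_lpp_stationary:
  "(\<integral>\<^sup>+ w. of_nat (lpp w M N) \<partial>Pi_pmf ({0..M} \<times> {0..N}) 0 law) = ennreal (real M / p1 + real N / p2)"
proof -
  let ?Q = "Pi_pmf ({0..M} \<times> {0..N}) 0 law"
  have col: "lpp w 0 n = w (0, 0) + (\<Sum>k\<in>{1..n}. w (0, k))" for w n
    by (induction n) auto
  have row: "lpp w m N = lpp w 0 N + (\<Sum>k\<in>{1..m}. row_increments M w N k)" if "m \<le> M" for w m
    using that
  proof (induction m)
    case (Suc m)
    then show ?case using lpp_le_Suc1[of w m N] by (simp add: row_increments_def)
  qed simp
  have marg: "(\<integral>\<^sup>+ w. of_nat (w c) \<partial>?Q) = (\<integral>\<^sup>+ k. of_nat k \<partial>law c)" if "c \<in> {0..M} \<times> {0..N}" for c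
  proof -
    have "(\<integral>\<^sup>+ w. of_nat (w c) \<partial>?Q) = (\<integral>\<^sup>+ k. of_nat k \<partial>map_pmf (\<lambda>w. w c) ?Q)" by simp
    also have "map_pmf (\<lambda>w. w c) ?Q = law c" using that by (subst Pi_pmf_component) auto
    finally show ?thesis .
  qed
  have inc: "(\<integral>\<^sup>+ w. of_nat (row_increments M w N k) \<partial>?Q) = ennreal (1 / p1)" if k: "k \<in> {1..M}" for k
  proof -
    have "(\<integral>\<^sup>+ w. of_nat (row_increments M w N k) \<partial>?Q)
        = (\<integral>\<^sup>+ g. of_nat (g k) \<partial>map_pmf (\<lambda>w. row_increments M w N) ?Q)" by simp
    also have "\<dots> = (\<integral>\<^sup>+ y. of_nat y \<partial>map_pmf (\<lambda>g. g k) (Pi_pmf {1..M} 0 (\<lambda>_. geometric1_pmf p1)))"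
      unfolding row_increments_law by simp
    also have "map_pmf (\<lambda>g. g k) (Pi_pmf {1..M} 0 (\<lambda>_. geometric1_pmf p1)) = geometric1_pmf p1"
      using k by (subst Pi_pmf_component) auto
    finally show ?thesis using nn_integral_geometric1_pmf p by simp
  qed
  have "(\<integral>\<^sup>+ w. of_nat (lpp w M N) \<partial>?Q) = (\<integral>\<^sup>+ w. of_nat (w (0, 0)) + (\<Sum>k\<in>{1..N}. of_nat (w (0, k)))
      + (\<Sum>k\<in>{1..M}. of_nat (row_increments M w N k)) \<partial>?Q)"
    by (simp add: row col)
  also have "\<dots> = (\<integral>\<^sup>+ w. of_nat (w (0, 0)) \<partial>?Q) + (\<Sum>k\<in>{1..N}. \<integral>\<^sup>+ w. of_nat (w (0, k)) \<partial>?Q)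
      + (\<Sum>k\<in>{1..M}. \<integral>\<^sup>+ w. of_nat (row_increments M w N k) \<partial>?Q)"
    by (simp add: nn_integral_add nn_integral_sum)
  also have "(\<integral>\<^sup>+ w. of_nat (w (0, 0)) \<partial>?Q) = 0"
    by (subst marg) (auto simp: stationary_law_def)
  also have "(\<Sum>k\<in>{1..N}. \<integral>\<^sup>+ w. of_nat (w (0, k)) \<partial>?Q) = (\<Sum>k\<in>{1..N}. ennreal (1 / p2))"
    using p by (intro sum.cong refl) (subst marg, auto simp: stationary_law_def nn_integral_geometric1_pmf simp del: nn_integral_map_pmf)
  also have "(\<Sum>k\<in>{1..M}. \<integral>\<^sup>+ w. of_nat (row_increments M w N k) \<partial>?Q) = (\<Sum>k\<in>{1..M}. ennreal (1 / p1))"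
    by (intro sum.cong refl inc)
  also have "0 + (\<Sum>k\<in>{1..N}. ennreal (1 / p2)) + (\<Sum>k\<in>{1..M}. ennreal (1 / p1))
      = ennreal (real N * (1 / p2)) + ennreal (real M * (1 / p1))"
    using p by (simp add: ennreal_of_nat_eq_real_of_nat flip: ennreal_mult'')
  also have "\<dots> = ennreal (real M / p1 + real N / p2)"
    using p by (subst ennreal_plus[symmetric]) (auto simp: add.commute)
  finally show ?thesis .
qed

text \<open>The weights are coupled by restricting the stationary field to the interior, where it is
  positive. Restoring the axes and the cells missing from \<open>x\<close> only increases the
  passage time.\<close>

lemma expected_lpp_le_stationary:
  assumes x: "x \<subseteq> {1..M} \<times> {1..N}"
  shows "expected_lpp p M N x \<le> ennreal (real M / p1 + real N / p2)"
proof -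
  let ?A = "{1..M} \<times> {1..N}"
  let ?Q = "Pi_pmf ({0..M} \<times> {0..N}) 0 law"
  let ?r = "\<lambda>w c. if c \<in> ?A then w c else 0"
  have "Pi_pmf ?A 0 (\<lambda>_. geometric_pmf p) = Pi_pmf ?A 0 (\<lambda>_. map_pmf (\<lambda>k. k - 1) (geometric1_pmf p))"
    by (simp add: map_pmf_comp)
  also have "\<dots> = map_pmf (\<lambda>h. (\<lambda>k. k - 1) \<circ> h) (Pi_pmf ?A 0 (\<lambda>_. geometric1_pmf p))"
    by (rule Pi_pmf_map) auto
  also have "Pi_pmf ?A 0 (\<lambda>_. geometric1_pmf p) = Pi_pmf ?A 0 law"
    by (rule Pi_pmf_cong) (auto simp: stationary_law_def)
  also have "\<dots> = map_pmf ?r ?Q"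
    by (rule Pi_pmf_subset) auto
  finally have "expected_lpp p M N x = (\<integral>\<^sup>+ w. of_nat (lpp (cell_weight x (\<lambda>c. ?r w c - 1)) M N) \<partial>?Q)"
    unfolding expected_lpp_def by (simp add: comp_def)
  also have "\<dots> \<le> (\<integral>\<^sup>+ w. of_nat (lpp w M N) \<partial>?Q)"
  proof (intro nn_integral_mono_AE AE_pmfI of_nat_mono lpp_mono)
    fix w a b assume w: "w \<in> set_pmf ?Q"
    have "w (a, b) \<in> set_pmf (law (a, b))" if "(a, b) \<in> x"
      using w x that by (subst (asm) set_Pi_pmf) (auto simp: PiE_dflt_def)
    then have "w (a, b) \<noteq> 0" if "(a, b) \<in> x"
      using that x by (auto simp: stationary_law_def split: if_splits)
    then show "cell_weight x (\<lambda>c. ?r w c - 1) (a, b) \<le> w (a, b)"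
      using x by (auto simp: cell_weight_def)
  qed
  finally show ?thesis
    unfolding nn_integral_lpp_stationary .
qed

end

lemma expected_lpp_le:
  assumes p: "0 < p" "p \<le> 1" and MN: "0 < M" "0 < N" and x: "x \<subseteq> {1..M} \<times> {1..N}"
  shows "expected_lpp p M N x \<le> ennreal ((M + N + 2 * sqrt ((1 - p) * M * N)) / p)"
proof (cases "p = 1")
  case True
  then show ?thesis
    using expected_lpp_le_stationary[of 1 1 p x M N] p x by simp
next
  case False
  define q where "q = 1 - p"
  have q: "0 < q" "q < 1" "p = 1 - q" using False p by (auto simp: q_def)
  \<comment> \<open>For every \<open>s > 0\<close> the parameters below satisfy the Burke relation
    and give the bound \<open>(M + N + M s + q N / s) / p\<close>; this value of \<open>s\<close>
    equates the last two terms. It would be 0 for \<open>p = 1\<close>, hence the separate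
    case.\<close>
  define s where "s = sqrt (q * N / M)"
  have s: "s > 0" "s * s = q * N / M" using q MN by (auto simp: s_def real_sqrt_mult_self simp flip: power2_eq_square)
  define p1 where "p1 = p / (1 + s)"
  define p2 where "p2 = s * p / (q + s)"
  have p1: "0 < p1" "p1 \<le> 1" using s p q by (auto simp: p1_def field_simps)
  have p2: "0 < p2" "p2 \<le> 1"
  proof -
    show "0 < p2" using s p q by (simp add: p2_def)
    have "s * p \<le> s * 1" using s p by (intro mult_left_mono) auto
    then have "s * p \<le> q + s" using q by simp
    then show "p2 \<le> 1" using s q by (simp add: p2_def)
  qed
  have a1: "1 - p1 = (s + q) / (1 + s)" using s(1) q(1,2) unfolding p1_def q(3) by (simp add: field_simps)
  have a2: "1 - p2 = q * (1 + s) / (q + s)" using s(1) q(1,2) unfolding p2_def q(3) by (simp add: field_simps)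
  have eq: "(1 - p1) * (1 - p2) = 1 - p"
    unfolding a1 a2 using s q by (simp add: add.commute)
  have r: "sqrt (q * M * N) = M * s"
  proof -
    have "q * M * N = (M * s) * (M * s)"
      using s(2) MN by (simp add: field_simps)
    then have "sqrt (q * M * N) = \<bar>M * s\<bar>" by (simp only: real_sqrt_abs2)
    then show ?thesis using s by simp
  qed
  have "M / p1 + N / p2 = (M * (1 + s) + N * (q + s) / s) / p"
    using s p by (simp add: p1_def p2_def field_simps)
  also have "N * (q + s) / s = N + N * q / s" using s by (simp add: field_simps)
  also have "N * q / s = M * s"
    using s MN by (simp add: field_simps)
  also have "(M * (1 + s) + (N + M * s)) / p = (M + N + 2 * sqrt ((1 - p) * M * N)) / p"
    using r by (simp add: q_def algebra_simps)
  finally show ?thesis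
    using expected_lpp_le_stationary[OF p1 p2 p eq x] by simp
qed

section \<open>Inversions of signed permutations\<close>

definition signed_range :: "nat \<Rightarrow> int set" where
  "signed_range n = {a. a \<noteq> 0 \<and> \<bar>a\<bar> \<le> int n}"

text \<open>The value -1 at 0 makes all simple reflections alike: each exchanges
  \<open>low i\<close> and \<open>high i\<close>, which are neighbours among the nonzero integers,
  and likewise their negatives.\<close>

definition low :: "nat \<Rightarrow> int" where
  "low i = (if i = 0 then -1 else int i)"

definition high :: "nat \<Rightarrow> int" where
  "high i = int i + 1"

lemma simple_refl_apply:
  "simple_refl i x = (if x = low i then high i else if x = high i then low i
     else if x = - low i then - high i else if x = - high i then - low i else x)"
  by (auto simp: simple_refl_def low_def high_def Transposition.transpose_def)

lemma simple_refl_invol [simp]: "simple_refl i (simple_refl i x) = x"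
  by (auto simp: simple_refl_apply low_def high_def)

lemma simple_refl_comp_invol [simp]: "simple_refl i \<circ> simple_refl i = id"
  by (simp add: fun_eq_iff)

lemma simple_refl_comp_cancel [simp]: "simple_refl i \<circ> (simple_refl i \<circ> w) = w"
  by (simp add: fun_eq_iff)

lemma simple_refl_minus [simp]: "simple_refl i (- x) = - simple_refl i x"
  by (auto simp: simple_refl_apply low_def high_def)

lemma simple_refl_low [simp]: "simple_refl i (low i) = high i"
  by (simp add: simple_refl_apply)

lemma simple_refl_high [simp]: "simple_refl i (high i) = low i"
  by (simp add: simple_refl_apply low_def high_def)

lemma low_less_high: "low i < high i"
  by (simp add: low_def high_def)

lemma bij_simple_refl: "bij (simple_refl i)"
  by (rule involuntory_imp_bij) simp

lemma inv_simple_refl: "inv (simple_refl i) = simple_refl i"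
  by (rule inv_unique_comp) simp_all

lemma simple_refl_in_range:
  "i < n \<Longrightarrow> a \<in> signed_range n \<Longrightarrow> simple_refl i a \<in> signed_range n"
  by (auto simp: simple_refl_apply signed_range_def low_def high_def)

lemma low_in_range: "i < n \<Longrightarrow> low i \<in> signed_range n"
  by (auto simp: signed_range_def low_def)

lemma high_in_range: "i < n \<Longrightarrow> high i \<in> signed_range n"
  by (auto simp: signed_range_def high_def)

lemma uminus_in_range: "- a \<in> signed_range n \<longleftrightarrow> a \<in> signed_range n"
  by (auto simp: signed_range_def)

lemma finite_signed_range: "finite (signed_range n)"
  by (rule finite_subset[of _ "{- int n..int n}"]) (auto simp: signed_range_def)

lemma simple_refl_hyperoctahedral:
  assumes "i < n" shows "simple_refl i \<in> hyperoctahedral n"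
proof -
  have "simple_refl i permutes {- int n..int n}"
    using assms by (intro bij_imp_permutes bij_betwI[where g = "simple_refl i"])
      (auto simp: simple_refl_apply low_def high_def)
  then show ?thesis by (simp add: hyperoctahedral_def)
qed

lemma comp_hyperoctahedral:
  "u \<in> hyperoctahedral n \<Longrightarrow> v \<in> hyperoctahedral n \<Longrightarrow> u \<circ> v \<in> hyperoctahedral n"
  by (auto simp: hyperoctahedral_def intro: permutes_compose)

lemma id_hyperoctahedral: "id \<in> hyperoctahedral n"
  by (simp add: hyperoctahedral_def permutes_id)

lemma word_prod_simps [simp]:
  "word_prod [] = id" "word_prod (i # ws) = simple_refl i \<circ> word_prod ws"
  by (simp_all add: word_prod_def)

lemma word_prod_hyperoctahedral: "set ws \<subseteq> {..<n} \<Longrightarrow> word_prod ws \<in> hyperoctahedral n"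
  by (induction ws) (auto simp: id_hyperoctahedral intro: comp_hyperoctahedral simple_refl_hyperoctahedral)

lemma bij_hyperoctahedral: "w \<in> hyperoctahedral n \<Longrightarrow> bij w"
  by (auto simp: hyperoctahedral_def permutes_bij)

lemma inv_hyperoctahedral:
  assumes w: "w \<in> hyperoctahedral n" shows "inv w \<in> hyperoctahedral n"
proof -
  have "inv w (- x) = - inv w x" for x
  proof -
    have "w (- inv w x) = - x"
      using w bij_hyperoctahedral[OF w] by (simp add: hyperoctahedral_def bij_is_surj surj_f_inv_f)
    then show ?thesis
      using bij_hyperoctahedral[OF w] by (metis bij_inv_eq_iff)
  qed
  then show ?thesis
    using w by (auto simp: hyperoctahedral_def intro: permutes_inv)
qed

lemma finite_hyperoctahedral: "finite (hyperoctahedral n)"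
  by (rule finite_subset[OF _ finite_permutations[of "{- int n..int n}"]]) (auto simp: hyperoctahedral_def)

lemma hyperoctahedral_minus: "w \<in> hyperoctahedral n \<Longrightarrow> w (- x) = - w x"
  by (simp add: hyperoctahedral_def)

lemma hyperoctahedral_in_range:
  assumes w: "w \<in> hyperoctahedral n" and a: "a \<in> signed_range n" shows "w a \<in> signed_range n"
proof -
  have "w 0 = - w 0" using hyperoctahedral_minus[OF w, of 0] by simp
  then have "w 0 = 0" by simp
  then have "w a \<noteq> 0" using a injD[OF bij_is_inj[OF bij_hyperoctahedral[OF w]], of a 0]
    by (auto simp: signed_range_def)
  moreover have "w a \<in> {- int n..int n}"
    using w a permutes_in_image[of w "{- int n..int n}" a] by (auto simp: hyperoctahedral_def signed_range_def)
  ultimately show ?thesis by (auto simp: signed_range_def)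
qed

text \<open>Reflections are encoded by pairs of values: the pairs \<open>(a, b)\<close> and \<open>(- b, - a)\<close> stand for the
  same reflection.\<close>

definition inversions :: "nat \<Rightarrow> (int \<Rightarrow> int) \<Rightarrow> (int \<times> int) set" where
  "inversions n w = {(a, b). a \<in> signed_range n \<and> b \<in> signed_range n \<and> a < b \<and> inv w b < inv w a}"

definition left_descent :: "(int \<Rightarrow> int) \<Rightarrow> nat \<Rightarrow> bool" where
  "left_descent w i \<longleftrightarrow> inv w (high i) < inv w (low i)"

definition simple_pairs :: "nat \<Rightarrow> (int \<times> int) set" where
  "simple_pairs i = {(low i, high i), (- high i, - low i)}"

definition pair_orbit :: "int \<times> int \<Rightarrow> (int \<times> int) set" where
  "pair_orbit c = {c, (- snd c, - fst c)}"

text \<open>Counting mirror orbits instead of pairs lets each reflection contribute once, so that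
  the count is the Coxeter length, as \<open>reduced_word_for_iff\<close> confirms.\<close>

definition inv_count :: "nat \<Rightarrow> (int \<Rightarrow> int) \<Rightarrow> nat" where
  "inv_count n w = card (pair_orbit ` inversions n w)"

lemma inversions_subset: "inversions n w \<subseteq> signed_range n \<times> signed_range n"
  by (auto simp: inversions_def)

lemma finite_inversions: "finite (inversions n w)"
  using finite_subset[OF inversions_subset] finite_signed_range by blast

lemma inversions_id [simp]: "inversions n id = {}" "inversions n (\<lambda>a. a) = {}"
  by (auto simp: inversions_def)

lemma left_descent_iff: "i < n \<Longrightarrow> left_descent w i \<longleftrightarrow> (low i, high i) \<in> inversions n w"
  by (simp add: left_descent_def inversions_def low_in_range high_in_range low_less_high)

lemma inversions_sym:
  assumes "w \<in> hyperoctahedral n"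
  shows "(- b, - a) \<in> inversions n w \<longleftrightarrow> (a, b) \<in> inversions n w"
  using hyperoctahedral_minus[OF inv_hyperoctahedral[OF assms]]
  by (auto simp: inversions_def uminus_in_range)

lemma inv_simple_refl_comp:
  assumes "w \<in> hyperoctahedral n"
  shows "inv (simple_refl i \<circ> w) = inv w \<circ> simple_refl i"
  using assms by (simp add: o_inv_distrib bij_hyperoctahedral bij_simple_refl inv_simple_refl)

text \<open>Exchanging neighbours disturbs no comparison but their own. Zero is excluded because for
  \<open>i = 0\<close> it lies between -1 and 1.\<close>

lemma simple_refl_less_iff:
  assumes "a \<noteq> 0" "b \<noteq> 0" "a < b"
  shows "simple_refl i a < simple_refl i b \<longleftrightarrow> (a, b) \<notin> simple_pairs i"
proof -
  have "(if a = l then h else if a = h then l else if a = - l then - h else if a = - h then - l else a)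
      < (if b = l then h else if b = h then l else if b = - l then - h else if b = - h then - l else b)
    \<longleftrightarrow> \<not> (a = l \<and> b = h \<or> a = - h \<and> b = - l)"
    if "l = -1 \<and> h = 1 \<or> 0 < l \<and> h = l + 1" for l h :: int
    using that
  proof
    assume "l = -1 \<and> h = 1"
    then show ?thesis using assms by auto
  next
    assume *: "0 < l \<and> h = l + 1"
    consider "a = l" | "a = h" | "a = - l" | "a = - h" | "a \<noteq> l \<and> a \<noteq> h \<and> a \<noteq> -l \<and> a \<noteq> -h" by blast
    then show ?thesis using * assms(3) by cases auto
  qed
  moreover have "low i = -1 \<and> high i = 1 \<or> 0 < low i \<and> high i = low i + 1"
    by (cases i) (simp_all add: low_def high_def)
  ultimately show ?thesis
    unfolding simple_refl_apply simple_pairs_def by simp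
qed

lemma simple_pairs_flip:
  "(a, b) \<in> simple_pairs i \<Longrightarrow> simple_refl i a = b \<and> simple_refl i b = a"
  by (auto simp: simple_pairs_def)

definition map_pairs :: "nat \<Rightarrow> (int \<times> int) set \<Rightarrow> (int \<times> int) set" where
  "map_pairs i A = map_prod (simple_refl i) (simple_refl i) ` A"

lemma in_map_pairs: "(a, b) \<in> map_pairs i A \<longleftrightarrow> (simple_refl i a, simple_refl i b) \<in> A"
  unfolding map_pairs_def by force

text \<open>Left multiplication relabels values, and all comparisons except that of the reflection's
  own pair survive the relabelling. So stripping a left descent costs exactly its simple
  pairs.\<close>

lemma inversions_simple_refl_comp:
  assumes w: "w \<in> hyperoctahedral n" and i: "i < n" and d: "left_descent w i"
  shows "inversions n (simple_refl i \<circ> w) = map_pairs i (inversions n w - simple_pairs i)"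
    and "inversions n w = simple_pairs i \<union> map_pairs i (inversions n (simple_refl i \<circ> w))"
    and "simple_pairs i \<inter> map_pairs i (inversions n (simple_refl i \<circ> w)) = {}"
proof -
  have sp: "simple_pairs i \<subseteq> inversions n w"
    using d inversions_sym[OF w, of "high i" "low i"] by (auto simp: simple_pairs_def left_descent_iff[OF i])
  have nz: "a \<noteq> 0" if "a \<in> signed_range n" for a using that by (simp add: signed_range_def)
  have r: "simple_refl i a \<in> signed_range n \<longleftrightarrow> a \<in> signed_range n" for a
    using simple_refl_in_range[OF i, of a] simple_refl_in_range[OF i, of "simple_refl i a"] by auto
  show 1: "inversions n (simple_refl i \<circ> w) = map_pairs i (inversions n w - simple_pairs i)"
  proof (rule Set.set_eqI)
    fix z :: "int \<times> int" obtain a b where z: "z = (a, b)" by (cases z)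
    let ?a = "simple_refl i a" and ?b = "simple_refl i b"
    have "(a, b) \<in> inversions n (simple_refl i \<circ> w) \<longleftrightarrow>
        ?a \<in> signed_range n \<and> ?b \<in> signed_range n \<and> a < b \<and> inv w ?b < inv w ?a"
      by (simp add: inversions_def inv_simple_refl_comp[OF w] r)
    also have "\<dots> \<longleftrightarrow> ?a \<in> signed_range n \<and> ?b \<in> signed_range n \<and> ?a < ?b \<and> (?a, ?b) \<notin> simple_pairs i \<and> inv w ?b < inv w ?a"
    proof (cases "?a \<in> signed_range n \<and> ?b \<in> signed_range n \<and> inv w ?b < inv w ?a")
      case True
      have "a < b \<longleftrightarrow> ?a < ?b \<and> (?a, ?b) \<notin> simple_pairs i"
      proof
        assume ab: "a < b"
        have "(a, b) \<notin> simple_pairs i"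
        proof
          assume "(a, b) \<in> simple_pairs i"
          then have "(a, b) \<in> inversions n w" using sp by blast
          then have "inv w b < inv w a" by (simp add: inversions_def)
          with True simple_pairs_flip[OF \<open>(a, b) \<in> simple_pairs i\<close>] show False by simp
        qed
        moreover have "a \<noteq> 0" "b \<noteq> 0" using True nz r by blast+
        ultimately have "?a < ?b" using simple_refl_less_iff ab by blast
        moreover have "(?a, ?b) \<notin> simple_pairs i"
        proof
          assume "(?a, ?b) \<in> simple_pairs i"
          from simple_pairs_flip[OF this] have "a = ?b" "b = ?a"
            unfolding simple_refl_invol by (rule conjunct1, rule conjunct2)
          with \<open>?a < ?b\<close> ab show False by linarith
        qed
        ultimately show "?a < ?b \<and> (?a, ?b) \<notin> simple_pairs i" by blast
      next
        assume "?a < ?b \<and> (?a, ?b) \<notin> simple_pairs i"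
        then show "a < b" using simple_refl_less_iff[of ?a ?b i] True nz by auto
      qed
      then show ?thesis by blast
    next
      case False then show ?thesis by blast
    qed
    finally show "z \<in> inversions n (simple_refl i \<circ> w) \<longleftrightarrow> z \<in> map_pairs i (inversions n w - simple_pairs i)"
      unfolding z in_map_pairs by (auto simp: inversions_def)
  qed
  have 2: "map_pairs i (inversions n (simple_refl i \<circ> w)) = inversions n w - simple_pairs i"
    unfolding 1 by (auto simp: in_map_pairs)
  show "inversions n w = simple_pairs i \<union> map_pairs i (inversions n (simple_refl i \<circ> w))"
    unfolding 2 using sp by blast
  show "simple_pairs i \<inter> map_pairs i (inversions n (simple_refl i \<circ> w)) = {}"
    unfolding 2 by blast
qed

lemma inv_count_Suc:
  assumes w: "w \<in> hyperoctahedral n" and i: "i < n" and d: "left_descent w i"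
  shows "inv_count n w = Suc (inv_count n (simple_refl i \<circ> w))"
proof -
  let ?I = "inversions n (simple_refl i \<circ> w)" and ?s = "simple_refl i"
  let ?f = "\<lambda>X. map_prod ?s ?s ` X"
  have orb: "pair_orbit (map_prod ?s ?s c) = ?f (pair_orbit c)" for c
    by (auto simp: pair_orbit_def map_prod_def split: prod.splits)
  have "inj ?s" by (rule bij_is_inj[OF bij_simple_refl])
  then have "inj (map_prod ?s ?s)" by (rule prod.inj_map) (rule \<open>inj ?s\<close>)
  then have injf: "inj ?f" by (intro injI) (simp only: inj_image_eq_iff)
  have orb_sp: "pair_orbit ` simple_pairs i = {simple_pairs i}"
    by (auto simp: pair_orbit_def simple_pairs_def)
  have "pair_orbit ` inversions n w = insert (simple_pairs i) (?f ` (pair_orbit ` ?I))"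
    by (subst inversions_simple_refl_comp(2)[OF assms])
      (simp add: image_Un orb_sp map_pairs_def image_image orb)
  moreover have "simple_pairs i \<notin> ?f ` (pair_orbit ` ?I)"
  proof
    assume "simple_pairs i \<in> ?f ` (pair_orbit ` ?I)"
    then obtain c where c: "c \<in> ?I" "simple_pairs i = ?f (pair_orbit c)" by auto
    then have "map_prod ?s ?s c \<in> simple_pairs i \<inter> map_pairs i ?I"
      by (auto simp: pair_orbit_def map_pairs_def)
    then show False using inversions_simple_refl_comp(3)[OF assms] by blast
  qed
  moreover have "card (?f ` (pair_orbit ` ?I)) = card (pair_orbit ` ?I)"
    by (rule card_image[OF inj_on_subset[OF injf]]) simp
  ultimately show ?thesis
    using finite_inversions[of n "?s \<circ> w"] by (simp add: inv_count_def)
qed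

lemma left_descent_simple_refl_comp:
  assumes w: "w \<in> hyperoctahedral n" and i: "i < n"
  shows "left_descent (simple_refl i \<circ> w) i \<longleftrightarrow> \<not> left_descent w i"
proof -
  have "inv w (low i) \<noteq> inv w (high i)"
    using injD[OF bij_is_inj[OF bij_hyperoctahedral[OF inv_hyperoctahedral[OF w]]], of "low i" "high i"]
      low_less_high[of i] by auto
  then show ?thesis by (auto simp: left_descent_def inv_simple_refl_comp[OF w])
qed

lemma inv_count_simple_refl_comp:
  assumes w: "w \<in> hyperoctahedral n" and i: "i < n"
  shows "inv_count n w \<le> Suc (inv_count n (simple_refl i \<circ> w))"
    and "inv_count n (simple_refl i \<circ> w) < inv_count n w \<longleftrightarrow> left_descent w i"
proof -
  have w': "simple_refl i \<circ> w \<in> hyperoctahedral n"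
    by (rule comp_hyperoctahedral[OF simple_refl_hyperoctahedral[OF i] w])
  have "inv_count n w \<le> Suc (inv_count n (simple_refl i \<circ> w)) \<and>
    (inv_count n (simple_refl i \<circ> w) < inv_count n w \<longleftrightarrow> left_descent w i)"
  proof (cases "left_descent w i")
    case True
    then show ?thesis using inv_count_Suc[OF w i True] by simp
  next
    case False
    then have "left_descent (simple_refl i \<circ> w) i" using left_descent_simple_refl_comp[OF w i] by simp
    from inv_count_Suc[OF w' i this] show ?thesis using False by simp
  qed
  then show "inv_count n w \<le> Suc (inv_count n (simple_refl i \<circ> w))"
    "inv_count n (simple_refl i \<circ> w) < inv_count n w \<longleftrightarrow> left_descent w i" by blast+
qed

lemma strict_mono_self_map_id:
  fixes f :: "int \<Rightarrow> int"
  assumes mono: "\<And>i. 1 \<le> i \<Longrightarrow> i < m \<Longrightarrow> f i < f (i + 1)"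
    and range: "\<And>i. 1 \<le> i \<Longrightarrow> i \<le> m \<Longrightarrow> 1 \<le> f i \<and> f i \<le> m"
    and i: "1 \<le> i" "i \<le> m"
  shows "f i = i"
proof -
  have "i \<le> m \<longrightarrow> i \<le> f i" if "1 \<le> i" for i
    using that
  proof (induction i rule: int_ge_induct)
    case (step i)
    then show ?case using mono[of i] by auto
  qed (use range in auto)
  moreover have "1 \<le> i \<longrightarrow> f i \<le> i" if "i \<le> m" for i
    using that
  proof (induction i rule: int_le_induct)
    case (step i)
    then show ?case using mono[of "i - 1"] by auto
  qed (use range in auto)
  ultimately show ?thesis using i by (simp add: antisym)
qed

text \<open>Without a descent the inverse \<open>v\<close> satisfies
  \<open>0 < v 1 < ... < v n\<close>, and a strictly increasing self-map of \<open>{1..n}\<close> is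
  the identity.\<close>

lemma ex_left_descent:
  assumes w: "w \<in> hyperoctahedral n" and neq: "w \<noteq> id"
  obtains i where "i < n" "left_descent w i"
proof (rule ccontr)
  assume "\<not> thesis"
  then have nd: "\<And>i. i < n \<Longrightarrow> \<not> left_descent w i" using that by blast
  let ?v = "inv w"
  have v: "?v \<in> hyperoctahedral n" by (rule inv_hyperoctahedral[OF w])
  have injv: "?v a = ?v b \<Longrightarrow> a = b" for a b
    using bij_is_inj[OF bij_hyperoctahedral[OF v]] by (auto dest: injD)
  have up: "?v (low i) < ?v (high i)" if "i < n" for i
    using nd[OF that] injv[of "low i" "high i"] low_less_high[of i] by (fastforce simp: left_descent_def)
  have mono: "?v i < ?v (i + 1)" if "1 \<le> i" "i < int n" for i
    using up[of "nat i"] that by (simp add: low_def high_def)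
  have pos: "1 \<le> i \<Longrightarrow> i \<le> int n \<Longrightarrow> 1 \<le> ?v i" for i
  proof (induction i rule: int_ge_induct)
    case base
    then show ?case
      using up[of 0] hyperoctahedral_minus[OF v, of 1] by (simp add: low_def high_def)
  next
    case (step i)
    then show ?case using mono[of i] by simp
  qed
  have le: "?v i \<le> int n" if "1 \<le> i" "i \<le> int n" for i
    using hyperoctahedral_in_range[OF v, of i] that by (auto simp: signed_range_def)
  have fix_pos: "?v i = i" if "1 \<le> i" "i \<le> int n" for i
    using strict_mono_self_map_id[of "int n" ?v i] mono pos le that by blast
  have "?v i = i" for i
  proof -
    consider "i \<in> {1..int n}" | "- i \<in> {1..int n}" | "i = 0" | "i \<notin> {- int n..int n}" by fastforce
    then show ?thesis
    proof cases
      case 2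
      then show ?thesis using fix_pos[of "- i"] hyperoctahedral_minus[OF v, of i] by simp
    next
      case 3
      then show ?thesis using hyperoctahedral_minus[OF v, of 0] by simp
    next
      case 4
      then show ?thesis using v by (auto simp: hyperoctahedral_def dest: permutes_not_in)
    qed (use fix_pos in auto)
  qed
  then have "?v = id" by auto
  then have "w = id" using bij_hyperoctahedral[OF w] by (metis inv_id inv_inv_eq)
  with neq show False by blast
qed

lemma inv_count_le_length: "set ws \<subseteq> {..<n} \<Longrightarrow> inv_count n (word_prod ws) \<le> length ws"
proof (induction ws)
  case Nil
  then show ?case by (simp add: inv_count_def)
next
  case (Cons i ws)
  let ?w = "word_prod (i # ws)"
  have "?w \<in> hyperoctahedral n" by (rule word_prod_hyperoctahedral[OF Cons.prems])
  then have "inv_count n ?w \<le> Suc (inv_count n (simple_refl i \<circ> ?w))"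
    using Cons.prems by (intro inv_count_simple_refl_comp) auto
  also have "simple_refl i \<circ> ?w = word_prod ws" by simp
  also have "Suc (inv_count n (word_prod ws)) \<le> length (i # ws)" using Cons by simp
  finally show ?case .
qed

lemma ex_word_inv_count:
  "w \<in> hyperoctahedral n \<Longrightarrow> \<exists>ws. word_for n ws w \<and> length ws = inv_count n w"
proof (induction "inv_count n w" arbitrary: w rule: less_induct)
  case less
  show ?case
  proof (cases "w = id")
    case True
    then show ?thesis by (intro exI[of _ "[]"]) (simp add: word_for_def inv_count_def)
  next
    case False
    then obtain i where i: "i < n" "left_descent w i" using ex_left_descent less.prems by blast
    let ?w = "simple_refl i \<circ> w"
    have "?w \<in> hyperoctahedral n"
      by (rule comp_hyperoctahedral[OF simple_refl_hyperoctahedral[OF i(1)] less.prems])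
    moreover have S: "inv_count n w = Suc (inv_count n ?w)" by (rule inv_count_Suc[OF less.prems i])
    ultimately obtain ws where "word_for n ws ?w" "length ws = inv_count n ?w"
      using less.hyps[of ?w] by auto
    then have "word_for n (i # ws) w \<and> length (i # ws) = inv_count n w"
      using i S by (auto simp: word_for_def)
    then show ?thesis by blast
  qed
qed

section \<open>Reduced words and the right weak order in terms of inversions\<close>

lemma word_for_hyperoctahedral: "word_for n ws w \<Longrightarrow> w \<in> hyperoctahedral n"
  using word_prod_hyperoctahedral by (auto simp: word_for_def)

lemma reduced_word_for_iff:
  "reduced_word_for n ws w \<longleftrightarrow> word_for n ws w \<and> length ws = inv_count n w"
proof
  assume r: "reduced_word_for n ws w"
  then have w: "word_for n ws w" by (simp add: reduced_word_for_def)
  then obtain vs where "word_for n vs w" "length vs = inv_count n w"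
    using ex_word_inv_count[OF word_for_hyperoctahedral] by blast
  with r have "length ws \<le> inv_count n w" by (auto simp: reduced_word_for_def)
  moreover have "inv_count n w \<le> length ws"
    using inv_count_le_length[of ws n] w by (auto simp: word_for_def)
  ultimately show "word_for n ws w \<and> length ws = inv_count n w" using w by simp
next
  assume "word_for n ws w \<and> length ws = inv_count n w"
  then show "reduced_word_for n ws w"
    using inv_count_le_length[of _ n] by (metis reduced_word_for_def word_for_def)
qed

lemma ex_reduced_word: "w \<in> hyperoctahedral n \<Longrightarrow> \<exists>ws. reduced_word_for n ws w"
  using ex_word_inv_count by (simp add: reduced_word_for_iff)

lemma reduced_word_for_hyperoctahedral: "reduced_word_for n ws w \<Longrightarrow> w \<in> hyperoctahedral n"
  by (auto simp: reduced_word_for_iff intro: word_for_hyperoctahedral)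

lemma reduced_word_for_id [simp]: "reduced_word_for n ws id \<longleftrightarrow> ws = []"
  by (auto simp: reduced_word_for_iff inv_count_def word_for_def)

lemma reduced_word_for_Nil: "reduced_word_for n [] w \<longleftrightarrow> w = id"
  by (auto simp: reduced_word_for_iff inv_count_def word_for_def)

lemma reduced_word_for_Cons:
  "reduced_word_for n (i # ws) w \<longleftrightarrow>
    w \<in> hyperoctahedral n \<and> i < n \<and> left_descent w i \<and> reduced_word_for n ws (simple_refl i \<circ> w)"
proof
  assume r: "reduced_word_for n (i # ws) w"
  then have wf: "word_for n (i # ws) w" and len: "Suc (length ws) = inv_count n w"
    unfolding reduced_word_for_iff by simp_all
  have i: "i < n" using wf by (simp add: word_for_def)
  have "word_prod ws = simple_refl i \<circ> w"
    using wf unfolding word_for_def by (metis simple_refl_comp_cancel word_prod_simps(2))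
  then have ws: "word_for n ws (simple_refl i \<circ> w)"
    using wf by (simp add: word_for_def)
  have w: "w \<in> hyperoctahedral n" by (rule reduced_word_for_hyperoctahedral[OF r])
  have "inv_count n (simple_refl i \<circ> w) \<le> length ws"
    using ws inv_count_le_length[of ws n] by (auto simp: word_for_def)
  then have d: "left_descent w i" using inv_count_simple_refl_comp(2)[OF w i] len by simp
  then show "w \<in> hyperoctahedral n \<and> i < n \<and> left_descent w i \<and> reduced_word_for n ws (simple_refl i \<circ> w)"
    using w i ws len inv_count_Suc[OF w i d] by (simp add: reduced_word_for_iff)
next
  assume a: "w \<in> hyperoctahedral n \<and> i < n \<and> left_descent w i \<and> reduced_word_for n ws (simple_refl i \<circ> w)"
  then have "set ws \<subseteq> {..<n}" "word_prod ws = simple_refl i \<circ> w" "length ws = inv_count n (simple_refl i \<circ> w)"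
    unfolding reduced_word_for_iff word_for_def by blast+
  moreover from this(2) have "simple_refl i \<circ> word_prod ws = w" by (metis simple_refl_comp_cancel)
  ultimately show "reduced_word_for n (i # ws) w"
    using a inv_count_Suc[of w n i] unfolding reduced_word_for_iff word_for_def by simp
qed

lemma map_pairs_mono: "A \<subseteq> B \<Longrightarrow> map_pairs i A \<subseteq> map_pairs i B"
  by (auto simp: map_pairs_def)

text \<open>Both directions peel off first letters. A common prefix relabels both inversion sets in
  the same way; conversely, inclusion makes a left descent of \<open>u\<close> one of
  \<open>v\<close>, so it can begin reduced words of both.\<close>

lemma right_weak_le_iff:
  assumes "u \<in> hyperoctahedral n" "v \<in> hyperoctahedral n"
  shows "right_weak_le n u v \<longleftrightarrow> inversions n u \<subseteq> inversions n v"
proof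
  have *: "inversions n u \<subseteq> inversions n v"
    if "reduced_word_for n us u" "reduced_word_for n (us @ ts) v" for us ts u v
    using that
  proof (induction us arbitrary: u v)
    case Nil
    then show ?case by (simp add: reduced_word_for_Nil)
  next
    case (Cons i us)
    then have "inversions n (simple_refl i \<circ> u) \<subseteq> inversions n (simple_refl i \<circ> v)"
      by (auto simp: reduced_word_for_Cons)
    from map_pairs_mono[OF this, of i] show ?case
      using Cons.prems inversions_simple_refl_comp(2)[of u n i] inversions_simple_refl_comp(2)[of v n i]
      by (auto simp: reduced_word_for_Cons)
  qed
  assume "right_weak_le n u v"
  then obtain us vs where "reduced_word_for n us u" "reduced_word_for n vs v" "prefix us vs"
    by (auto simp: right_weak_le_def)
  then show "inversions n u \<subseteq> inversions n v" using * by (metis prefix_def)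
next
  assume "inversions n u \<subseteq> inversions n v"
  with assms show "right_weak_le n u v"
  proof (induction "inv_count n u" arbitrary: u v rule: less_induct)
    case less
    show ?case
    proof (cases "u = id")
      case True
      then show ?thesis using ex_reduced_word[OF less.prems(2)] by (auto simp: right_weak_le_def)
    next
      case False
      then obtain i where i: "i < n" "left_descent u i" using ex_left_descent less.prems by blast
      then have dv: "left_descent v i" using less.prems(3) by (auto simp: left_descent_iff)
      let ?u = "simple_refl i \<circ> u" and ?v = "simple_refl i \<circ> v"
      have "?u \<in> hyperoctahedral n" "?v \<in> hyperoctahedral n"
        using less.prems i by (auto intro: comp_hyperoctahedral simple_refl_hyperoctahedral)
      moreover have "inversions n ?u \<subseteq> inversions n ?v"
        using less.prems i dv by (simp add: inversions_simple_refl_comp(1)) (intro map_pairs_mono, blast)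
      moreover have "inv_count n ?u < inv_count n u"
        using inv_count_Suc[OF less.prems(1) i] by simp
      ultimately have "right_weak_le n ?u ?v" using less.hyps by blast
      then obtain us vs where "reduced_word_for n us ?u" "reduced_word_for n vs ?v" "prefix us vs"
        by (auto simp: right_weak_le_def)
      then have "reduced_word_for n (i # us) u" "reduced_word_for n (i # vs) v" "prefix (i # us) (i # vs)"
        using less.prems i dv by (auto simp: reduced_word_for_Cons)
      then show ?thesis unfolding right_weak_le_def by blast
    qed
  qed
qed

lemma inversions_inject:
  assumes "u \<in> hyperoctahedral n" "v \<in> hyperoctahedral n" "inversions n u = inversions n v"
  shows "u = v"
proof -
  have "right_weak_le n u v" using assms by (simp add: right_weak_le_iff)
  then obtain us vs where r: "reduced_word_for n us u" "reduced_word_for n vs v" "prefix us vs"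
    by (auto simp: right_weak_le_def)
  then have "length us = length vs" using assms(3) by (simp add: reduced_word_for_iff inv_count_def)
  with r(3) have "us = vs" by (auto simp: prefix_def)
  with r show ?thesis by (auto simp: reduced_word_for_iff word_for_def)
qed

section \<open>Sortable elements\<close>

text \<open>The edge between \<open>m - 1\<close> and \<open>m\<close> of the Coxeter graph determines on which side of the value \<open>m\<close>
  an inversion passing over \<open>m\<close> must have a companion. The value \<open>colour cw n\<close>, which belongs to no
  edge, is chosen so that rotating the word acts on colours by its first letter.\<close>

definition colour :: "nat list \<Rightarrow> int \<Rightarrow> bool" where
  "colour cw m = (if m > 0 then \<not> appears_left_of cw (nat m) (nat m - 1)
     else appears_left_of cw (nat (- m)) (nat (- m) - 1))"

text \<open>A one-line form of Reading's alignment condition, to be applied to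
  \<open>v = inv w\<close>. For functions \<open>v\<close>, left multiplication of \<open>w\<close>
  by a simple reflection becomes precomposition.\<close>

definition aligned :: "nat \<Rightarrow> (int \<Rightarrow> bool) \<Rightarrow> (int \<Rightarrow> int) \<Rightarrow> bool" where
  "aligned n Y v \<longleftrightarrow> (\<forall>a \<in> signed_range n. \<forall>m \<in> signed_range n. \<forall>b \<in> signed_range n.
     a < m \<longrightarrow> m < b \<longrightarrow> v b < v a \<longrightarrow> (if Y m then v m < v a else v b < v m))"

lemma alignedD:
  assumes "aligned n Y v" "a \<in> signed_range n" "m \<in> signed_range n" "b \<in> signed_range n"
    "a < m" "m < b" "v b < v a"
  shows "if Y m then v m < v a else v b < v m"
  using assms unfolding aligned_def by blast

lemma appears_left_of_Cons:
  "appears_left_of (x # xs) a b \<longleftrightarrow> a = x \<and> b \<in> set xs \<or> appears_left_of xs a b"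
proof
  assume "appears_left_of (x # xs) a b"
  then obtain j k where jk: "j < k" "k < length (x # xs)" "(x # xs) ! j = a" "(x # xs) ! k = b"
    unfolding appears_left_of_def by blast
  then obtain k' where k': "k = Suc k'" by (cases k) auto
  show "a = x \<and> b \<in> set xs \<or> appears_left_of xs a b"
  proof (cases j)
    case 0
    then show ?thesis using jk k' by auto
  next
    case (Suc j')
    then have "appears_left_of xs a b"
      unfolding appears_left_of_def using jk k' by (intro exI[of _ j'] exI[of _ k']) auto
    then show ?thesis ..
  qed
next
  assume "a = x \<and> b \<in> set xs \<or> appears_left_of xs a b"
  then show "appears_left_of (x # xs) a b"
  proof
    assume "a = x \<and> b \<in> set xs"
    then obtain k where "k < length xs" "xs ! k = b" "a = x" by (auto simp: in_set_conv_nth)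
    then show ?thesis unfolding appears_left_of_def by (intro exI[of _ 0] exI[of _ "Suc k"]) auto
  next
    assume "appears_left_of xs a b"
    then obtain j k where "j < k" "k < length xs" "xs ! j = a" "xs ! k = b"
      unfolding appears_left_of_def by blast
    then show ?thesis unfolding appears_left_of_def by (intro exI[of _ "Suc j"] exI[of _ "Suc k"]) auto
  qed
qed

lemma appears_left_of_snoc:
  "appears_left_of (xs @ [x]) a b \<longleftrightarrow> b = x \<and> a \<in> set xs \<or> appears_left_of xs a b"
proof -
  have "\<not> appears_left_of [] a b" by (simp add: appears_left_of_def)
  then show ?thesis
    by (induction xs) (auto simp: appears_left_of_Cons)
qed

lemma appears_left_of_set: "appears_left_of xs a b \<Longrightarrow> a \<in> set xs \<and> b \<in> set xs"
  by (auto simp: appears_left_of_def)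

lemma colour_minus: "m \<noteq> 0 \<Longrightarrow> colour cw (- m) \<longleftrightarrow> \<not> colour cw m"
  by (auto simp: colour_def)

text \<open>The pair jumps over the gap just below \<open>high i\<close>. The mirror gap is covered
  by the symmetry of inversion sets.\<close>

definition crosses :: "nat \<Rightarrow> int \<Rightarrow> int \<Rightarrow> bool" where
  "crosses i a b \<longleftrightarrow> a < high i \<and> high i \<le> b"

context
  fixes n :: nat and i :: nat and r :: "nat list"
  assumes cw: "distinct (i # r)" "set (i # r) = {..<n}"
begin

lemma head_less: "i < n"
  using cw(2) by auto

lemma colour_high_head: "colour (i # r) (high i)"
proof -
  have "\<not> appears_left_of (i # r) (Suc i) i"
    using cw appears_left_of_set[of r "Suc i" i] by (auto simp: appears_left_of_Cons)
  then show ?thesis by (simp add: colour_def high_def nat_add_distrib)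
qed

lemma colour_low_head:
  assumes n: "i \<noteq> 0 \<or> 1 < n"
  shows "\<not> colour (i # r) (low i)"
proof (cases "i = 0")
  case True
  have "\<not> appears_left_of (i # r) (Suc i) i"
    using cw appears_left_of_set[of r "Suc i" i] by (auto simp: appears_left_of_Cons)
  then show ?thesis using True by (simp add: colour_def low_def)
next
  case False
  moreover have "i - 1 \<in> set (i # r)" using head_less cw(2) by auto
  ultimately have "i - 1 \<in> set r" by auto
  then show ?thesis using False by (simp add: colour_def low_def appears_left_of_Cons)
qed

text \<open>Moving \<open>i\<close> from the front to the end reverses exactly the edges at
  \<open>i\<close>. The identity fails at \<open>m = n\<close> for \<open>i = n - 1\<close>, but a
  value strictly between two others has absolute value below \<open>n\<close>.\<close>

lemma colour_rotate:
  assumes m: "m \<noteq> 0" "\<bar>m\<bar> < int n"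
  shows "colour (r @ [i]) m \<longleftrightarrow> colour (i # r) (simple_refl i m)"
proof -
  have pos: "colour (r @ [i]) m \<longleftrightarrow> colour (i # r) (simple_refl i m)" if m: "0 < m" "m < int n" for m
  proof -
    have in_r: "x \<in> set r \<longleftrightarrow> x < n \<and> x \<noteq> i" for x using cw by (metis distinct.simps(2) insert_iff lessThan_iff list.simps(15))
    have nl: "\<not> appears_left_of r i x" "\<not> appears_left_of r x i" for x
      using cw(1) appears_left_of_set[of r] by auto
    obtain k where k: "m = int (Suc k)" using m(1) by (metis zero_less_imp_eq_int Suc_pred')
    have kn: "Suc k < n" using m(2) k by simp
    consider "i = 0" "k = 0" | "i \<noteq> 0" "Suc k = i" | "i \<noteq> 0" "k = i" | "Suc k \<noteq> i" "k \<noteq> i" by blast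
    then show ?thesis
    proof cases
      case 1
      then have "simple_refl i m = -1" using k by (simp add: simple_refl_apply low_def high_def)
      then show ?thesis using 1 kn k in_r nl by (simp add: colour_def appears_left_of_snoc appears_left_of_Cons)
    next
      case 2
      then have "simple_refl i m = int (Suc i)" using k by (simp add: simple_refl_apply low_def high_def)
      moreover have "colour (i # r) (int (Suc i))" using colour_high_head by (simp add: high_def add.commute)
      moreover have "colour (r @ [i]) m"
        using 2 nl k appears_left_of_set[of "r" i k] by (auto simp: colour_def appears_left_of_snoc)
      ultimately show ?thesis by simp
    next
      case 3
      then have "simple_refl i m = low i" using k by (simp add: simple_refl_apply low_def high_def)
      moreover have "\<not> colour (i # r) (low i)" using colour_low_head 3 by simp
      moreover have "\<not> colour (r @ [i]) m"
        using 3 k kn in_r by (auto simp: colour_def appears_left_of_snoc nat_add_distrib)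
      ultimately show ?thesis by simp
    next
      case 4
      then have "simple_refl i m = m" using k by (auto simp: simple_refl_apply low_def high_def)
      then show ?thesis using 4 k by (auto simp: colour_def appears_left_of_snoc appears_left_of_Cons nat_add_distrib)
    qed
  qed
  show ?thesis
  proof (cases "0 < m")
    case True
    then show ?thesis using pos m by simp
  next
    case False
    then have "colour (r @ [i]) (- m) \<longleftrightarrow> colour (i # r) (- simple_refl i m)"
      using pos[of "- m"] m by simp
    moreover have "simple_refl i m \<noteq> 0"
      using simple_refl_in_range[OF head_less, of m] m by (auto simp: signed_range_def)
    ultimately show ?thesis using colour_minus m(1) by blast
  qed
qed

text \<open>The reflection reverses only its own pairs, whose lower end is uncoloured and whose
  upper end is coloured. Being an inversion already, such a pair supplies the companion that a
  triple containing it demands, directly or by transitivity.\<close>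

lemma flipped_colours:
  fixes v :: "int \<Rightarrow> int"
  assumes v: "v (low i) > v (high i)" "\<And>x. v (- x) = - v x"
    and ab: "a \<in> signed_range n" "b \<in> signed_range n" "a < b" "\<not> simple_refl i a < simple_refl i b"
    and n: "1 < n"
  shows "\<not> colour (i # r) a \<and> colour (i # r) b \<and> v b < v a"
proof -
  have nz: "a \<noteq> 0" "b \<noteq> 0" using ab by (auto simp: signed_range_def)
  then have "(a, b) \<in> simple_pairs i" using simple_refl_less_iff[OF nz ab(3)] ab(4) by blast
  then consider "a = low i" "b = high i" | "a = - high i" "b = - low i"
    by (auto simp: simple_pairs_def)
  then show ?thesis
  proof cases
    case 1
    then show ?thesis using colour_high_head colour_low_head v n by simp
  next
    case 2
    then show ?thesis using colour_high_head colour_low_head v n nz by (simp add: colour_minus)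
  qed
qed

lemma aligned_descent:
  assumes v: "v (low i) > v (high i)" "\<And>x. v (- x) = - v x" and n: "1 < n"
  shows "aligned n (colour (i # r)) v \<longleftrightarrow> aligned n (colour (r @ [i])) (v \<circ> simple_refl i)"
proof -
  let ?Y = "colour (i # r)" and ?Y' = "colour (r @ [i])" and ?s = "simple_refl i"
  let ?S = "signed_range n"
  note flip = flipped_colours[OF v _ _ _ _ n]
  have sS: "?s x \<in> ?S" if "x \<in> ?S" for x using that simple_refl_in_range head_less by blast
  have inj: "?s x = ?s y \<Longrightarrow> x = y" for x y by (metis simple_refl_invol)
  have Y': "?Y' m \<longleftrightarrow> ?Y (?s m)" if "a \<in> ?S" "m \<in> ?S" "b \<in> ?S" "a < m" "m < b" for a m b
    using that by (intro colour_rotate) (auto simp: signed_range_def)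
  show ?thesis
  proof
    assume A: "aligned n ?Y v"
    show "aligned n ?Y' (v \<circ> ?s)"
      unfolding aligned_def
    proof (intro ballI impI)
      fix a m b assume S: "a \<in> ?S" "m \<in> ?S" "b \<in> ?S" and o: "a < m" "m < b"
        and inv: "(v \<circ> ?s) b < (v \<circ> ?s) a"
      have "if ?Y (?s m) then v (?s m) < v (?s a) else v (?s b) < v (?s m)"
      proof -
        consider "?s a < ?s m" "?s m < ?s b" | "?s m < ?s a" | "?s b < ?s m"
          using inj[of a m] inj[of m b] o by fastforce
        then show ?thesis
        proof cases
          case 1
          then show ?thesis using alignedD[OF A sS[OF S(1)] sS[OF S(2)] sS[OF S(3)]] inv by simp
        next
          case 2
          then show ?thesis using flip[OF sS[OF S(2)] sS[OF S(1)] 2] o inv by auto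
        next
          case 3
          then show ?thesis using flip[OF sS[OF S(3)] sS[OF S(2)] 3] o inv by auto
        qed
      qed
      then show "if ?Y' m then (v \<circ> ?s) m < (v \<circ> ?s) a else (v \<circ> ?s) b < (v \<circ> ?s) m"
        using Y'[OF S o] by simp
    qed
  next
    assume A: "aligned n ?Y' (v \<circ> ?s)"
    show "aligned n ?Y v"
      unfolding aligned_def
    proof (intro ballI impI)
      fix a m b assume S: "a \<in> ?S" "m \<in> ?S" "b \<in> ?S" and o: "a < m" "m < b" and inv: "v b < v a"
      consider "?s a < ?s m" "?s m < ?s b" | "\<not> ?s a < ?s m" | "\<not> ?s m < ?s b" by blast
      then show "if ?Y m then v m < v a else v b < v m"
      proof cases
        case 1
        then show ?thesis
          using alignedD[OF A sS[OF S(1)] sS[OF S(2)] sS[OF S(3)] 1] inv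
            Y'[OF sS[OF S(1)] sS[OF S(2)] sS[OF S(3)] 1] by (auto split: if_splits)
      next
        case 2
        then show ?thesis using flip[OF S(1,2) o(1)] by simp
      next
        case 3
        then show ?thesis using flip[OF S(2,3) o(2)] by simp
      qed
    qed
  qed
qed

text \<open>Passing over the coloured \<open>high i\<close>, a crossing inversion would yield
  \<open>(a, high i)\<close>, and this, passing over the uncoloured \<open>low i\<close>, would
  yield \<open>(low i, high i)\<close>, contrary to the assumption on \<open>v\<close>.\<close>

lemma aligned_not_crossing:
  assumes A: "aligned n (colour (i # r)) v" and v: "v (low i) < v (high i)" and n: "1 < n"
    and ab: "a \<in> signed_range n" "b \<in> signed_range n" "v b < v a"
  shows "\<not> crosses i a b"
proof
  assume c: "crosses i a b"
  note h = high_in_range[OF head_less] and l = low_in_range[OF head_less]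
  have "v (high i) < v a"
  proof (cases "b = high i")
    case True
    then show ?thesis using ab by simp
  next
    case False
    then show ?thesis
      using alignedD[OF A ab(1) h ab(2)] ab c colour_high_head by (auto simp: crosses_def)
  qed
  moreover have "a \<le> low i" using c ab(1) by (auto simp: crosses_def low_def high_def signed_range_def)
  ultimately show False
    using alignedD[OF A ab(1) l h] low_less_high[of i] colour_low_head n v by (cases "a = low i") auto
qed

text \<open>If no inversion crosses the gap, none crosses its mirror image. The middle value of a
  relevant triple is then fixed by the reflection, so the rotation leaves its colour
  unchanged.\<close>

lemma aligned_rotate_not_crossing:
  assumes nc: "\<And>a b. a \<in> signed_range n \<Longrightarrow> b \<in> signed_range n \<Longrightarrow> v b < v a \<Longrightarrow> \<not> crosses i a b"
    and v: "\<And>x. v (- x) = - v x"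
  shows "aligned n (colour (i # r)) v \<longleftrightarrow> aligned n (colour (r @ [i])) v"
proof -
  have Y': "colour (r @ [i]) m \<longleftrightarrow> colour (i # r) m"
    if S: "a \<in> signed_range n" "m \<in> signed_range n" "b \<in> signed_range n" and o: "a < m" "m < b" and inv: "v b < v a" for a m b
  proof -
    have "\<not> crosses i a b" "\<not> crosses i (- b) (- a)"
      using nc[of a b] nc[of "- b" "- a"] S inv v by (auto simp: uminus_in_range)
    then have "simple_refl i m = m"
      using S o by (auto simp: crosses_def simple_refl_apply low_def high_def signed_range_def)
    then show ?thesis using colour_rotate[of m] S o by (auto simp: signed_range_def)
  qed
  then show ?thesis unfolding aligned_def by meson
qed

end

text \<open>Letters other than \<open>k\<close> move no nonzero value across the gap below
  \<open>high k\<close>, so they neither create nor destroy crossings; an occurrence of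
  \<open>k\<close> contributes its own pair, which crosses.\<close>

lemma reduced_word_letter_iff:
  assumes "reduced_word_for n ws w"
  shows "k \<notin> set ws \<longleftrightarrow> (\<forall>(a, b) \<in> inversions n w. \<not> crosses k a b)"
  using assms
proof (induction ws arbitrary: w)
  case Nil
  then show ?case by (simp add: reduced_word_for_Nil)
next
  case (Cons i ws)
  from Cons.prems have w: "w \<in> hyperoctahedral n" "i < n" "left_descent w i"
    and r: "reduced_word_for n ws (simple_refl i \<circ> w)"
    unfolding reduced_word_for_Cons by blast+
  let ?I = "inversions n (simple_refl i \<circ> w)"
  have I: "inversions n w = simple_pairs i \<union> map_pairs i ?I"
    by (rule inversions_simple_refl_comp(2)[OF w])
  show ?case
  proof (cases "i = k")
    case True
    then have "(low k, high k) \<in> inversions n w" unfolding I by (simp add: simple_pairs_def)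
    moreover have "crosses k (low k) (high k)" by (simp add: crosses_def low_less_high)
    ultimately show ?thesis using True by auto
  next
    case False
    have less: "simple_refl i x < high k \<longleftrightarrow> x < high k" if "x \<noteq> 0" for x
      using False that by (auto simp: simple_refl_apply low_def high_def)
    have c: "crosses k (simple_refl i a) (simple_refl i b) \<longleftrightarrow> crosses k a b" if "a \<noteq> 0" "b \<noteq> 0" for a b
      using less[of a] less[of b] that by (auto simp: crosses_def)
    have "\<forall>(a, b) \<in> simple_pairs i. \<not> crosses k a b"
      using False by (auto simp: simple_pairs_def crosses_def low_def high_def)
    then have "(\<forall>(a, b) \<in> inversions n w. \<not> crosses k a b) \<longleftrightarrow> (\<forall>(a, b) \<in> map_pairs i ?I. \<not> crosses k a b)"
      unfolding I by blast
    also have "\<dots> \<longleftrightarrow> (\<forall>(a, b) \<in> ?I. \<not> crosses k (simple_refl i a) (simple_refl i b))"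
      by (auto simp: map_pairs_def)
    also have "\<dots> \<longleftrightarrow> (\<forall>(a, b) \<in> ?I. \<not> crosses k a b)"
      using c by (fastforce simp: inversions_def signed_range_def)
    finally show ?thesis unfolding Cons.IH[OF r, symmetric] using False by auto
  qed
qed

section \<open>Sorting words under removal of the first letter\<close>

definition repeats_earlier :: "nat \<Rightarrow> nat list \<Rightarrow> bool" where
  "repeats_earlier n ps \<longleftrightarrow> (\<forall>k. k + n \<in> set ps \<longrightarrow> k \<in> set ps)"

text \<open>Within one copy a letter is the same thing as its position modulo \<open>n\<close>. The
  reformulation by positions is the one that can be followed when the infinite word is
  shifted.\<close>

lemma block_letters_decreasing_iff:
  assumes cw: "distinct cw" "length cw = n" and n: "0 < n"
  shows "(\<forall>i. block_letters cw ps (Suc i) \<subseteq> block_letters cw ps i) \<longleftrightarrow> repeats_earlier n ps"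
proof
  assume dec: "\<forall>i. block_letters cw ps (Suc i) \<subseteq> block_letters cw ps i"
  show "repeats_earlier n ps"
    unfolding repeats_earlier_def
  proof (intro allI impI)
    fix k assume k: "k + n \<in> set ps"
    have "(k + n) div n = Suc (k div n)" using n by simp
    then have "word_power_inf cw (k + n) \<in> block_letters cw ps (Suc (k div n))"
      using k cw unfolding block_letters_def by auto
    then have "word_power_inf cw (k + n) \<in> block_letters cw ps (k div n)" using dec by blast
    then obtain k' where k': "k' \<in> set ps" "k' div n = k div n" "word_power_inf cw (k + n) = word_power_inf cw k'"
      using cw unfolding block_letters_def by auto
    then have "cw ! (k mod n) = cw ! (k' mod n)" using cw by (simp add: word_power_inf_def)
    then have "k mod n = k' mod n" using cw n by (simp add: nth_eq_iff_index_eq)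
    with k'(2) have "k' = k" by (metis div_mult_mod_eq)
    with k'(1) show "k \<in> set ps" by simp
  qed
next
  assume rep: "repeats_earlier n ps"
  show "\<forall>i. block_letters cw ps (Suc i) \<subseteq> block_letters cw ps i"
  proof (intro allI subsetI)
    fix i x assume "x \<in> block_letters cw ps (Suc i)"
    then obtain k where k: "k \<in> set ps" "k div n = Suc i" "x = word_power_inf cw k"
      using cw unfolding block_letters_def by auto
    then have "n \<le> k" using n by (metis div_less not_less zero_less_Suc less_irrefl)
    then obtain k' where k': "k = k' + n" by (metis le_add_diff_inverse2)
    with rep k(1) have "k' \<in> set ps" by (auto simp: repeats_earlier_def)
    moreover have "k' div n = i" using k(2) k' n by simp
    moreover have "x = word_power_inf cw k'" using k(3) k' cw by (simp add: word_power_inf_def)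
    ultimately show "x \<in> block_letters cw ps i" using cw unfolding block_letters_def by auto
  qed
qed

lemma word_power_inf_0: "word_power_inf (i # r) 0 = i"
  by (simp add: word_power_inf_def)

lemma word_power_inf_rotate: "word_power_inf (i # r) (Suc k) = word_power_inf (r @ [i]) k"
proof -
  have "rotate1 (i # r) ! (k mod length (i # r)) = (i # r) ! (Suc (k mod length (i # r)) mod length (i # r))"
    by (rule nth_rotate1) simp
  then show ?thesis by (simp add: word_power_inf_def mod_Suc_eq)
qed

lemma map_word_power_inf_Suc:
  "map (word_power_inf (i # r)) (map Suc ps) = map (word_power_inf (r @ [i])) ps"
  by (simp add: word_power_inf_rotate)

lemma sorted_wrt_less_cases:
  assumes "sorted_wrt (<) (qs :: nat list)"
  obtains qs' where "sorted_wrt (<) qs'" "qs = map Suc qs'" | qs' where "sorted_wrt (<) qs'" "qs = 0 # map Suc qs'"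
proof -
  have pred: "\<exists>qs'. sorted_wrt (<) qs' \<and> qs = map Suc qs'" if "sorted_wrt (<) qs" "0 \<notin> set qs" for qs :: "nat list"
  proof (intro exI conjI)
    show eq: "qs = map Suc (map (\<lambda>k. k - 1) qs)"
    proof -
      have "map (\<lambda>k. Suc (k - 1)) qs = qs"
      proof (rule map_idI)
        fix x assume "x \<in> set qs"
        then have "x \<noteq> 0" using that(2) by metis
        then show "Suc (x - 1) = x" by simp
      qed
      then show ?thesis by (simp add: comp_def)
    qed
    have "sorted_wrt (<) (map Suc (map (\<lambda>k. k - 1) qs))" using that(1) eq by simp
    then show "sorted_wrt (<) (map (\<lambda>k. k - 1) qs)" by (simp add: sorted_wrt_map)
  qed
  show thesis
  proof (cases "0 \<in> set qs")
    case False
    then show thesis using pred[OF assms] that(1) by blast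
  next
    case True
    then obtain x xs where qs: "qs = x # xs" by (cases qs) auto
    then have "\<forall>y \<in> set xs. x < y" "sorted_wrt (<) xs" using assms by auto
    moreover from this(1) True qs have "x = 0" by auto
    ultimately have "0 \<notin> set xs" by auto
    then show thesis using pred[OF \<open>sorted_wrt (<) xs\<close>] that(2) qs \<open>x = 0\<close> by blast
  qed
qed

lemma lexord_map_Suc:
  "(xs, ys) \<in> lexord less_than \<Longrightarrow> (map Suc xs, map Suc ys) \<in> lexord less_than"
proof (induction xs arbitrary: ys)
  case Nil
  then show ?case by (cases ys) auto
next
  case (Cons x xs)
  then show ?case by (cases ys) auto
qed

lemma sorted_wrt_map_Suc: "sorted_wrt (<) (map Suc ps) \<longleftrightarrow> sorted_wrt (<) ps"
  by (simp add: sorted_wrt_map)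

lemma reduced_positions_map_Suc:
  "map Suc ps \<in> reduced_positions n (i # r) w \<longleftrightarrow> ps \<in> reduced_positions n (r @ [i]) w"
  unfolding reduced_positions_def mem_Collect_eq map_word_power_inf_Suc sorted_wrt_map_Suc ..

lemma reduced_positions_0_map_Suc:
  "0 # map Suc ps \<in> reduced_positions n (i # r) w \<longleftrightarrow>
    w \<in> hyperoctahedral n \<and> i < n \<and> left_descent w i \<and>
    ps \<in> reduced_positions n (r @ [i]) (simple_refl i \<circ> w)"
proof -
  have "sorted_wrt (<) (0 # map Suc ps) \<longleftrightarrow> sorted_wrt (<) ps"
    by (simp add: sorted_wrt_map)
  then show ?thesis
    unfolding reduced_positions_def mem_Collect_eq list.map(2) map_word_power_inf_Suc word_power_inf_0
      reduced_word_for_Cons by blast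
qed

text \<open>A nonempty list that starts at 0 precedes every nonempty one that does not, so the
  sorting word takes the first letter whenever it is a left descent.\<close>

lemma sorting_positions_descent:
  assumes ps: "sorting_positions n (r @ [i]) (simple_refl i \<circ> w) ps"
    and w: "w \<in> hyperoctahedral n" "i < n" "left_descent w i"
  shows "sorting_positions n (i # r) w (0 # map Suc ps)"
  unfolding sorting_positions_def
proof (intro conjI ballI impI)
  show "0 # map Suc ps \<in> reduced_positions n (i # r) w"
    using assms unfolding reduced_positions_0_map_Suc sorting_positions_def by blast
  fix qs assume qs: "qs \<in> reduced_positions n (i # r) w" "qs \<noteq> 0 # map Suc ps"
  then have "sorted_wrt (<) qs" by (simp add: reduced_positions_def)
  then show "(0 # map Suc ps, qs) \<in> lexord less_than"
  proof (cases rule: sorted_wrt_less_cases)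
    case (1 qs')
    \<comment> \<open>The empty list would precede everything; it is excluded because an element
      with a descent is not the identity.\<close>
    have "qs' \<noteq> []"
    proof
      assume "qs' = []"
      then have "w = id" using qs(1) 1 by (simp add: reduced_positions_def reduced_word_for_Nil)
      then show False using w(3) low_less_high[of i] by (simp add: left_descent_def)
    qed
    then show ?thesis using 1 by (cases qs') auto
  next
    case (2 qs')
    then have "qs' \<in> reduced_positions n (r @ [i]) (simple_refl i \<circ> w)" "qs' \<noteq> ps"
      using qs reduced_positions_0_map_Suc by blast+
    then have "(ps, qs') \<in> lexord less_than" using ps unfolding sorting_positions_def by blast
    then show ?thesis using 2 lexord_map_Suc by simp
  qed
qed

lemma sorting_positions_not_descent:
  assumes ps: "sorting_positions n (r @ [i]) w ps" and nd: "\<not> left_descent w i"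
  shows "sorting_positions n (i # r) w (map Suc ps)"
  unfolding sorting_positions_def
proof (intro conjI ballI impI)
  show "map Suc ps \<in> reduced_positions n (i # r) w"
    using ps unfolding reduced_positions_map_Suc sorting_positions_def by blast
  fix qs assume qs: "qs \<in> reduced_positions n (i # r) w" "qs \<noteq> map Suc ps"
  then have "sorted_wrt (<) qs" by (simp add: reduced_positions_def)
  then show "(map Suc ps, qs) \<in> lexord less_than"
  proof (cases rule: sorted_wrt_less_cases)
    case (1 qs')
    then have "qs' \<in> reduced_positions n (r @ [i]) w" "qs' \<noteq> ps"
      using qs reduced_positions_map_Suc by blast+
    then have "(ps, qs') \<in> lexord less_than" using ps unfolding sorting_positions_def by blast
    then show ?thesis using 1 lexord_map_Suc by simp
  next
    case (2 qs')
    then show ?thesis using qs(1) reduced_positions_0_map_Suc nd by blast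
  qed
qed

lemma sorting_positions_unique:
  assumes "sorting_positions n cw w ps" "sorting_positions n cw w qs"
  shows "ps = qs"
proof (rule ccontr)
  assume "ps \<noteq> qs"
  then have "(ps, qs) \<in> lexord less_than" "(qs, ps) \<in> lexord less_than"
    using assms unfolding sorting_positions_def by metis+
  then show False using lexord_asymmetric[OF asym_less_than] by metis
qed

lemma repeats_earlier_0_map_Suc:
  assumes "0 < n" shows "repeats_earlier n (0 # map Suc ps) \<longleftrightarrow> repeats_earlier n ps"
proof
  assume r: "repeats_earlier n (0 # map Suc ps)"
  show "repeats_earlier n ps"
    unfolding repeats_earlier_def
  proof (intro allI impI)
    fix k assume "k + n \<in> set ps"
    then have "Suc k + n \<in> set (0 # map Suc ps)" by simp
    then have "Suc k \<in> set (0 # map Suc ps)" using r unfolding repeats_earlier_def by blast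
    then show "k \<in> set ps" by auto
  qed
next
  assume r: "repeats_earlier n ps"
  show "repeats_earlier n (0 # map Suc ps)"
    unfolding repeats_earlier_def
  proof (intro allI impI)
    fix k assume k: "k + n \<in> set (0 # map Suc ps)"
    show "k \<in> set (0 # map Suc ps)"
    proof (cases k)
      case (Suc k')
      then have "k' + n \<in> set ps" using k by auto
      then show ?thesis using r Suc unfolding repeats_earlier_def by auto
    qed simp
  qed
qed

text \<open>The shift sends position \<open>n - 1\<close> to \<open>n\<close>, which asks for
  position 0, and a shifted list never contains 0.\<close>

lemma repeats_earlier_map_Suc:
  assumes "0 < n"
  shows "repeats_earlier n (map Suc ps) \<longleftrightarrow> n - 1 \<notin> set ps \<and> repeats_earlier n ps"
proof
  assume r: "repeats_earlier n (map Suc ps)"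
  have "n - 1 \<notin> set ps"
  proof
    assume "n - 1 \<in> set ps"
    then have "Suc (n - 1) \<in> set (map Suc ps)" by simp
    then have "0 + n \<in> set (map Suc ps)" using assms by simp
    then have "0 \<in> set (map Suc ps)" using r unfolding repeats_earlier_def by blast
    then show False by auto
  qed
  moreover have "repeats_earlier n ps"
    unfolding repeats_earlier_def
  proof (intro allI impI)
    fix k assume "k + n \<in> set ps"
    then have "Suc k + n \<in> set (map Suc ps)" by simp
    then have "Suc k \<in> set (map Suc ps)" using r unfolding repeats_earlier_def by blast
    then show "k \<in> set ps" by auto
  qed
  ultimately show "n - 1 \<notin> set ps \<and> repeats_earlier n ps" ..
next
  assume r: "n - 1 \<notin> set ps \<and> repeats_earlier n ps"
  show "repeats_earlier n (map Suc ps)"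
    unfolding repeats_earlier_def
  proof (intro allI impI)
    fix k assume k: "k + n \<in> set (map Suc ps)"
    show "k \<in> set (map Suc ps)"
    proof (cases k)
      case 0
      then have "n - 1 \<in> set ps" using k by auto
      then show ?thesis using r by blast
    next
      case (Suc k')
      then have "k' + n \<in> set ps" using k by auto
      then show ?thesis using r Suc unfolding repeats_earlier_def by auto
    qed
  qed
qed

text \<open>Every use of the last letter sits at \<open>n - 1\<close> modulo \<open>n\<close> and
  can be pulled back period by period to \<open>n - 1\<close> itself.\<close>

lemma last_letter_unused:
  assumes r: "repeats_earlier n ps" "n - 1 \<notin> set ps" and cw: "distinct (r @ [i])" "length (r @ [i]) = n"
  shows "i \<notin> set (map (word_power_inf (r @ [i])) ps)"
proof
  assume "i \<in> set (map (word_power_inf (r @ [i])) ps)"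
  then obtain k where k: "k \<in> set ps" "(r @ [i]) ! (k mod n) = i" using cw by (auto simp: word_power_inf_def)
  have "(r @ [i]) ! (n - 1) = i" using cw by auto
  then have mod: "k mod n = n - 1"
    using k(2) cw by (metis nth_eq_iff_index_eq diff_less length_greater_0_conv less_numeral_extra(1) mod_less_divisor snoc_eq_iff_butlast)
  have "(n - 1) + j * n \<in> set ps \<longrightarrow> n - 1 \<in> set ps" for j
  proof (induction j)
    case (Suc j)
    then show ?case using r(1) unfolding repeats_earlier_def
      by (metis add.assoc add.commute mult_Suc)
  qed simp
  from this[of "k div n"] have "k \<in> set ps \<longrightarrow> n - 1 \<in> set ps"
    using mod by (metis add.commute div_mult_mod_eq)
  with k(1) r(2) show False by blast
qed

text \<open>Consumes the word one letter at a time; the second summand of the measure is the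
  distance to the next letter that is used.\<close>

lemma ex_sorting_positions:
  assumes "distinct cw" "set cw = {..<n}" "1 < n" "w \<in> hyperoctahedral n"
    and "d < n" "w = id \<or> left_descent w (cw ! d)"
  shows "\<exists>ps. sorting_positions n cw w ps \<and> (repeats_earlier n ps \<longleftrightarrow> aligned n (colour cw) (inv w))"
  using assms
proof (induction "inv_count n w * n + d" arbitrary: cw w d rule: less_induct)
  case less
  note dist = less.prems(1) and set = less.prems(2) and n = less.prems(3) and w = less.prems(4)
  have len: "length cw = n" using distinct_card[OF dist] set by simp
  show ?case
  proof (cases "w = id")
    case True
    have "reduced_positions n cw w = {[]}" unfolding True by (auto simp: reduced_positions_def)
    then have "sorting_positions n cw w []" by (simp add: sorting_positions_def)
    moreover have "repeats_earlier n []" by (simp add: repeats_earlier_def)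
    moreover have "aligned n (colour cw) (inv w)" unfolding True by (auto simp: aligned_def)
    ultimately show ?thesis by blast
  next
    case False
    obtain i r where cw: "cw = i # r" using len n by (cases cw) auto
    have cw': "distinct (i # r)" "set (i # r) = {..<n}" using dist set cw by auto
    have rot: "distinct (r @ [i])" "set (r @ [i]) = {..<n}" "length (r @ [i]) = n" using dist set cw len by auto
    have i: "i < n" using cw set by auto
    have v: "inv w (- x) = - inv w x" for x by (rule hyperoctahedral_minus[OF inv_hyperoctahedral[OF w]])
    show ?thesis
    proof (cases "left_descent w i")
      case True
      let ?w = "simple_refl i \<circ> w"
      have w': "?w \<in> hyperoctahedral n" by (rule comp_hyperoctahedral[OF simple_refl_hyperoctahedral[OF i] w])
      have count: "inv_count n w = Suc (inv_count n ?w)" by (rule inv_count_Suc[OF w i True])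
      obtain d' where d': "d' < n" "?w = id \<or> left_descent ?w ((r @ [i]) ! d')"
      proof (cases "?w = id")
        case True
        then show thesis using that[of 0] n by simp
      next
        case False
        then obtain j where j: "j < n" "left_descent ?w j" using ex_left_descent[OF w'] by blast
        then have "j \<in> set (r @ [i])" using rot by blast
        then obtain d' where "d' < n" "(r @ [i]) ! d' = j" using rot(3) by (metis in_set_conv_nth)
        then show thesis using that j by blast
      qed
      \<comment> \<open>Any new distance below \<open>n\<close> is affordable, as the drop of
        \<open>inv_count\<close> by one already lowers the measure by \<open>n\<close>.\<close>
      have "inv_count n ?w * n + d' < inv_count n w * n + d" using count d'(1) by simp
      from less.hyps[OF this rot(1,2) n w' d'] obtain ps where ps: "sorting_positions n (r @ [i]) ?w ps"
        "repeats_earlier n ps \<longleftrightarrow> aligned n (colour (r @ [i])) (inv ?w)" by blast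
      have "aligned n (colour (i # r)) (inv w) \<longleftrightarrow> aligned n (colour (r @ [i])) (inv w \<circ> simple_refl i)"
        by (rule aligned_descent[where v = "inv w", OF cw' _ v n]) (use True in \<open>simp add: left_descent_def\<close>)
      then have "repeats_earlier n (0 # map Suc ps) \<longleftrightarrow> aligned n (colour cw) (inv w)"
        unfolding cw using ps(2) repeats_earlier_0_map_Suc[of n ps] n inv_simple_refl_comp[OF w] by simp
      moreover have "sorting_positions n cw w (0 # map Suc ps)"
        unfolding cw by (rule sorting_positions_descent[OF ps(1) w i True])
      ultimately show ?thesis by blast
    next
      case nd: False
      then have "d \<noteq> 0" using less.prems(6) False cw by (cases d) auto
      then have d': "d - 1 < n" "w = id \<or> left_descent w ((r @ [i]) ! (d - 1))"
        using less.prems(5,6) False cw len by (auto simp: nth_append nth_Cons')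
      have "inv_count n w * n + (d - 1) < inv_count n w * n + d" using \<open>d \<noteq> 0\<close> by simp
      from less.hyps[OF this rot(1,2) n w d'] obtain ps where ps: "sorting_positions n (r @ [i]) w ps"
        "repeats_earlier n ps \<longleftrightarrow> aligned n (colour (r @ [i])) (inv w)" by blast
      have red: "reduced_word_for n (map (word_power_inf (r @ [i])) ps) w"
        using ps(1) by (simp add: sorting_positions_def reduced_positions_def)
      note letter = reduced_word_letter_iff[OF red, of i]
      have vlt: "inv w (low i) < inv w (high i)"
        using nd injD[OF bij_is_inj[OF bij_hyperoctahedral[OF inv_hyperoctahedral[OF w]]], of "low i" "high i"]
          low_less_high[of i] unfolding left_descent_def by linarith
      have rotate: "aligned n (colour (i # r)) (inv w) \<longleftrightarrow> aligned n (colour (r @ [i])) (inv w)"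
        if nc: "\<forall>(a, b) \<in> inversions n w. \<not> crosses i a b"
      proof (rule aligned_rotate_not_crossing[where v = "inv w", OF cw' _ v])
        fix a b assume "a \<in> signed_range n" "b \<in> signed_range n" "inv w b < inv w a"
        then have "a < b \<Longrightarrow> (a, b) \<in> inversions n w" by (simp add: inversions_def)
        moreover have "crosses i a b \<Longrightarrow> a < b" by (simp add: crosses_def)
        ultimately show "\<not> crosses i a b" using nc by blast
      qed
      \<comment> \<open>A skipped first letter must be absent from the whole sorting word. For
        positions this says \<open>n - 1 \<notin> set ps\<close>; for inversions it says that
        nothing crosses, which alignment enforces.\<close>
      have "repeats_earlier n (map Suc ps) \<longleftrightarrow> aligned n (colour (i # r)) (inv w)"
      proof
        assume "repeats_earlier n (map Suc ps)"
        then have g: "n - 1 \<notin> set ps" "repeats_earlier n ps" using repeats_earlier_map_Suc n by auto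
        then have "i \<notin> set (map (word_power_inf (r @ [i])) ps)" using last_letter_unused rot by blast
        then show "aligned n (colour (i # r)) (inv w)" using letter rotate ps(2) g(2) by blast
      next
        assume A: "aligned n (colour (i # r)) (inv w)"
        have nc: "\<forall>(a, b) \<in> inversions n w. \<not> crosses i a b"
          using aligned_not_crossing[OF cw' A vlt n] by (auto simp: inversions_def)
        then have "repeats_earlier n ps" using rotate A ps(2) by blast
        moreover have "n - 1 \<notin> set ps"
        proof
          assume "n - 1 \<in> set ps"
          moreover have "word_power_inf (r @ [i]) (n - 1) = i"
            using rot(3) n by (auto simp: word_power_inf_def)
          ultimately have "i \<in> set (map (word_power_inf (r @ [i])) ps)" by force
          then show False using letter nc by blast
        qed
        ultimately show "repeats_earlier n (map Suc ps)" using repeats_earlier_map_Suc n by auto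
      qed
      moreover have "sorting_positions n cw w (map Suc ps)"
        unfolding cw by (rule sorting_positions_not_descent[OF ps(1) nd])
      ultimately show ?thesis using cw by blast
    qed
  qed
qed

lemma sortable_iff_aligned:
  assumes n: "1 < n" and c: "c \<in> coxeter_elements n"
  shows "sortable n c w \<longleftrightarrow> w \<in> hyperoctahedral n \<and> aligned n (colour (coxeter_word n c)) (inv w)"
proof -
  let ?cw = "coxeter_word n c"
  have "coxeter_word_for n ?cw c"
    using c unfolding coxeter_word_def coxeter_elements_def by (auto intro: someI)
  then have cw: "distinct ?cw" "set ?cw = {..<n}" by (auto simp: coxeter_word_for_def)
  have len: "length ?cw = n" using distinct_card[OF cw(1)] cw(2) by simp
  have "\<exists>ps. sorting_positions n ?cw w ps \<and> (repeats_earlier n ps \<longleftrightarrow> aligned n (colour ?cw) (inv w))"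
    if w: "w \<in> hyperoctahedral n"
  proof -
    obtain d where "d < n" "w = id \<or> left_descent w (?cw ! d)"
    proof (cases "w = id")
      case True
      then show thesis using that[of 0] n by simp
    next
      case False
      then obtain j where j: "j < n" "left_descent w j" using ex_left_descent[OF w] by blast
      then have "j \<in> set ?cw" using cw by blast
      then obtain d where "d < n" "?cw ! d = j" using len by (metis in_set_conv_nth)
      then show thesis using that j by blast
    qed
    then show ?thesis using ex_sorting_positions[OF cw n w] by blast
  qed
  then show ?thesis
    unfolding sortable_def using block_letters_decreasing_iff[OF cw(1) len] n sorting_positions_unique
    by (metis less_trans zero_less_one)
qed

section \<open>Sortable sets of inversions and their cells\<close>

lemma card_signed_range: "card (signed_range n) = 2 * n"
proof -
  have "signed_range n = {1..int n} \<union> uminus ` {1..int n}"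
    by (force simp: signed_range_def image_iff)
  moreover have "card ({1..int n} \<union> uminus ` {1..int n}) = card {1..int n} + card (uminus ` {1..int n})"
    by (rule card_Un_disjoint) auto
  ultimately show ?thesis by (simp add: card_image)
qed

text \<open>Reversing exactly the pairs of a closed and coclosed set in the usual order gives
  another linear order; mirror symmetry makes it the order of a signed permutation.\<close>

lemma ex_inversions:
  assumes sub: "\<And>a b. (a, b) \<in> A \<Longrightarrow> a \<in> signed_range n \<and> b \<in> signed_range n \<and> a < b"
    and sym: "\<And>a b. (a, b) \<in> A \<Longrightarrow> (- b, - a) \<in> A"
    and trans: "\<And>a m b. (a, m) \<in> A \<Longrightarrow> (m, b) \<in> A \<Longrightarrow> (a, b) \<in> A"
    and cotrans: "\<And>a m b. (a, b) \<in> A \<Longrightarrow> m \<in> signed_range n \<Longrightarrow> a < m \<Longrightarrow> m < b \<Longrightarrow> (a, m) \<in> A \<or> (m, b) \<in> A"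
  obtains w where "w \<in> hyperoctahedral n" "inversions n w = A"
proof -
  let ?S = "signed_range n"
  define P where "P a b \<longleftrightarrow> a < b \<and> (a, b) \<notin> A \<or> b < a \<and> (b, a) \<in> A" for a b
  have total: "P a b \<or> P b a" if "a \<noteq> b" for a b using that by (auto simp: P_def)
  have irrefl: "\<not> P a a" for a by (simp add: P_def)
  have antisym: "P a b \<Longrightarrow> \<not> P b a" for a b by (auto simp: P_def)
  have transP: "P a c" if S: "a \<in> ?S" "b \<in> ?S" "c \<in> ?S" and ab: "P a b" and bc: "P b c" for a b c
  proof -
    have neq: "a \<noteq> b" "b \<noteq> c" "a \<noteq> c" using ab bc irrefl antisym by blast+
    consider "a < b" "b < c" | "a < c" "c < b" | "b < a" "a < c" | "b < c" "c < a" | "c < a" "a < b" | "c < b" "b < a"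
      using neq by linarith
    then show ?thesis
    proof cases
      case 1
      then show ?thesis using ab bc cotrans[of a c b] S by (auto simp: P_def)
    next
      case 2
      then show ?thesis using ab bc trans[of a c b] by (auto simp: P_def)
    next
      case 3
      then show ?thesis using ab bc trans[of b a c] by (auto simp: P_def)
    next
      case 4
      then show ?thesis using ab bc cotrans[of b a c] S by (auto simp: P_def)
    next
      case 5
      then show ?thesis using ab bc cotrans[of c b a] S by (auto simp: P_def)
    next
      case 6
      then show ?thesis using ab bc trans[of c b a] by (auto simp: P_def)
    qed
  qed
  have symP: "P (- a) (- b) \<longleftrightarrow> P b a" for a b
  proof -
    have s: "(- a, - b) \<in> A \<longleftrightarrow> (b, a) \<in> A" for a b
      using sym[of b a] sym[of "- a" "- b"] by auto
    show ?thesis unfolding P_def s neg_less_iff_less by blast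
  qed
  define rk where "rk a = card {b \<in> ?S. P b a}" for a
  have fin: "finite {b \<in> ?S. Q b}" for Q using finite_signed_range by simp
  have rk_less: "rk a < rk b" if "a \<in> ?S" "b \<in> ?S" "P a b" for a b
    unfolding rk_def
  proof (rule psubset_card_mono[OF fin])
    have "{c \<in> ?S. P c a} \<subseteq> {c \<in> ?S. P c b}" using transP that by blast
    moreover have "a \<in> {c \<in> ?S. P c b}" "a \<notin> {c \<in> ?S. P c a}" using that irrefl by auto
    ultimately show "{c \<in> ?S. P c a} \<subset> {c \<in> ?S. P c b}" by blast
  qed
  have rk_less_iff: "rk a < rk b \<longleftrightarrow> P a b" if "a \<in> ?S" "b \<in> ?S" for a b
    using rk_less[OF that] rk_less[OF that(2,1)] total[of a b] by (metis less_asym less_irrefl)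
  have rk_minus: "rk (- a) + rk a + 1 = 2 * n" if a: "a \<in> ?S" for a
  proof -
    have "{b \<in> ?S. P b (- a)} = uminus ` {b \<in> ?S. P a b}"
    proof (rule Set.set_eqI)
      fix b
      have "b \<in> uminus ` {b \<in> ?S. P a b} \<longleftrightarrow> - b \<in> ?S \<and> P a (- b)"
        by (metis (no_types, lifting) add.inverse_inverse image_iff mem_Collect_eq)
      then show "b \<in> {b \<in> ?S. P b (- a)} \<longleftrightarrow> b \<in> uminus ` {b \<in> ?S. P a b}"
        using symP[of "- b" a] by (simp add: uminus_in_range)
    qed
    then have 1: "rk (- a) = card {b \<in> ?S. P a b}" by (simp add: rk_def card_image)
    have "?S = {b \<in> ?S. P a b} \<union> ({b \<in> ?S. P b a} \<union> {a})" using total a by blast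
    then have "card ?S = card {b \<in> ?S. P a b} + card ({b \<in> ?S. P b a} \<union> {a})"
      using fin antisym irrefl by (subst card_Un_disjoint[symmetric]) (auto simp: irrefl)
    also have "card ({b \<in> ?S. P b a} \<union> {a}) = rk a + 1"
      using fin irrefl by (simp add: rk_def)
    finally show ?thesis using 1 card_signed_range[of n] by simp
  qed
  \<comment> \<open>Ranks run from 0 to \<open>2n - 1\<close> and those of opposite values add up to
    \<open>2n - 1\<close>. Subtracting \<open>n\<close> centres them, and the extra 1 in the upper
    half skips the value 0.\<close>
  define v where "v a = (if a \<in> ?S then if n \<le> rk a then int (rk a) - int n + 1 else int (rk a) - int n else a)" for a
  have v_in: "v a \<in> ?S" if "a \<in> ?S" for a
    using rk_minus[OF that] that by (auto simp: v_def signed_range_def)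
  have v_minus: "v (- a) = - v a" for a
    using rk_minus[of a] by (auto simp: v_def uminus_in_range)
  have v_less: "v a < v b \<longleftrightarrow> P a b" if "a \<in> ?S" "b \<in> ?S" for a b
    using rk_less_iff[OF that] that by (auto simp: v_def)
  have injv: "inj_on v ?S"
  proof (rule inj_onI)
    fix a b assume "a \<in> ?S" "b \<in> ?S" "v a = v b"
    then show "a = b" using v_less[of a b] v_less[of b a] total[of a b] by auto
  qed
  have "v ` ?S = ?S"
    using v_in by (intro card_subset_eq[OF finite_signed_range] card_image[OF injv]) auto
  then have "bij_betw v ?S ?S" using injv by (simp add: bij_betw_def)
  then have "v permutes ?S" by (rule bij_imp_permutes) (simp add: v_def)
  then have "v permutes {- int n..int n}" by (rule permutes_subset) (auto simp: signed_range_def)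
  then have v: "v \<in> hyperoctahedral n" using v_minus by (simp add: hyperoctahedral_def)
  have inv_inv: "inv (inv v) = v" by (rule inv_inv_eq[OF bij_hyperoctahedral[OF v]])
  have "inversions n (inv v) = A"
  proof (rule Set.set_eqI)
    fix c :: "int \<times> int"
    obtain a b where c: "c = (a, b)" by (cases c)
    have "(a, b) \<in> inversions n (inv v) \<longleftrightarrow> a \<in> ?S \<and> b \<in> ?S \<and> a < b \<and> P b a"
      using v_less by (auto simp: inversions_def inv_inv)
    also have "\<dots> \<longleftrightarrow> (a, b) \<in> A" using sub by (auto simp: P_def)
    finally show "c \<in> inversions n (inv v) \<longleftrightarrow> c \<in> A" unfolding c .
  qed
  then show thesis using that inv_hyperoctahedral[OF v] by blast
qed

definition sortable_set :: "nat \<Rightarrow> (int \<Rightarrow> bool) \<Rightarrow> (int \<times> int) set \<Rightarrow> bool" where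
  "sortable_set n Y A \<longleftrightarrow>
    (\<forall>a b. (a, b) \<in> A \<longrightarrow> a \<in> signed_range n \<and> b \<in> signed_range n \<and> a < b \<and> (- b, - a) \<in> A) \<and>
    (\<forall>a m b. (a, m) \<in> A \<longrightarrow> (m, b) \<in> A \<longrightarrow> (a, b) \<in> A) \<and>
    (\<forall>a m b. (a, b) \<in> A \<longrightarrow> m \<in> signed_range n \<longrightarrow> a < m \<longrightarrow> m < b \<longrightarrow> (if Y m then (a, m) \<in> A else (m, b) \<in> A))"

lemma sortable_setI:
  assumes "\<And>a b. (a, b) \<in> A \<Longrightarrow> a \<in> signed_range n \<and> b \<in> signed_range n \<and> a < b"
    and "\<And>a b. (a, b) \<in> A \<Longrightarrow> (- b, - a) \<in> A"
    and "\<And>a m b. (a, m) \<in> A \<Longrightarrow> (m, b) \<in> A \<Longrightarrow> (a, b) \<in> A"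
    and "\<And>a m b. (a, b) \<in> A \<Longrightarrow> m \<in> signed_range n \<Longrightarrow> a < m \<Longrightarrow> m < b \<Longrightarrow>
      if Y m then (a, m) \<in> A else (m, b) \<in> A"
  shows "sortable_set n Y A"
  unfolding sortable_set_def
proof (intro conjI allI impI)
  fix a b assume "(a, b) \<in> A"
  then show "a \<in> signed_range n" "b \<in> signed_range n" "a < b" "(- b, - a) \<in> A"
    using assms(1,2) by blast+
next
  fix a m b assume "(a, m) \<in> A" "(m, b) \<in> A"
  then show "(a, b) \<in> A" by (rule assms(3))
next
  fix a m b assume "(a, b) \<in> A" "m \<in> signed_range n" "a < m" "m < b"
  then show "if Y m then (a, m) \<in> A else (m, b) \<in> A" by (rule assms(4))
qed

lemma sortable_setD:
  assumes "sortable_set n Y A"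
  shows "(a, b) \<in> A \<Longrightarrow> a \<in> signed_range n \<and> b \<in> signed_range n \<and> a < b"
    and "(a, b) \<in> A \<Longrightarrow> (- b, - a) \<in> A"
    and "(a, m) \<in> A \<Longrightarrow> (m, b) \<in> A \<Longrightarrow> (a, b) \<in> A"
    and "(a, b) \<in> A \<Longrightarrow> m \<in> signed_range n \<Longrightarrow> a < m \<Longrightarrow> m < b \<Longrightarrow>
      if Y m then (a, m) \<in> A else (m, b) \<in> A"
  using assms unfolding sortable_set_def by blast+

lemma aligned_iff_sortable_set:
  assumes w: "w \<in> hyperoctahedral n"
  shows "aligned n Y (inv w) \<longleftrightarrow> sortable_set n Y (inversions n w)"
proof
  assume A: "aligned n Y (inv w)"
  show "sortable_set n Y (inversions n w)"
  proof (rule sortable_setI)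
    fix a m b assume "(a, b) \<in> inversions n w" "m \<in> signed_range n" "a < m" "m < b"
    then show "if Y m then (a, m) \<in> inversions n w else (m, b) \<in> inversions n w"
      using alignedD[OF A, of a m b] by (auto simp: inversions_def split: if_splits)
  qed (use inversions_sym[OF w] in \<open>auto simp: inversions_def\<close>)
next
  assume A: "sortable_set n Y (inversions n w)"
  show "aligned n Y (inv w)"
    unfolding aligned_def
  proof (intro ballI impI)
    fix a m b assume h: "a \<in> signed_range n" "m \<in> signed_range n" "b \<in> signed_range n" "a < m" "m < b" "inv w b < inv w a"
    then have "(a, b) \<in> inversions n w" by (simp add: inversions_def)
    then have "if Y m then (a, m) \<in> inversions n w else (m, b) \<in> inversions n w"
      using sortable_setD(4)[OF A] h by blast
    then show "if Y m then inv w m < inv w a else inv w b < inv w m"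
      by (auto simp: inversions_def split: if_splits)
  qed
qed

lemma ex_sortable_set_inversions:
  assumes A: "sortable_set n Y A"
  obtains w where "w \<in> hyperoctahedral n" "inversions n w = A"
proof (rule ex_inversions[of A n])
  show "(a, m) \<in> A \<or> (m, b) \<in> A" if "(a, b) \<in> A" "m \<in> signed_range n" "a < m" "m < b" for a m b
    using sortable_setD(4)[OF A that] by (auto split: if_splits)
qed (use sortable_setD(1-3)[OF A] that in \<open>blast+\<close>)

text \<open>Ordinary coclosure is a disjunction and would not survive intersection. Here the colour
  of \<open>m\<close> selects the same alternative in all members of the family.\<close>

lemma sortable_set_INT:
  assumes "I \<noteq> {}" "\<And>i. i \<in> I \<Longrightarrow> sortable_set n Y (A i)"
  shows "sortable_set n Y (\<Inter>i\<in>I. A i)"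
proof (rule sortable_setI)
  fix a b assume ab: "(a, b) \<in> (\<Inter>i\<in>I. A i)"
  obtain i where i: "i \<in> I" using assms(1) by blast
  with ab have "(a, b) \<in> A i" by blast
  then show "a \<in> signed_range n \<and> b \<in> signed_range n \<and> a < b"
    by (rule sortable_setD(1)[OF assms(2)[OF i]])
  show "(- b, - a) \<in> (\<Inter>i\<in>I. A i)"
  proof (rule INT_I)
    fix j assume j: "j \<in> I"
    with ab have "(a, b) \<in> A j" by blast
    then show "(- b, - a) \<in> A j" by (rule sortable_setD(2)[OF assms(2)[OF j]])
  qed
next
  fix a m b assume h: "(a, m) \<in> (\<Inter>i\<in>I. A i)" "(m, b) \<in> (\<Inter>i\<in>I. A i)"
  show "(a, b) \<in> (\<Inter>i\<in>I. A i)"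
  proof (rule INT_I)
    fix j assume j: "j \<in> I"
    with h have "(a, m) \<in> A j" "(m, b) \<in> A j" by blast+
    then show "(a, b) \<in> A j" by (rule sortable_setD(3)[OF assms(2)[OF j]])
  qed
next
  fix a m b assume h: "(a, b) \<in> (\<Inter>i\<in>I. A i)" "m \<in> signed_range n" "a < m" "m < b"
  then have "if Y m then (a, m) \<in> A i else (m, b) \<in> A i" if "i \<in> I" for i
    using that by (intro sortable_setD(4)[OF assms(2)[OF that]]) auto
  then show "if Y m then (a, m) \<in> (\<Inter>i\<in>I. A i) else (m, b) \<in> (\<Inter>i\<in>I. A i)"
    by (auto split: if_splits)
qed

section \<open>Embedding the reflections into a rectangle\<close>

definition all_pairs :: "nat \<Rightarrow> (int \<times> int) set" where
  "all_pairs n = {(a, b). a \<in> signed_range n \<and> b \<in> signed_range n \<and> a < b}"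

lemma sortable_set_all_pairs: "sortable_set n Y (all_pairs n)"
  by (rule sortable_setI) (auto simp: uminus_in_range all_pairs_def)

lemma sortable_set_empty: "sortable_set n Y {}"
  unfolding sortable_set_def by simp

lemma inversions_subset_all_pairs: "inversions n w \<subseteq> all_pairs n"
  by (auto simp: inversions_def all_pairs_def)

text \<open>The ranking is chosen so that the three pairs formed by \<open>a < m < b\<close> are a chain in the product
  order on \<open>(endpoint_rank a, endpoint_rank (- b))\<close>.\<close>

definition endpoint_rank :: "nat \<Rightarrow> (int \<Rightarrow> bool) \<Rightarrow> int \<Rightarrow> nat" where
  "endpoint_rank n Y a = (if Y a then card {m \<in> signed_range n. Y m \<and> a \<le> m}
     else n + card {m \<in> signed_range n. \<not> Y m \<and> m \<le> a})"

definition pos_count :: "nat \<Rightarrow> (int \<Rightarrow> bool) \<Rightarrow> nat" where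
  "pos_count n Y = card {m \<in> signed_range n. Y m \<and> 0 < m}"

text \<open>The mirror exchanges \<open>u\<close> and \<open>v\<close>, so \<open>min\<close> and
  \<open>max\<close> identify the two pairs of one reflection. On \<open>all_pairs n\<close> the
  subtraction is never truncated, by \<open>max_rank_gt\<close>.\<close>

definition cell :: "nat \<Rightarrow> (int \<Rightarrow> bool) \<Rightarrow> int \<times> int \<Rightarrow> nat \<times> nat" where
  "cell n Y c = (let u = endpoint_rank n Y (fst c); v = endpoint_rank n Y (- snd c)
     in (min u v, max u v - pos_count n Y))"

context
  fixes n :: nat and Y :: "int \<Rightarrow> bool"
  assumes Y_minus: "\<And>m. m \<in> signed_range n \<Longrightarrow> Y (- m) \<longleftrightarrow> \<not> Y m"
begin

abbreviation (input) "endrank \<equiv> endpoint_rank n Y"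

lemma finite_filter_range: "finite {m \<in> signed_range n. Q m}"
  using finite_signed_range by simp

lemma card_filter_range_pos:
  assumes "a \<in> signed_range n" "Q a" shows "0 < card {m \<in> signed_range n. Q m}"
  unfolding card_gt_0_iff using assms finite_filter_range[of Q] by blast

lemma card_filter_range_less:
  assumes "\<And>x. Q x \<Longrightarrow> R x" "c \<in> signed_range n" "R c" "\<not> Q c"
  shows "card {m \<in> signed_range n. Q m} < card {m \<in> signed_range n. R m}"
  using assms by (intro psubset_card_mono[OF finite_filter_range]) blast

lemma card_coloured: "card {m \<in> signed_range n. Y m} = n" "card {m \<in> signed_range n. \<not> Y m} = n"
proof -
  let ?A = "{m \<in> signed_range n. Y m}" and ?B = "{m \<in> signed_range n. \<not> Y m}"
  have "?B = uminus ` ?A"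
  proof (rule Set.set_eqI)
    fix m show "m \<in> ?B \<longleftrightarrow> m \<in> uminus ` ?A"
      using Y_minus[of "- m"] by (auto simp: uminus_in_range image_iff Y_minus intro!: exI[of _ "- m"])
  qed
  then have "card ?B = card ?A" by (simp add: card_image)
  moreover have "card ?A + card ?B = 2 * n"
  proof -
    have "card ?A + card ?B = card (?A \<union> ?B)"
      by (rule card_Un_disjoint[symmetric]) (auto simp: finite_filter_range)
    also have "?A \<union> ?B = signed_range n" by blast
    finally show ?thesis by (simp add: card_signed_range)
  qed
  ultimately show "card ?A = n" "card ?B = n" by simp_all
qed

lemma rank_True:
  assumes "a \<in> signed_range n" "Y a" shows "1 \<le> endrank a" "endrank a \<le> n"
proof -
  have "0 < card {m \<in> signed_range n. Y m \<and> a \<le> m}" using assms by (intro card_filter_range_pos[of a]) auto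
  then show "1 \<le> endrank a" using assms by (simp add: endpoint_rank_def)
  have "card {m \<in> signed_range n. Y m \<and> a \<le> m} \<le> card {m \<in> signed_range n. Y m}"
    by (rule card_mono[OF finite_filter_range]) auto
  then show "endrank a \<le> n" using assms card_coloured by (simp add: endpoint_rank_def)
qed

lemma rank_False:
  assumes "a \<in> signed_range n" "\<not> Y a" shows "n < endrank a" "endrank a \<le> 2 * n"
proof -
  have "0 < card {m \<in> signed_range n. \<not> Y m \<and> m \<le> a}" using assms by (intro card_filter_range_pos[of a]) auto
  then show "n < endrank a" using assms by (simp add: endpoint_rank_def)
  have "card {m \<in> signed_range n. \<not> Y m \<and> m \<le> a} \<le> card {m \<in> signed_range n. \<not> Y m}"
    by (rule card_mono[OF finite_filter_range]) auto
  then show "endrank a \<le> 2 * n" using assms card_coloured by (simp add: endpoint_rank_def)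
qed

lemma rank_bounds: "a \<in> signed_range n \<Longrightarrow> 1 \<le> endrank a \<and> endrank a \<le> 2 * n"
  using rank_True[of a] rank_False[of a] by (cases "Y a") auto

text \<open>The ranking lists the coloured values in decreasing order and then the others in
  increasing order, so the colour of the larger of two values alone decides how their ranks
  compare.\<close>

lemma rank_less:
  assumes S: "a \<in> signed_range n" "m \<in> signed_range n" and less: "a < m"
  shows "Y m \<Longrightarrow> endrank m < endrank a" "\<not> Y m \<Longrightarrow> endrank a < endrank m"
proof -
  assume m: "Y m"
  show "endrank m < endrank a"
  proof (cases "Y a")
    case True
    have "card {x \<in> signed_range n. Y x \<and> m \<le> x} < card {x \<in> signed_range n. Y x \<and> a \<le> x}"
      using S less True by (intro card_filter_range_less[of _ _ a]) auto
    then show ?thesis using True m by (simp add: endpoint_rank_def)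
  next
    case False
    then show ?thesis using rank_True[OF S(2) m] rank_False[OF S(1)] by simp
  qed
next
  assume m: "\<not> Y m"
  show "endrank a < endrank m"
  proof (cases "Y a")
    case True
    then show ?thesis using rank_False[OF S(2) m] rank_True[OF S(1)] by simp
  next
    case False
    have "card {x \<in> signed_range n. \<not> Y x \<and> x \<le> a} < card {x \<in> signed_range n. \<not> Y x \<and> x \<le> m}"
      using S less m by (intro card_filter_range_less[of _ _ m]) auto
    then show ?thesis using False m by (simp add: endpoint_rank_def)
  qed
qed

lemma rank_inject: "a \<in> signed_range n \<Longrightarrow> b \<in> signed_range n \<Longrightarrow> endrank a = endrank b \<Longrightarrow> a = b"
  using rank_less[of a b] rank_less[of b a] by (metis linorder_neqE less_irrefl)

text \<open>By the mirror there are as many negative uncoloured values as positive coloured ones.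
  They occupy the first \<open>pos_count n Y\<close> ranks above \<open>n\<close>, and what follows
  is positive.\<close>

lemma pos_if_rank_gt:
  assumes a: "a \<in> signed_range n" "n + pos_count n Y < endrank a" shows "0 < a"
proof (rule ccontr)
  assume neg: "\<not> 0 < a"
  have X: "\<not> Y a" using rank_True(2)[OF a(1)] a(2) by fastforce
  have "{m \<in> signed_range n. \<not> Y m \<and> m \<le> a} \<subseteq> uminus ` {m \<in> signed_range n. Y m \<and> 0 < m}"
  proof
    fix m assume m: "m \<in> {m \<in> signed_range n. \<not> Y m \<and> m \<le> a}"
    then have "- m \<in> {m \<in> signed_range n. Y m \<and> 0 < m}"
      using neg Y_minus[of m] by (auto simp: uminus_in_range signed_range_def)
    then show "m \<in> uminus ` {m \<in> signed_range n. Y m \<and> 0 < m}" by (metis add.inverse_inverse imageI)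
  qed
  then have "card {m \<in> signed_range n. \<not> Y m \<and> m \<le> a} \<le> pos_count n Y"
    unfolding pos_count_def by (rule surj_card_le[OF finite_filter_range])
  then show False using a(2) X by (simp add: endpoint_rank_def)
qed

lemma pos_count_le: "pos_count n Y \<le> n"
proof -
  have "pos_count n Y \<le> card {m \<in> signed_range n. Y m}"
    unfolding pos_count_def by (rule card_mono[OF finite_filter_range]) auto
  then show ?thesis by (simp only: card_coloured)
qed

lemma pos_if_rank_le:
  assumes a: "a \<in> signed_range n" "endrank a \<le> pos_count n Y" shows "0 < a"
proof (rule ccontr)
  assume neg: "\<not> 0 < a"
  have "Y a" using rank_False(1)[OF a(1)] a(2) pos_count_le by fastforce
  have "card {m \<in> signed_range n. Y m \<and> 0 < m} < card {m \<in> signed_range n. Y m \<and> a \<le> m}"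
    using neg a(1) \<open>Y a\<close> by (intro card_filter_range_less[of _ _ a]) auto
  then show False using a(2) \<open>Y a\<close> by (simp add: endpoint_rank_def pos_count_def)
qed

lemma all_pairsD: "(a, b) \<in> all_pairs n \<Longrightarrow> a \<in> signed_range n \<and> - b \<in> signed_range n \<and> a < b"
  by (simp add: all_pairs_def uminus_in_range)

lemma max_rank_gt:
  assumes "(a, b) \<in> all_pairs n" shows "pos_count n Y < max (endrank a) (endrank (- b))"
  using all_pairsD[OF assms] pos_if_rank_le[of a] pos_if_rank_le[of "- b"] by fastforce

text \<open>Since \<open>a < b\<close>, the values \<open>a\<close> and \<open>- b\<close> are not
  both positive. Their ranks therefore neither both exceed \<open>n + pos_count n Y\<close> nor both
  stay within \<open>pos_count n Y\<close>, which bounds \<open>min\<close> above and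
  \<open>max\<close> below.\<close>

lemma cell_in_rectangle:
  assumes c: "c \<in> all_pairs n"
  shows "cell n Y c \<in> {1..n + pos_count n Y} \<times> {1..2 * n - pos_count n Y}"
proof -
  obtain a b where ab: "c = (a, b)" by (cases c)
  have S: "a \<in> signed_range n" "- b \<in> signed_range n" "a < b" using all_pairsD c ab by auto
  have "min (endrank a) (endrank (- b)) \<le> n + pos_count n Y"
    using pos_if_rank_gt[OF S(1)] pos_if_rank_gt[OF S(2)] S(3) by fastforce
  moreover have "pos_count n Y < max (endrank a) (endrank (- b))"
    using max_rank_gt c ab by simp
  ultimately show ?thesis
    using rank_bounds[OF S(1)] rank_bounds[OF S(2)] unfolding cell_def Let_def ab by auto
qed

lemma cell_eq_iff:
  assumes "(a, b) \<in> all_pairs n" "(a', b') \<in> all_pairs n"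
  shows "cell n Y (a, b) = cell n Y (a', b') \<longleftrightarrow> (a', b') = (a, b) \<or> (a', b') = (- b, - a)"
proof
  assume eq: "cell n Y (a, b) = cell n Y (a', b')"
  note S = all_pairsD[OF assms(1)] all_pairsD[OF assms(2)]
  have "min (endrank a) (endrank (- b)) = min (endrank a') (endrank (- b'))" "max (endrank a) (endrank (- b)) = max (endrank a') (endrank (- b'))"
    using eq eq_diff_iff[OF less_imp_le[OF max_rank_gt[OF assms(1)]] less_imp_le[OF max_rank_gt[OF assms(2)]]]
    by (simp_all add: cell_def Let_def)
  then have "endrank a = endrank a' \<and> endrank (- b) = endrank (- b') \<or> endrank a = endrank (- b') \<and> endrank (- b) = endrank a'"
    by (auto simp: min_def max_def split: if_splits)
  then have "a = a' \<and> - b = - b' \<or> a = - b' \<and> - b = a'"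
    using rank_inject S by blast
  then show "(a', b') = (a, b) \<or> (a', b') = (- b, - a)" by auto
qed (auto simp: cell_def Let_def min.commute max.commute)

text \<open>The first coordinates compare \<open>a\<close> with \<open>m\<close>, the second ones
  \<open>- b\<close> with \<open>- m\<close>. By \<open>rank_less\<close> the colours of
  \<open>m\<close> and \<open>- m\<close> decide, and as these are opposite, both coordinates move
  in the same direction along the chain.\<close>

lemma cell_chain:
  assumes S: "a \<in> signed_range n" "m \<in> signed_range n" "b \<in> signed_range n" and less: "a < m" "m < b"
  shows "Y m \<Longrightarrow> cell n Y (m, b) \<le> cell n Y (a, b) \<and> cell n Y (a, b) \<le> cell n Y (a, m)"
    and "\<not> Y m \<Longrightarrow> cell n Y (a, m) \<le> cell n Y (a, b) \<and> cell n Y (a, b) \<le> cell n Y (m, b)"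
proof -
  have S': "- m \<in> signed_range n" "- b \<in> signed_range n" using S by (simp_all add: uminus_in_range)
  note r1 = rank_less[OF S(1,2) less(1)]
  note r2 = rank_less[OF S'(2,1)]
  have mono: "cell n Y (x, y) \<le> cell n Y (x', y')" if "endrank x \<le> endrank x'" "endrank (- y) \<le> endrank (- y')" for x y x' y'
    using that unfolding cell_def Let_def less_eq_prod_def by (auto intro: min.mono max.mono diff_le_mono)
  show "Y m \<Longrightarrow> cell n Y (m, b) \<le> cell n Y (a, b) \<and> cell n Y (a, b) \<le> cell n Y (a, m)"
    using r1 r2 less Y_minus[OF S(2)] by (intro conjI mono) auto
  show "\<not> Y m \<Longrightarrow> cell n Y (a, m) \<le> cell n Y (a, b) \<and> cell n Y (a, b) \<le> cell n Y (m, b)"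
    using r1 r2 less Y_minus[OF S(2)] by (intro conjI mono) auto
qed

end

section \<open>The Ungarian Markov chain on Cambrian lattices\<close>

lemma set_pmf_random_subset: "finite A \<Longrightarrow> T \<in> set_pmf (random_subset p A) \<Longrightarrow> T \<subseteq> A"
  by (auto simp: random_subset_def)

text \<open>An injection transports independent coins, and the coins outside its image are
  forgotten.\<close>

lemma random_subset_vimage:
  fixes y :: "'b \<Rightarrow> 'a"
  assumes A: "finite A" and y: "inj_on y D" "y ` D \<subseteq> A" and z: "z \<notin> A"
  shows "map_pmf (\<lambda>T. {j \<in> D. y j \<in> T}) (random_subset p A) = random_subset p D"
proof -
  let ?b = "\<lambda>_. bernoulli_pmf p"
  \<comment> \<open>\<open>Pi_pmf_bij_betw\<close> asks that indices outside \<open>D\<close> be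
    sent outside the image; \<open>z\<close> is a dummy target for them.\<close>
  define h where "h j = (if j \<in> D then y j else z)" for j
  have fin: "finite D" using y A by (metis finite_imageD finite_subset)
  have "Pi_pmf D False ?b = map_pmf (\<lambda>g. g \<circ> h) (Pi_pmf (y ` D) False ?b)"
  proof (rule Pi_pmf_bij_betw[OF fin])
    show "bij_betw h D (y ` D)" using y by (auto simp: bij_betw_def h_def inj_on_def image_iff)
    show "h x \<notin> y ` D" if "x \<notin> D" for x using that y z by (auto simp: h_def)
  qed
  also have "Pi_pmf (y ` D) False ?b = map_pmf (\<lambda>f x. if x \<in> y ` D then f x else False) (Pi_pmf A False ?b)"
    by (rule Pi_pmf_subset[OF A y(2)])
  finally have "random_subset p D = map_pmf (\<lambda>f. {j \<in> D. if h j \<in> y ` D then f (h j) else False}) (Pi_pmf A False ?b)"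
    by (simp add: random_subset_def map_pmf_comp)
  also have "(\<lambda>f. {j \<in> D. if h j \<in> y ` D then f (h j) else False}) = (\<lambda>f. {j \<in> D. y j \<in> {x \<in> A. f x}})"
    using y(2) by (auto simp: h_def fun_eq_iff)
  also have "map_pmf \<dots> (Pi_pmf A False ?b) = map_pmf (\<lambda>T. {j \<in> D. y j \<in> T}) (random_subset p A)"
    by (simp add: random_subset_def map_pmf_comp)
  finally show ?thesis ..
qed

context
  fixes n :: nat and c :: "int \<Rightarrow> int"
  assumes n: "1 < n" and c: "c \<in> coxeter_elements n"
begin

abbreviation (input) "L \<equiv> Camb n c"
abbreviation (input) "Y \<equiv> colour (coxeter_word n c)"
abbreviation (input) "cells w \<equiv> cell n (colour (coxeter_word n c)) ` inversions n w"
abbreviation (input) "nrows \<equiv> n + pos_count n (colour (coxeter_word n c))"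
abbreviation (input) "ncols \<equiv> 2 * n - pos_count n (colour (coxeter_word n c))"

lemma Y_minus: "m \<in> signed_range n \<Longrightarrow> Y (- m) \<longleftrightarrow> \<not> Y m"
  by (rule colour_minus) (simp add: signed_range_def)

lemma sortable_iff: "sortable n c w \<longleftrightarrow> w \<in> hyperoctahedral n \<and> sortable_set n Y (inversions n w)"
  using sortable_iff_aligned[OF n c] aligned_iff_sortable_set by blast

lemma sortableD: "sortable n c w \<Longrightarrow> w \<in> hyperoctahedral n" "sortable n c w \<Longrightarrow> sortable_set n Y (inversions n w)"
  by (simp_all add: sortable_iff)

lemma Camb_carrier [simp]: "carrier L = {w. sortable n c w}"
  by (simp add: Camb_def)

lemma Camb_le: "sortable n c u \<Longrightarrow> sortable n c v \<Longrightarrow> u \<sqsubseteq>\<^bsub>L\<^esub> v \<longleftrightarrow> inversions n u \<subseteq> inversions n v"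
  by (simp add: Camb_def right_weak_le_iff sortableD)

lemma Camb_less: "sortable n c u \<Longrightarrow> sortable n c v \<Longrightarrow> u \<sqsubset>\<^bsub>L\<^esub> v \<longleftrightarrow> inversions n u \<subset> inversions n v"
  using Camb_le[of u v] inversions_inject[of u n v] sortableD(1)[of u] sortableD(1)[of v]
  by (auto simp: lless_def) (simp_all add: Camb_def)

lemma ex_sortable:
  assumes "sortable_set n Y A" obtains w where "sortable n c w" "inversions n w = A"
  using ex_sortable_set_inversions[OF assms] assms sortable_iff by metis

lemma finite_sortable: "finite {w. sortable n c w}"
  by (rule finite_subset[OF _ finite_hyperoctahedral]) (auto dest: sortableD)

text \<open>The intersection of the inversion sets is itself the inversion set of a sortable
  element, which is then the greatest lower bound.\<close>

lemma Camb_inf: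
  assumes A: "A \<subseteq> {w. sortable n c w}" "A \<noteq> {}"
  shows "sortable n c (\<Sqinter>\<^bsub>L\<^esub> A)" "inversions n (\<Sqinter>\<^bsub>L\<^esub> A) = (\<Inter>w\<in>A. inversions n w)"
proof -
  have "sortable_set n Y (\<Inter>w\<in>A. inversions n w)"
    using A sortableD(2) by (intro sortable_set_INT) auto
  then obtain z where z: "sortable n c z" "inversions n z = (\<Inter>w\<in>A. inversions n w)"
    by (rule ex_sortable)
  have low: "Lower L A = {u. sortable n c u \<and> inversions n u \<subseteq> (\<Inter>w\<in>A. inversions n w)}"
  proof (rule Set.set_eqI)
    fix u
    have "u \<in> Lower L A \<longleftrightarrow> sortable n c u \<and> (\<forall>w \<in> A. u \<sqsubseteq>\<^bsub>L\<^esub> w)"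
      using A(1) unfolding Lower_def Camb_carrier by blast
    also have "\<dots> \<longleftrightarrow> sortable n c u \<and> (\<forall>w \<in> A. inversions n u \<subseteq> inversions n w)"
      using A(1) Camb_le by (metis mem_Collect_eq subsetD)
    finally show "u \<in> Lower L A \<longleftrightarrow> u \<in> {u. sortable n c u \<and> inversions n u \<subseteq> (\<Inter>w\<in>A. inversions n w)}"
      unfolding mem_Collect_eq le_INF_iff .
  qed
  have "greatest L z (Lower L A)"
    unfolding greatest_def low using z Camb_le by auto
  then have "greatest L (\<Sqinter>\<^bsub>L\<^esub> A) (Lower L A)" unfolding inf_def by (rule someI[of "\<lambda>x. greatest L x (Lower L A)"])
  then have g: "sortable n c (\<Sqinter>\<^bsub>L\<^esub> A)" "inversions n (\<Sqinter>\<^bsub>L\<^esub> A) \<subseteq> (\<Inter>w\<in>A. inversions n w)"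
    "z \<sqsubseteq>\<^bsub>L\<^esub> \<Sqinter>\<^bsub>L\<^esub> A"
    using z unfolding greatest_def low by auto
  then show "sortable n c (\<Sqinter>\<^bsub>L\<^esub> A)" by blast
  show "inversions n (\<Sqinter>\<^bsub>L\<^esub> A) = (\<Inter>w\<in>A. inversions n w)"
  proof (rule subset_antisym[OF g(2)])
    show "(\<Inter>w\<in>A. inversions n w) \<subseteq> inversions n (\<Sqinter>\<^bsub>L\<^esub> A)"
      using Camb_le[OF z(1) g(1)] g(3) unfolding z(2) by simp
  qed
qed

lemma Camb_top: "sortable n c \<top>\<^bsub>L\<^esub>"
proof -
  obtain z where z: "sortable n c z" "inversions n z = all_pairs n"
    using ex_sortable[OF sortable_set_all_pairs] by blast
  have "greatest L z (carrier L)"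
    unfolding greatest_def using z Camb_le inversions_subset_all_pairs by auto
  then have "greatest L \<top>\<^bsub>L\<^esub> (carrier L)" unfolding top_def by (rule someI[of "\<lambda>x. greatest L x (carrier L)"])
  then show ?thesis by (simp add: greatest_def)
qed

lemma Camb_bottom: "sortable n c \<bottom>\<^bsub>L\<^esub>" "inversions n \<bottom>\<^bsub>L\<^esub> = {}"
proof -
  obtain z where z: "sortable n c z" "inversions n z = {}"
    using ex_sortable[OF sortable_set_empty] by blast
  have "least L z (carrier L)"
    unfolding least_def using z Camb_le by auto
  then have "least L \<bottom>\<^bsub>L\<^esub> (carrier L)" unfolding bottom_def by (rule someI[of "\<lambda>x. least L x (carrier L)"])
  then show "sortable n c \<bottom>\<^bsub>L\<^esub>" "inversions n \<bottom>\<^bsub>L\<^esub> = {}"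
    using z Camb_le unfolding least_def by auto
qed

lemma covered_by_sortable: "covered_by L x \<subseteq> {w. sortable n c w}"
  by (auto simp: covered_by_def)

lemma cells_in_rectangle: "cells w \<subseteq> {1..nrows} \<times> {1..ncols}"
  using cell_in_rectangle[where Y = Y, OF Y_minus] inversions_subset_all_pairs by blast

text \<open>By \<open>cell_chain\<close>, the pair \<open>(a, b)\<close> lies above one of its two
  parts and below the companion demanded by the colour. Removing a minimal cell thus breaks neither
  closure condition, and since a cell is a single mirror orbit, nothing sortable fits in
  between.\<close>

lemma remove_min_cell:
  assumes x: "sortable n c x" and j: "j \<in> min_cells (cells x)"
  obtains y where "y \<in> covered_by L x" "inversions n y = {d \<in> inversions n x. cell n Y d \<noteq> j}"
proof -
  let ?I = "inversions n x" and ?cell = "cell n Y"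
  let ?A = "{d \<in> ?I. ?cell d \<noteq> j}"
  have S: "sortable_set n Y ?I" by (rule sortableD(2)[OF x])
  note D = sortable_setD[OF S]
  note chain = cell_chain[where Y = Y, OF Y_minus]
  have pairs: "d \<in> all_pairs n" if "d \<in> ?I" for d using that inversions_subset_all_pairs by blast
  have min: "?cell d = j" if "d \<in> ?I" "?cell d \<le> j" for d
    using j that unfolding min_cells_def less_eq_prod_def by auto
  have mirror: "?cell (- b, - a) = ?cell (a, b)" if "(a, b) \<in> ?I" for a b
    using cell_eq_iff[where Y = Y, OF Y_minus pairs pairs, of a b "- b" "- a"] that D(2) by auto
  have A: "sortable_set n Y ?A"
  proof (rule sortable_setI)
    fix a b assume ab: "(a, b) \<in> ?A"
    then show "a \<in> signed_range n \<and> b \<in> signed_range n \<and> a < b" using D(1) by blast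
    show "(- b, - a) \<in> ?A" using ab D(2) mirror by auto
  next
    fix a m b assume h: "(a, m) \<in> ?A" "(m, b) \<in> ?A"
    then have ab: "(a, b) \<in> ?I" using D(3) by blast
    have r: "a \<in> signed_range n" "m \<in> signed_range n" "b \<in> signed_range n" "a < m" "m < b"
      using h D(1) by blast+
    have "?cell (a, b) \<noteq> j"
    proof
      assume "?cell (a, b) = j"
      then have "?cell (m, b) \<le> j \<or> ?cell (a, m) \<le> j"
        using chain[OF _ r] by (cases "Y m") auto
      then show False using min h by blast
    qed
    with ab show "(a, b) \<in> ?A" by blast
  next
    fix a m b assume h: "(a, b) \<in> ?A" "m \<in> signed_range n" "a < m" "m < b"
    have r: "a \<in> signed_range n" "b \<in> signed_range n" using h D(1) by blast+
    have I: "if Y m then (a, m) \<in> ?I else (m, b) \<in> ?I" using D(4)[of a b m] h by blast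
    note ch = chain[OF _ r(1) h(2) r(2) h(3,4)]
    show "if Y m then (a, m) \<in> ?A else (m, b) \<in> ?A"
    proof (cases "Y m")
      case True
      then have "?cell (a, b) \<le> ?cell (a, m)" using ch by auto
      then have "?cell (a, m) \<noteq> j" using min[of "(a, b)"] h(1) by blast
      then show ?thesis using True I by simp
    next
      case False
      then have "?cell (a, b) \<le> ?cell (m, b)" using ch by auto
      then have "?cell (m, b) \<noteq> j" using min[of "(a, b)"] h(1) by blast
      then show ?thesis using False I by simp
    qed
  qed
  obtain y where y: "sortable n c y" "inversions n y = ?A" using ex_sortable[OF A] .
  obtain d0 where d0: "d0 \<in> ?I" "?cell d0 = j" using j by (auto simp: min_cells_def)
  have less: "y \<sqsubset>\<^bsub>L\<^esub> x" using Camb_less[OF y(1) x] y(2) d0 by blast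
  have "\<not> (y \<sqsubset>\<^bsub>L\<^esub> z \<and> z \<sqsubset>\<^bsub>L\<^esub> x)" if z: "sortable n c z" for z
  proof
    assume yzx: "y \<sqsubset>\<^bsub>L\<^esub> z \<and> z \<sqsubset>\<^bsub>L\<^esub> x"
    then have yz: "?A \<subset> inversions n z" and zx: "inversions n z \<subset> ?I"
      using Camb_less y x z by auto
    then obtain d where d: "d \<in> inversions n z" "d \<in> ?I" "?cell d = j" by blast
    have "d' \<in> inversions n z" if d': "d' \<in> ?I" "?cell d' = j" for d'
    proof -
      obtain a b a' b' where ab: "d = (a, b)" "d' = (a', b')" by (cases d, cases d')
      have "d' = d \<or> d' = (- b, - a)"
        using cell_eq_iff[where Y = Y, OF Y_minus pairs pairs, of a b a' b'] d d' unfolding ab by simp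
      then show ?thesis using d(1) sortable_setD(2)[OF sortableD(2)[OF z]] ab by blast
    qed
    then have "?I \<subseteq> inversions n z" using yz by blast
    with zx show False by blast
  qed
  then have "y \<in> covered_by L x" unfolding covered_by_def using y(1) less by auto
  then show thesis using that y(2) by blast
qed

lemma ungarian_kernel_sortable:
  assumes x: "sortable n c x" and z: "z \<in> set_pmf (ungarian_kernel L p x)"
  shows "sortable n c z" "inversions n z \<subseteq> inversions n x"
proof -
  have fin: "finite (covered_by L x)" using finite_subset[OF covered_by_sortable finite_sortable] .
  obtain T where T: "T \<subseteq> covered_by L x" "z = \<Sqinter>\<^bsub>L\<^esub> ({x} \<union> T)"
    using z set_pmf_random_subset[OF fin] by (auto simp: ungarian_kernel_def)
  have "{x} \<union> T \<subseteq> {w. sortable n c w}" using T(1) covered_by_sortable x by blast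
  from Camb_inf[OF this] show "sortable n c z" "inversions n z \<subseteq> inversions n x"
    unfolding T(2) by auto
qed

text \<open>Distinct minimal cells give distinct covered elements, so their selections are
  independent coins, and the meet loses at least the selected cells. What other covered elements
  remove in addition is absorbed by \<open>expected_lpp_mono\<close>.\<close>

lemma ungarian_drift:
  assumes x: "sortable n c x" and p: "0 < p" "p \<le> 1"
  shows "indicator (- {\<bottom>\<^bsub>L\<^esub>}) x + (\<integral>\<^sup>+ z. expected_lpp p nrows ncols (cells z) \<partial>ungarian_kernel L p x)
    \<le> expected_lpp p nrows ncols (cells x)"
proof (cases "x = \<bottom>\<^bsub>L\<^esub>")
  case True
  have "(\<integral>\<^sup>+ z. expected_lpp p nrows ncols (cells z) \<partial>ungarian_kernel L p x)
      \<le> (\<integral>\<^sup>+ z. expected_lpp p nrows ncols (cells x) \<partial>ungarian_kernel L p x)"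
    using ungarian_kernel_sortable(2)[OF x]
    by (intro nn_integral_mono_AE AE_pmfI expected_lpp_mono image_mono)
  then show ?thesis using True by simp
next
  case False
  let ?V = "expected_lpp p nrows ncols" and ?cell = "cell n Y"
  let ?D = "min_cells (cells x)" and ?cov = "covered_by L x"
  have fin: "finite ?cov" using finite_subset[OF covered_by_sortable finite_sortable] .
  have "inversions n x \<noteq> {}"
    using False inversions_inject[of x n "\<bottom>\<^bsub>L\<^esub>"] Camb_bottom sortableD(1) x by metis
  then have ne: "cells x \<noteq> {}" by simp
  have ex: "\<exists>y. y \<in> ?cov \<and> inversions n y = {d \<in> inversions n x. ?cell d \<noteq> j}" if "j \<in> ?D" for j
    by (rule remove_min_cell[OF x that]) blast
  define y where "y j = (SOME y. y \<in> ?cov \<and> inversions n y = {d \<in> inversions n x. ?cell d \<noteq> j})" for j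
  have y: "y j \<in> ?cov" "inversions n (y j) = {d \<in> inversions n x. ?cell d \<noteq> j}" if "j \<in> ?D" for j
    using someI_ex[OF ex[OF that]] unfolding y_def by blast+
  have cells_y: "cells (y j) = cells x - {j}" if "j \<in> ?D" for j using y(2)[OF that] by auto
  have "inj_on y ?D"
  proof (rule inj_onI)
    fix i j assume ij: "i \<in> ?D" "j \<in> ?D" "y i = y j"
    then have "cells x - {i} = cells x - {j}" using cells_y by metis
    moreover have "i \<in> cells x" using ij by (simp add: min_cells_def)
    ultimately show "i = j" by blast
  qed
  moreover have "y ` ?D \<subseteq> ?cov" using y(1) by blast
  \<comment> \<open>The dummy for \<open>random_subset_vimage\<close>: a function that is not
    bijective is no element of the lattice.\<close>
  moreover have "(\<lambda>_. 0) \<notin> ?cov"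
  proof
    assume "(\<lambda>_. 0) \<in> ?cov"
    then have "bij (\<lambda>_::int. 0::int)" using covered_by_sortable sortableD(1) bij_hyperoctahedral by blast
    then show False by (metis bij_pointE zero_neq_one)
  qed
  ultimately have law: "map_pmf (\<lambda>T. {j \<in> ?D. y j \<in> T}) (random_subset p ?cov) = random_subset p ?D"
    using random_subset_vimage[OF fin] by blast
  have "(\<integral>\<^sup>+ z. ?V (cells z) \<partial>ungarian_kernel L p x)
      = (\<integral>\<^sup>+ T. ?V (cells (\<Sqinter>\<^bsub>L\<^esub> ({x} \<union> T))) \<partial>random_subset p ?cov)"
    by (simp add: ungarian_kernel_def)
  also have "\<dots> \<le> (\<integral>\<^sup>+ T. ?V (cells x - {j \<in> ?D. y j \<in> T}) \<partial>random_subset p ?cov)"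
  proof (intro nn_integral_mono_AE AE_pmfI expected_lpp_mono)
    fix T assume "T \<in> set_pmf (random_subset p ?cov)"
    then have T: "T \<subseteq> ?cov" by (rule set_pmf_random_subset[OF fin])
    then have "{x} \<union> T \<subseteq> {w. sortable n c w}" using covered_by_sortable x by blast
    from Camb_inf(2)[OF this] have I: "inversions n (\<Sqinter>\<^bsub>L\<^esub> ({x} \<union> T)) = (\<Inter>w\<in>{x} \<union> T. inversions n w)" by simp
    show "cells (\<Sqinter>\<^bsub>L\<^esub> ({x} \<union> T)) \<subseteq> cells x - {j \<in> ?D. y j \<in> T}"
    proof
      fix e assume "e \<in> cells (\<Sqinter>\<^bsub>L\<^esub> ({x} \<union> T))"
      then obtain d where d: "e = ?cell d" "d \<in> inversions n x" "\<And>w. w \<in> T \<Longrightarrow> d \<in> inversions n w"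
        unfolding I by blast
      have "y e \<notin> T" if e: "e \<in> ?D"
      proof
        assume "y e \<in> T"
        then have "d \<in> inversions n (y e)" by (rule d(3))
        then show False using y(2)[OF e] d(1) by blast
      qed
      then show "e \<in> cells x - {j \<in> ?D. y j \<in> T}" using d(1,2) by blast
    qed
  qed
  also have "\<dots> = (\<integral>\<^sup>+ R. ?V (cells x - R) \<partial>random_subset p ?D)"
    unfolding law[symmetric] by simp
  finally have "1 + (\<integral>\<^sup>+ z. ?V (cells z) \<partial>ungarian_kernel L p x) \<le> 1 + (\<integral>\<^sup>+ R. ?V (cells x - R) \<partial>random_subset p ?D)"
    by (rule add_left_mono)
  also have "\<dots> \<le> ?V (cells x)"
    by (rule expected_lpp_drift[OF cells_in_rectangle ne p])
  finally show ?thesis using False by simp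
qed

text \<open>A coloured value \<open>m\<close> with \<open>0 < m < n\<close> is an edge oriented from
  \<open>m - 1\<close> to \<open>m\<close>; the extra 1 is the value \<open>n\<close>, which is
  always coloured.\<close>

lemma pos_count_cox_r: "pos_count n Y = cox_r n c + 1"
proof -
  let ?cw = "coxeter_word n c"
  have "coxeter_word_for n ?cw c"
    using c unfolding coxeter_word_def coxeter_elements_def by (auto intro: someI)
  then have cw: "distinct ?cw" "set ?cw = {..<n}" by (auto simp: coxeter_word_for_def)
  have order: "\<not> appears_left_of ?cw b a \<longleftrightarrow> appears_left_of ?cw a b" if ab: "a < n" "b < n" "a \<noteq> b" for a b
  proof -
    obtain j k where jk: "j < length ?cw" "k < length ?cw" "?cw ! j = a" "?cw ! k = b"
      using cw(2) ab by (metis in_set_conv_nth lessThan_iff)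
    have uniq: "i = j" if "i < length ?cw" "?cw ! i = a" for i
      using nth_eq_iff_index_eq[OF cw(1) that(1) jk(1)] that(2) jk(3) by simp
    have uniq': "i = k" if "i < length ?cw" "?cw ! i = b" for i
      using nth_eq_iff_index_eq[OF cw(1) that(1) jk(2)] that(2) jk(4) by simp
    have "appears_left_of ?cw a b \<longleftrightarrow> j < k" "appears_left_of ?cw b a \<longleftrightarrow> k < j"
      unfolding appears_left_of_def using jk uniq uniq' by (metis less_trans)+
    then show ?thesis using ab(3) jk by auto
  qed
  let ?E = "{i. i + 1 < n \<and> appears_left_of ?cw i (i + 1)}"
  have fin: "finite ?E" by (rule finite_subset[of _ "{..<n}"]) auto
  have last: "\<not> appears_left_of ?cw n (n - 1)"
    using appears_left_of_set[of ?cw n "n - 1"] cw(2) by auto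
  have "{m \<in> signed_range n. Y m \<and> 0 < m} = (\<lambda>i. int (i + 1)) ` insert (n - 1) ?E"
  proof (rule Set.set_eqI, rule iffI)
    fix m assume m: "m \<in> {m \<in> signed_range n. Y m \<and> 0 < m}"
    then obtain i where i: "m = int (Suc i)" by (metis mem_Collect_eq zero_less_imp_eq_int Suc_pred')
    have "i < n" using m i by (simp add: signed_range_def)
    have "\<not> appears_left_of ?cw (Suc i) i" using m i by (simp add: colour_def nat_add_distrib)
    then have "i = n - 1 \<or> i \<in> ?E" using order[of i "Suc i"] \<open>i < n\<close> by auto
    then show "m \<in> (\<lambda>i. int (i + 1)) ` insert (n - 1) ?E" using i by auto
  next
    fix m assume "m \<in> (\<lambda>i. int (i + 1)) ` insert (n - 1) ?E"
    then obtain i where i: "m = int (Suc i)" "i = n - 1 \<or> i \<in> ?E" by auto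
    then have "i < n" using n by auto
    have "\<not> appears_left_of ?cw (Suc i) i"
    proof (cases "i = n - 1")
      case True
      then show ?thesis using last n by simp
    next
      case False
      then show ?thesis using i(2) order[of i "Suc i"] by auto
    qed
    then show "m \<in> {m \<in> signed_range n. Y m \<and> 0 < m}"
      using i(1) \<open>i < n\<close> by (simp add: colour_def signed_range_def nat_add_distrib)
  qed
  then have "pos_count n Y = card (insert (n - 1) ?E)"
    unfolding pos_count_def by (simp only:) (rule card_image, simp add: inj_on_def)
  also have "\<dots> = card ?E + 1" using fin n by simp
  finally show ?thesis by (simp add: cox_r_def)
qed

lemma pos_count_colour_le: "pos_count n Y \<le> n"
  by (rule pos_count_le) (rule Y_minus)

lemma cox_r_less: "cox_r n c < n"
  using pos_count_colour_le pos_count_cox_r by simp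

lemma expected_ungarian_steps_Camb_le:
  assumes p: "0 < p" "p \<le> 1"
  shows "expected_ungarian_steps p L \<le> ennreal
    ((3 * real n + 2 * sqrt ((1 - p) * (real n + real (cox_r n c) + 1) * (2 * real n - real (cox_r n c) - 1))) / p)"
proof -
  let ?V = "\<lambda>w. expected_lpp p nrows ncols (cells w)"
  note l = pos_count_colour_le
  have "expected_ungarian_steps p L \<le> (\<integral>\<^sup>+ x. ?V x \<partial>return_pmf \<top>\<^bsub>L\<^esub>)"
    unfolding expected_ungarian_steps_def
  proof (rule expected_hitting_time_le[where C = "{w. sortable n c w}"])
    show "set_pmf (return_pmf \<top>\<^bsub>L\<^esub>) \<subseteq> {w. sortable n c w}" using Camb_top by simp
    show "set_pmf (ungarian_kernel L p x) \<subseteq> {w. sortable n c w}" if "x \<in> {w. sortable n c w}" for x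
      using ungarian_kernel_sortable(1) that by blast
    show "indicator (- {\<bottom>\<^bsub>L\<^esub>}) x + (\<integral>\<^sup>+ z. ?V z \<partial>ungarian_kernel L p x) \<le> ?V x"
      if "x \<in> {w. sortable n c w}" for x
      using ungarian_drift[OF _ p] that by simp
  qed
  also have "\<dots> = ?V \<top>\<^bsub>L\<^esub>" by simp
  also have "\<dots> \<le> ennreal ((real nrows + real ncols + 2 * sqrt ((1 - p) * real nrows * real ncols)) / p)"
    using n l by (intro expected_lpp_le[OF p _ _ cells_in_rectangle]) auto
  also have "real nrows + real ncols = 3 * real n" using l by simp
  also have "real nrows = real n + real (cox_r n c) + 1" by (simp add: pos_count_cox_r)
  also have "real ncols = 2 * real n - real (cox_r n c) - 1" using l by (simp add: pos_count_cox_r of_nat_diff)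
  finally show ?thesis .
qed

end

theorem theorem1p15:
  fixes p rbar :: real and c :: "nat \<Rightarrow> int \<Rightarrow> int"
  assumes "0 < p" and "p \<le> 1"
    and "\<And>n. n \<ge> 2 \<Longrightarrow> c n \<in> coxeter_elements n"
    and "(\<lambda>n. real (cox_r n (c n)) / real n) \<longlonglongrightarrow> rbar"
  shows "\<exists>g :: nat \<Rightarrow> real. g \<in> o(\<lambda>n. real n) \<and>
           (\<forall>n\<ge>2. enn2ereal (expected_ungarian_steps p (Camb n (c n)))
              \<le> ereal (1 / p * (3 + 2 * sqrt ((1 - p) * (2 - rbar) * (1 + rbar))) * real n + g n))"
proof -
  define r where "r n = real (cox_r n (c n))" for n
  \<comment> \<open>The bound at finite \<open>n\<close>; the witness for the error term will be
    \<open>B n - K * real n\<close>.\<close>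
  define B where "B n = (3 * real n + 2 * sqrt ((1 - p) * (real n + r n + 1) * (2 * real n - r n - 1))) / p" for n
  define K where "K = 1 / p * (3 + 2 * sqrt ((1 - p) * (2 - rbar) * (1 + rbar)))"
  have lim: "(\<lambda>n. (3 + 2 * sqrt ((1 - p) * (1 + r n / real n + 1 / real n) * (2 - r n / real n - 1 / real n))) / p)
      \<longlonglongrightarrow> (3 + 2 * sqrt ((1 - p) * (1 + rbar + 0) * (2 - rbar - 0))) / p"
    using assms(1,4) unfolding r_def by (intro tendsto_intros lim_1_over_n) auto
  have scaled: "(3 + 2 * sqrt ((1 - p) * (1 + r n / real n + 1 / real n) * (2 - r n / real n - 1 / real n))) / p = B n / real n"
    if n: "n > 0" for n
  proof -
    have "(1 - p) * (1 + r n / real n + 1 / real n) * (2 - r n / real n - 1 / real n)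
        = (1 - p) * (real n + r n + 1) * (2 * real n - r n - 1) / (real n)\<^sup>2"
      using n by (simp add: field_simps power2_eq_square)
    then have "sqrt ((1 - p) * (1 + r n / real n + 1 / real n) * (2 - r n / real n - 1 / real n))
        = sqrt ((1 - p) * (real n + r n + 1) * (2 * real n - r n - 1)) / real n"
      by (simp add: real_sqrt_divide)
    then show ?thesis using n assms(1) by (simp add: B_def field_simps)
  qed
  have "(\<lambda>n. B n / real n) \<longlonglongrightarrow> (3 + 2 * sqrt ((1 - p) * (1 + rbar + 0) * (2 - rbar - 0))) / p"
    by (rule Lim_transform_eventually[OF lim eventually_mono[OF eventually_gt_at_top[of 0] scaled]])
  also have "(3 + 2 * sqrt ((1 - p) * (1 + rbar + 0) * (2 - rbar - 0))) / p = K"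
    by (simp add: K_def mult_ac)
  finally have "(\<lambda>n. B n / real n - K) \<longlonglongrightarrow> 0" by (rule LIM_zero)
  moreover have "eventually (\<lambda>n. B n / real n - K = (B n - K * real n) / real n) at_top"
    using eventually_gt_at_top[of "0::nat"] by eventually_elim (simp add: field_simps)
  ultimately have "(\<lambda>n. (B n - K * real n) / real n) \<longlonglongrightarrow> 0"
    by (rule Lim_transform_eventually)
  then have "(\<lambda>n. B n - K * real n) \<in> o(\<lambda>n. real n)"
    by (rule smalloI_tendsto) (use eventually_gt_at_top[of "0::nat"] in \<open>auto elim: eventually_mono\<close>)
  moreover have "enn2ereal (expected_ungarian_steps p (Camb n (c n))) \<le> ereal (K * real n + (B n - K * real n))"
    if n: "n \<ge> 2" for n
  proof -
    have "expected_ungarian_steps p (Camb n (c n)) \<le> ennreal (B n)"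
      unfolding B_def r_def using n assms by (intro expected_ungarian_steps_Camb_le) auto
    \<comment> \<open>\<open>ennreal\<close> sends negative numbers to 0, so the passage back to
      \<open>ereal\<close> relies on this sign.\<close>
    moreover have "0 \<le> B n"
      using cox_r_less[of n "c n"] n assms unfolding B_def r_def
      by (intro divide_nonneg_pos add_nonneg_nonneg mult_nonneg_nonneg real_sqrt_ge_zero) auto
    ultimately show ?thesis by (simp add: less_eq_ennreal.rep_eq enn2ereal_ennreal)
  qed
  ultimately show ?thesis unfolding K_def by blast
qed

end
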